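(* Let $n\geq 1$ and let $\mathfrak{a}\subseteq\mathbb{C}[x_1,\ldots,x_n]$ be a nonzero monomial ideal, with Bernstein-Sato polynomial $b_{\mathfrak{a}}(s)$ and Newton polyhedron $P_{\mathfrak{a}}$. Then the set of roots of $b_{\mathfrak{a}}(s)$ (without multiplicities) is $$\bigcup_{Q} R_Q,$$ where $Q$ runs over all proper faces (of any dimension) of $P_{\mathfrak{a}}$ that are not contained in any coordinate hyperplane $\{x_i=0\}$, $1\le i\le n$.
   Context: **Monomial data.** For $u\in\mathbb{Z}_{\geq 0}^n$ write $x^u=x_1^{u_1}\cdots x_n^{u_n}$. For a nonzero monomial ideal $\mathfrak{a}$ (an ideal generated by monomials) put $\Gamma_{\mathfrak{a}}=\{u\in\mathbb{Z}_{\ge 0}^n\mid x^u\in\mathfrak{a}\}$. The Newton polyhedron $P_{\mathfrak{a}}$ is the convex hull of $\Gamma_{\mathfrak{a}}$ in $\mathbb{R}_{\ge 0}^n$. Let $e=(1,\ldots,1)\in\mathbb{Z}^n$. **The sets $M_Q$, $M_Q'$, $R_Q$.** For a face $Q$ of $P_{\mathfrak{a}}$, let $M_Q=e+S_Q$, where $S_Q$ is the subsemigroup of $\mathbb{Z}^n$ generated by all elements $u-v$ with $u\in\Gamma_{\mathfrak{a}}$ and $v\in\Gamma_{\mathfrak{a}}\cap Q$. Put $M_Q'=v_0+M_Q$ for any $v_0\in\Gamma_{\mathfrak{a}}\cap Q$; this is a subset of $M_Q$ independent of the choice of $v_0$. Let $V_Q\subseteq\mathbb{R}^n$ be the linear subspace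 generated by $Q$. If a proper face $Q$ is not contained in any coordinate hyperplane, its affine span does not contain the origin, and there is a (not necessarily unique) linear function $L_Q$ on $\mathbb{R}^n$ with rational coefficients such that $L_Q=1$ on $Q$. For such $Q$ define $$R_Q=\{-L_Q(u)\mid u\in (M_Q\smallsetminus M_Q')\cap V_Q\},$$ which does not depend on the choice of $L_Q$. **Bernstein-Sato polynomial.** Let $\mathcal{D}=\mathbb{C}[x_1,\ldots,x_n]\langle\partial_{x_1},\ldots,\partial_{x_n}\rangle$ be the Weyl algebra. Let $f_1,\ldots,f_r$ be nonzero generators of $\mathfrak{a}$ (for example monomials), and let $s_1,\ldots,s_r$ be independent variables. The ring $\mathcal{D}$ acts naturally on $$\mathbb{C}[x_1,\ldots,x_n]\Big[\prod_i f_i^{-1},s_1,\ldots,s_r\Big]\prod_i f_i^{s_i},$$ with $\partial_{x_k}\prod_i f_i^{s_i}=\sum_i s_i\frac{\partial f_i}{\partial x_k}f_i^{-1}\prod_j f_j^{s_j}$. Let $t_i$ be the $\mathcal{D}$-linear invertible operator on this module induced by $s_i\mapsto s_i+1$, $s_j\mapsto s_j$ for $j\ne i$ (so $t_i(h(x,\ldots,s_i,\ldots)\prod_j f_j^{s_j})=h(x,\ldots,s_i+1,\ldots)\,f_i\prod_j f_j^{s_j}$). Put $s_{i,j}=s_it_i^{-1}t_j$ and $s=\sum_i s_i$. The Bernstein-Sato polynomial $b_{\mathfrak{a}}(s)=b_f(s)$ is the monic polynomial in one variable of smallest degree such that $$b_f(s)\prod_i f_i^{s_i}=\sum_{k=1}^r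 P_kt_k\prod_i f_i^{s_i}$$ for some $P_k$ in the ring generated by $\mathcal{D}$ and the $s_{i,j}$ ($1\le i,j\le r$). Equivalently, it is the monic polynomial of smallest degree such that $b_f(\sum_i s_i)\prod_i f_i^{s_i}$ belongs to the $\mathcal{D}[s_1,\ldots,s_r]$-submodule generated by the elements $$\prod_{i:\,c_i<0}\binom{s_i}{-c_i}\cdot\prod_{i=1}^r f_i^{s_i+c_i},$$ where $(c_1,\ldots,c_r)$ runs over the elements of $\mathbb{Z}^r$ with $\sum_i c_i=1$, and $\binom{s_i}{m}=s_i(s_i-1)\cdots(s_i-m+1)/m!$. It is known that $b_{\mathfrak{a}}$ depends only on $\mathfrak{a}$, not on the choice of generators. *)

theory Defs
  imports
    "HOL-Analysis.Analysis"
    "HOL-Library.Poly_Mapping"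
    "HOL-Computational_Algebra.Polynomial"
    "HOL-Computational_Algebra.Fraction_Field"
begin

section \<open>Monomial ideals in \<open>\<complex>[x\<^sub>1, \<dots>, x\<^sub>n]\<close>\<close>

text \<open>
  The variables are indexed by a nonempty finite type \<open>'n\<close>, so that \<open>n = CARD('n)\<close>.
  The linear order on \<open>'n\<close> (\<open>x\<^sub>1, \<dots>, x\<^sub>n\<close> are numbered) is there because the library derives
  from it that the polynomial ring is an integral domain, which \<open>fract\<close> requires.
\<close>

type_synonym 'n cpoly = "('n \<Rightarrow>\<^sub>0 nat) \<Rightarrow>\<^sub>0 complex"

definition xmonom :: "('n \<Rightarrow>\<^sub>0 nat) \<Rightarrow> 'n cpoly" where
  "xmonom u = Poly_Mapping.single u 1"

abbreviation ideal_gen :: "'a::comm_ring_1 set \<Rightarrow> 'a set" where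
  "ideal_gen \<equiv> module.span (*)"

definition monomial_ideal :: "'n cpoly set \<Rightarrow> bool" where
  "monomial_ideal I \<longleftrightarrow> (\<exists>U. I = ideal_gen (xmonom ` U))"


section \<open>Newton polyhedron\<close>

definition expvec :: "('n::finite \<Rightarrow>\<^sub>0 nat) \<Rightarrow> real ^ 'n" where
  "expvec u = (\<chi> i. real (Poly_Mapping.lookup u i))"

definition Gam :: "'n::finite cpoly set \<Rightarrow> (real ^ 'n) set" where
  "Gam I = {expvec u | u. xmonom u \<in> I}"

definition newton_polyhedron :: "'n::finite cpoly set \<Rightarrow> (real ^ 'n) set" where
  "newton_polyhedron I = convex hull (Gam I)"


section \<open>The sets \<open>M\<^sub>Q\<close>, \<open>M'\<^sub>Q\<close> and \<open>R\<^sub>Q\<close>\<close>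

text \<open>All lattice points are regarded as points of \<open>\<real>\<^sup>n\<close>.\<close>

inductive_set subsemigroup_gen :: "'a::semigroup_add set \<Rightarrow> 'a set" for G where
  gen: "g \<in> G \<Longrightarrow> g \<in> subsemigroup_gen G"
| add: "a \<in> subsemigroup_gen G \<Longrightarrow> b \<in> subsemigroup_gen G \<Longrightarrow> a + b \<in> subsemigroup_gen G"

definition S_face :: "'n::finite cpoly set \<Rightarrow> (real ^ 'n) set \<Rightarrow> (real ^ 'n) set" where
  "S_face I Q = subsemigroup_gen {u - v | u v. u \<in> Gam I \<and> v \<in> Gam I \<inter> Q}"

definition M_face :: "'n::finite cpoly set \<Rightarrow> (real ^ 'n) set \<Rightarrow> (real ^ 'n) set" where
  "M_face I Q = (\<lambda>w. (\<chi> i. 1) + w) ` S_face I Q"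

text \<open>
  The base point \<open>v\<^sub>0\<close> and the linear function \<open>L\<^sub>Q\<close> are arbitrary choices; the sets \<open>M'\<^sub>Q\<close> and
  \<open>R\<^sub>Q\<close> do not depend on them.
\<close>

definition M'_face :: "'n::finite cpoly set \<Rightarrow> (real ^ 'n) set \<Rightarrow> (real ^ 'n) set" where
  "M'_face I Q = (\<lambda>w. (SOME v0. v0 \<in> Gam I \<inter> Q) + w) ` M_face I Q"

definition L_face :: "(real ^ 'n::finite) set \<Rightarrow> real ^ 'n \<Rightarrow> real" where
  "L_face Q = (SOME L. linear L \<and> (\<forall>i. L (axis i 1) \<in> \<rat>) \<and> (\<forall>x\<in>Q. L x = 1))"

definition R_face :: "'n::finite cpoly set \<Rightarrow> (real ^ 'n) set \<Rightarrow> real set" where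
  "R_face I Q = {- L_face Q u | u. u \<in> (M_face I Q - M'_face I Q) \<inter> span Q}"

text \<open>The empty face lies in every coordinate hyperplane, so it is excluded.\<close>

definition relevant_faces :: "'n::finite cpoly set \<Rightarrow> (real ^ 'n) set set" where
  "relevant_faces I = {Q. Q face_of newton_polyhedron I \<and> Q \<noteq> newton_polyhedron I
      \<and> \<not> (\<exists>i. Q \<subseteq> {x. x $ i = 0})}"


section \<open>Partial derivatives\<close>

definition xderiv :: "'n \<Rightarrow> 'n cpoly \<Rightarrow> 'n cpoly" where
  "xderiv k p = (\<Sum>u\<in>Poly_Mapping.keys p. Poly_Mapping.single (u - Poly_Mapping.single k 1)
      (of_nat (Poly_Mapping.lookup u k) * Poly_Mapping.lookup p u))"

lemma xderiv_superset:
  assumes "finite A" "Poly_Mapping.keys p \<subseteq> A"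
  shows "xderiv k p = (\<Sum>u\<in>A. Poly_Mapping.single (u - Poly_Mapping.single k 1)
      (of_nat (Poly_Mapping.lookup u k) * Poly_Mapping.lookup p u))"
  unfolding xderiv_def
  by (rule sum.mono_neutral_left) (use assms in \<open>auto simp: in_keys_iff\<close>)

lemma xderiv_zero: "xderiv k 0 = 0"
  by (simp add: xderiv_def)

lemma xderiv_add: "xderiv k (p + q) = xderiv k p + xderiv k q"
proof -
  let ?A = "Poly_Mapping.keys p \<union> Poly_Mapping.keys q"
  have "Poly_Mapping.keys (p + q) \<subseteq> ?A" by (rule Poly_Mapping.keys_add)
  then show ?thesis
    by (subst (1 2 3) xderiv_superset[of ?A])
      (auto simp: Poly_Mapping.lookup_add distrib_left Poly_Mapping.single_add sum.distrib)
qed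

lemma xderiv_sum: "xderiv k (sum g A) = (\<Sum>a\<in>A. xderiv k (g a))"
  by (induction A rule: infinite_finite_induct) (auto simp: xderiv_zero xderiv_add)

lemma xderiv_single: "xderiv k (Poly_Mapping.single u c) =
    Poly_Mapping.single (u - Poly_Mapping.single k 1) (of_nat (Poly_Mapping.lookup u k) * c)"
  by (cases "c = 0") (auto simp: xderiv_def)

lemma poly_mapping_sum_single:
  "p = (\<Sum>u\<in>Poly_Mapping.keys p. Poly_Mapping.single u (Poly_Mapping.lookup p u))"
  by (rule poly_mapping_eqI)
    (auto simp: Poly_Mapping.lookup_sum Poly_Mapping.lookup_single when_def in_keys_iff)

lemma exponent_diff_add:
  fixes u v :: "'n \<Rightarrow>\<^sub>0 nat"
  assumes "Poly_Mapping.lookup u k > 0"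
  shows "u - Poly_Mapping.single k 1 + v = u + v - Poly_Mapping.single k 1"
  using assms
  by (intro poly_mapping_eqI)
    (auto simp: Poly_Mapping.lookup_add Poly_Mapping.lookup_minus Poly_Mapping.lookup_single when_def)

lemma xderiv_mult_single:
  "xderiv k (Poly_Mapping.single u c * Poly_Mapping.single v d) =
     xderiv k (Poly_Mapping.single u c) * Poly_Mapping.single v d
   + Poly_Mapping.single u c * xderiv k (Poly_Mapping.single v d)"
proof -
  have 1: "Poly_Mapping.single (u - Poly_Mapping.single k 1 + v) (of_nat (Poly_Mapping.lookup u k) * c * d)
      = Poly_Mapping.single (u + v - Poly_Mapping.single k 1) (of_nat (Poly_Mapping.lookup u k) * c * d)"
    by (cases "Poly_Mapping.lookup u k = 0") (use exponent_diff_add[of u k v] in auto)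
  have 2: "Poly_Mapping.single (u + (v - Poly_Mapping.single k 1)) (c * (of_nat (Poly_Mapping.lookup v k) * d))
      = Poly_Mapping.single (u + v - Poly_Mapping.single k 1) (c * (of_nat (Poly_Mapping.lookup v k) * d))"
    by (cases "Poly_Mapping.lookup v k = 0")
      (use exponent_diff_add[of v k u] in \<open>auto simp: add.commute\<close>)
  show ?thesis
    unfolding xderiv_single mult_single 1 2
    by (simp add: Poly_Mapping.single_add[symmetric] Poly_Mapping.lookup_add algebra_simps)
qed

lemma xderiv_mult: "xderiv k (p * q) = xderiv k p * q + p * xderiv k q"
proof -
  let ?s = "\<lambda>p u. Poly_Mapping.single u (Poly_Mapping.lookup p u) :: 'a cpoly"
  have "xderiv k ((\<Sum>u\<in>Poly_Mapping.keys p. ?s p u) * (\<Sum>v\<in>Poly_Mapping.keys q. ?s q v)) =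
      xderiv k (\<Sum>u\<in>Poly_Mapping.keys p. ?s p u) * (\<Sum>v\<in>Poly_Mapping.keys q. ?s q v)
      + (\<Sum>u\<in>Poly_Mapping.keys p. ?s p u) * xderiv k (\<Sum>v\<in>Poly_Mapping.keys q. ?s q v)"
    by (simp only: sum_product xderiv_sum xderiv_mult_single sum.distrib)
  then show ?thesis by (simp only: poly_mapping_sum_single[symmetric])
qed

text \<open>The extension of \<open>\<partial>/\<partial>x\<^sub>k\<close> to the field \<open>\<complex>(x)\<close> by the quotient rule.\<close>

lift_definition xderiv_fract ::
    "'n::{finite,linorder} \<Rightarrow> 'n cpoly fract \<Rightarrow> 'n cpoly fract"
  is "\<lambda>k (a, b). (xderiv k a * b - a * xderiv k b, b * b)"
proof (clarsimp simp del: mult_eq_0_iff)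
  fix k :: 'n and a b c d :: "'n cpoly"
  assume nz: "b \<noteq> 0" "d \<noteq> 0" and eq: "a * d = c * b"
  have "xderiv k (a * d) = xderiv k (c * b)" using eq by simp
  then have D: "xderiv k a * d + a * xderiv k d = xderiv k c * b + c * xderiv k b"
    by (simp add: xderiv_mult)
  have "(xderiv k a * b - a * xderiv k b) * (d * d)
      = (xderiv k a * d + a * xderiv k d) * (b * d) - a * d * (xderiv k b * d + b * xderiv k d)"
    by (simp add: algebra_simps)
  also have "\<dots> = (xderiv k c * b + c * xderiv k b) * (b * d)
      - c * b * (xderiv k b * d + b * xderiv k d)"
    using D eq by simp
  also have "\<dots> = (xderiv k c * d - c * xderiv k d) * (b * b)"
    by (simp add: algebra_simps)
  finally show "b * b \<noteq> 0 \<and> d * d \<noteq> 0 \<and> (xderiv k a * b - a * xderiv k b) * (d * d)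
      = (xderiv k c * d - c * xderiv k d) * (b * b)"
    using nz by simp
qed


section \<open>The module \<open>\<complex>[x][\<Prod>\<^sub>i f\<^sub>i\<^sup>-\<^sup>1, s\<^sub>1, \<dots>, s\<^sub>r] \<Prod>\<^sub>i f\<^sub>i\<^bsup>s\<^sub>i\<^esup>\<close>\<close>

text \<open>
  The generators \<open>f\<^sub>1, \<dots>, f\<^sub>r\<close> form a list \<open>fs\<close> and are numbered from \<open>0\<close>.  An element
  \<open>h \<cdot> \<Prod>\<^sub>i f\<^sub>i\<^bsup>s\<^sub>i\<^esup>\<close> of the module is represented by its coefficient \<open>h\<close>, so that
  \<open>\<Prod>\<^sub>i f\<^sub>i\<^bsup>s\<^sub>i\<^esup>\<close> itself is \<open>1\<close>.  The coefficient ring \<open>\<complex>[x][\<Prod>\<^sub>i f\<^sub>i\<^sup>-\<^sup>1, s]\<close> is viewed inside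
  \<open>\<complex>(x)[s]\<close>; it is mapped into itself by all operators below and contains \<open>1\<close>, so the larger
  ring does not affect which elements are reached from \<open>1\<close>.
\<close>

type_synonym 'n coef = "(nat \<Rightarrow>\<^sub>0 nat) \<Rightarrow>\<^sub>0 'n cpoly fract"

definition coef_const :: "'n::{finite,linorder} cpoly fract \<Rightarrow> 'n coef" where
  "coef_const q = Poly_Mapping.single 0 q"

definition coef_poly :: "'n::{finite,linorder} cpoly \<Rightarrow> 'n coef" where
  "coef_poly p = coef_const (Fract p 1)"

definition svar :: "nat \<Rightarrow> 'n::{finite,linorder} coef" where
  "svar i = Poly_Mapping.single (Poly_Mapping.single i 1) 1"

text \<open>Substitution \<open>s\<^sub>i \<mapsto> s\<^sub>i + c\<close>, \<open>s\<^sub>j \<mapsto> s\<^sub>j\<close> for \<open>j \<noteq> i\<close>.\<close>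

definition s_shift :: "nat \<Rightarrow> int \<Rightarrow> 'n::{finite,linorder} coef \<Rightarrow> 'n coef" where
  "s_shift i c h = (\<Sum>v\<in>Poly_Mapping.keys h. coef_const (Poly_Mapping.lookup h v)
      * (\<Prod>j\<in>Poly_Mapping.keys v. (svar j + (if j = i then of_int c else 0)) ^ Poly_Mapping.lookup v j))"

definition partial_op ::
    "'n::{finite,linorder} cpoly list \<Rightarrow> 'n \<Rightarrow> 'n coef \<Rightarrow> 'n coef" where
  "partial_op fs k h = Poly_Mapping.map (xderiv_fract k) h
      + h * (\<Sum>i<length fs. svar i * coef_const (Fract (xderiv k (fs ! i)) (fs ! i)))"

definition t_op :: "'n::{finite,linorder} cpoly list \<Rightarrow> nat \<Rightarrow> 'n coef \<Rightarrow> 'n coef" where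
  "t_op fs i h = s_shift i 1 h * coef_poly (fs ! i)"

definition t_inv_op :: "'n::{finite,linorder} cpoly list \<Rightarrow> nat \<Rightarrow> 'n coef \<Rightarrow> 'n coef" where
  "t_inv_op fs i h = s_shift i (- 1) h * coef_const (Fract 1 (fs ! i))"

definition s_op :: "'n::{finite,linorder} cpoly list \<Rightarrow> nat \<Rightarrow> nat \<Rightarrow> 'n coef \<Rightarrow> 'n coef" where
  "s_op fs i j h = svar i * t_inv_op fs i (t_op fs j h)"

text \<open>
  The ring generated by \<open>\<D>\<close> and the \<open>s\<^sub>i\<^sub>,\<^sub>j\<close>, as a ring of operators.  Negatives are
  compositions with multiplication by the polynomial \<open>-1\<close>.
\<close>

inductive_set DS_ring ::
    "'n::{finite,linorder} cpoly list \<Rightarrow> ('n coef \<Rightarrow> 'n coef) set" for fs where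
  mult: "(\<lambda>h. coef_poly p * h) \<in> DS_ring fs"
| partial: "partial_op fs k \<in> DS_ring fs"
| s_op: "i < length fs \<Longrightarrow> j < length fs \<Longrightarrow> s_op fs i j \<in> DS_ring fs"
| plus: "P \<in> DS_ring fs \<Longrightarrow> P' \<in> DS_ring fs \<Longrightarrow> (\<lambda>h. P h + P' h) \<in> DS_ring fs"
| comp: "P \<in> DS_ring fs \<Longrightarrow> P' \<in> DS_ring fs \<Longrightarrow> P \<circ> P' \<in> DS_ring fs"


section \<open>Bernstein-Sato polynomial\<close>

text \<open>\<open>b(s\<^sub>1 + \<dots> + s\<^sub>r)\<close> for a polynomial \<open>b\<close> in one variable over \<open>\<complex>\<close>.\<close>

definition eval_at_s :: "nat \<Rightarrow> complex poly \<Rightarrow> 'n::{finite,linorder} coef" where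
  "eval_at_s r b = poly (map_poly (\<lambda>c. coef_poly (Poly_Mapping.single 0 c)) b) (\<Sum>i<r. svar i)"

definition bernstein_sato_relation ::
    "'n::{finite,linorder} cpoly list \<Rightarrow> complex poly \<Rightarrow> bool" where
  "bernstein_sato_relation fs b \<longleftrightarrow>
     (\<exists>P. (\<forall>k<length fs. P k \<in> DS_ring fs) \<and>
       eval_at_s (length fs) b * 1 = (\<Sum>k<length fs. P k (t_op fs k 1)))"

definition bernstein_sato_poly :: "'n::{finite,linorder} cpoly list \<Rightarrow> complex poly" where
  "bernstein_sato_poly fs = (ARG_MIN Polynomial.degree b.
     lead_coeff b = 1 \<and> bernstein_sato_relation fs b)"

end

theory Submission
  imports Defs "HOL-Analysis.Kronecker_Approximation_Theorem"
begin

text \<open>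
  The proof has three parts: a reduction of the functional equation to families of polynomials,
  a description of the roots by points \<open>z \<in> \<complex>\<^sup>r\<close> called stuck below, and a translation of these
  points into the sets \<open>R\<^sub>Q\<close>.

  \<^bold>\<open>Values at natural numbers.\<close> Put \<open>s\<^sub>j = M\<^sub>j \<in> \<nat>\<close>.  The element \<open>h \<cdot> \<Prod>\<^sub>j f\<^sub>j\<^bsup>s\<^sub>j\<^esup>\<close> becomes a
  family \<open>H\<close> of elements of \<open>\<complex>(x)\<close> indexed by the finite multisets \<open>M\<close> of generator numbers, and
  \<open>\<Prod>\<^sub>j f\<^sub>j\<^bsup>s\<^sub>j\<^esup>\<close> itself becomes the family \<open>gen_prod f\<close> of the products \<open>\<Prod>\<^sub>j\<^sub>\<in>\<^sub>M f\<^sub>j\<close>.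
  Now \<open>\<partial>\<^sub>k\<close> acts on each member, \<open>t\<^sub>j\<close> is the shift \<open>M \<mapsto> M + {j}\<close>, and \<open>s\<^sub>j t\<^sub>j\<^sup>-\<^sup>1\<close> is the
  operator \<open>tau\<close> with \<open>tau j H M = M\<^sub>j \<cdot> H (M - {j})\<close>, which makes sense even where \<open>M\<^sub>j = 0\<close>.
  So only polynomials occur.  No information is lost, because the generators are nonzero and a
  polynomial in \<open>s\<close> that vanishes on \<open>\<nat>\<^sup>r\<close> is zero.  The relation that defines the
  Bernstein-Sato polynomial becomes the membership of the family \<open>b(|M|) \<cdot> gen_prod f M\<close> in the
  step \<open>V\<^sup>1\<close> of a filtration \<open>Vfilt\<close> (\<open>bernstein_sato_relation_iff\<close>).  If \<open>f\<^sub>a = \<Sum>\<^sub>b h\<^sub>a\<^sub>b g\<^sub>b\<close>,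
  then the multilinear expansion of \<open>\<Prod>\<^sub>a\<^sub>\<in>\<^sub>M f\<^sub>a\<close> defines a transformation of families that takes
  \<open>gen_prod g\<close> to \<open>gen_prod f\<close> and respects the filtrations (\<open>Vfilt_change_gens\<close>).  Therefore the
  relation depends on the ideal only, and the generators may be taken to be monomials \<open>x\<^bsup>a\<^sub>j\<^esup>\<close>.

  \<^bold>\<open>Stuck points.\<close> Put \<open>\<ell>(s) = \<Sum>\<^sub>j s\<^sub>j a\<^sub>j\<close>.  A point \<open>z \<in> \<complex>\<^sup>r\<close> is stuck if no \<open>c \<in> \<int>\<^sup>r\<close> with
  \<open>\<Sum>\<^sub>j c\<^sub>j = 1\<close> preserves both the naturality of those \<open>z\<^sub>j\<close> that are natural numbers and the
  negative integrality of those \<open>\<ell>\<^sub>i(z)\<close> that are negative integers.  The numbers \<open>\<Sum>\<^sub>j z\<^sub>j\<close> for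
  stuck \<open>z\<close> are roots of every \<open>b\<close> that satisfies the relation (\<open>model_relation_root\<close>): for \<open>H\<close>
  in \<open>V\<^sup>m\<close> the coefficient of \<open>x\<^bsup>y\<^esup>\<close> in \<open>H M\<close> extends to complex \<open>M\<close> and \<open>y\<close>, polynomially as
  long as \<open>y - \<ell>(M)\<close> is fixed, and the extension is zero unless such a \<open>c\<close> with \<open>\<Sum>\<^sub>j c\<^sub>j = m\<close>
  exists.  Conversely, if all these numbers are real, then a product of factors \<open>s - \<Sum>\<^sub>j z\<^sub>j\<close> with
  \<open>z\<close> stuck satisfies the relation (\<open>model_relation_exists\<close>).  Indeed, every \<open>c\<close> with
  \<open>\<Sum>\<^sub>j c\<^sub>j = 1\<close> yields a product of linear forms in the ideal of all \<open>p(s)\<close> with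
  \<open>p(s) \<Prod>\<^sub>j f\<^sub>j\<^bsup>s\<^sub>j\<^esup>\<close> in \<open>V\<^sup>1\<close>.  A prime ideal over this ideal contains one factor of each of
  these products, and a \<open>\<complex>\<close>-linear functional \<open>\<phi>\<close> that vanishes on the prime ideal gives the
  stuck point \<open>z\<^sub>j = \<phi>(s\<^sub>j)\<close>.

  \<^bold>\<open>Faces.\<close> Let \<open>z\<close> be stuck, \<open>A = {j. z\<^sub>j \<notin> \<nat>}\<close>, and let \<open>E\<close> be the set of those \<open>i\<close> for which
  \<open>\<ell>\<^sub>i(z)\<close> is a negative integer.  A translation \<open>c\<close> is unrestricted in the positions of \<open>A\<close> and,
  as regards \<open>\<ell>(c)\<close>, in the coordinates outside \<open>E\<close>.  Let \<open>Q\<close> be the smallest face of the Newton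
  polyhedron that contains the \<open>a\<^sub>j\<close> with \<open>j \<in> A\<close> and their translates by the unit vectors \<open>e\<^sub>i\<close>
  with \<open>i \<notin> E\<close>.  The remaining data of \<open>z\<close> form a vector \<open>u \<in> M\<^sub>Q \<inter> V\<^sub>Q\<close> with
  \<open>L\<^sub>Q(u) = -\<Sum>\<^sub>j z\<^sub>j\<close>, and \<open>u \<in> M'\<^sub>Q\<close> would produce a translation \<open>c\<close> (\<open>stuck_in_R_face\<close>).  In the
  opposite direction, the expressions that witness \<open>u \<in> M\<^sub>Q \<inter> V\<^sub>Q\<close> are made the coordinates of a
  stuck point, for a system of monomial generators enlarged by the monomials that occur in them
  (\<open>R_face_attained\<close>).  Here it is essential that the relation does not depend on the generators.
\<close>

section \<open>Evaluation of polynomials in the parameters\<close>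

abbreviation lookup :: "('a \<Rightarrow>\<^sub>0 'b::zero) \<Rightarrow> 'a \<Rightarrow> 'b" where
  "lookup \<equiv> poly_mapping.lookup"

abbreviation keys :: "('a \<Rightarrow>\<^sub>0 'b::zero) \<Rightarrow> 'a set" where
  "keys \<equiv> Poly_Mapping.keys"

abbreviation single :: "'a \<Rightarrow> 'b::zero \<Rightarrow> 'a \<Rightarrow>\<^sub>0 'b" where
  "single \<equiv> Poly_Mapping.single"

definition pmon :: "(nat \<Rightarrow> 'b::comm_ring_1) \<Rightarrow> (nat \<Rightarrow>\<^sub>0 nat) \<Rightarrow> 'b" where
  "pmon x v = (\<Prod>j\<in>keys v. x j ^ lookup v j)"

definition peval :: "(nat \<Rightarrow> 'b::comm_ring_1) \<Rightarrow> ((nat \<Rightarrow>\<^sub>0 nat) \<Rightarrow>\<^sub>0 'b) \<Rightarrow> 'b" where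
  "peval x p = (\<Sum>v\<in>keys p. lookup p v * pmon x v)"

lemma sum_keys_superset:
  fixes T :: "'a \<Rightarrow> 'b::zero \<Rightarrow> 'c::comm_monoid_add"
  assumes "finite A" "keys p \<subseteq> A" "\<And>v. T v 0 = 0"
  shows "(\<Sum>v\<in>keys p. T v (lookup p v)) = (\<Sum>v\<in>A. T v (lookup p v))"
  by (rule sum.mono_neutral_left) (use assms in \<open>auto simp: in_keys_iff\<close>)

lemma sum_keys_add:
  fixes T :: "'a \<Rightarrow> 'b::comm_monoid_add \<Rightarrow> 'c::comm_monoid_add"
  assumes T: "\<And>v a b. T v (a + b) = T v a + T v b" "\<And>v. T v 0 = 0"
  shows "(\<Sum>v\<in>keys (p + q). T v (lookup (p + q) v)) =
     (\<Sum>v\<in>keys p. T v (lookup p v))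
     + (\<Sum>v\<in>keys q. T v (lookup q v))"
proof -
  let ?A = "keys p \<union> keys q"
  note sup = sum_keys_superset[where A = ?A and T = T, OF _ _ T(2)]
  have "keys (p + q) \<subseteq> ?A" by (rule keys_add)
  then have "(\<Sum>v\<in>keys (p + q). T v (lookup (p + q) v)) =
      (\<Sum>v\<in>?A. T v (lookup (p + q) v))"
    by (intro sup) auto
  also have "\<dots> = (\<Sum>v\<in>?A. T v (lookup p v)) + (\<Sum>v\<in>?A. T v (lookup q v))"
    by (simp only: lookup_add T(1) sum.distrib)
  finally show ?thesis using sup[of p] sup[of q] by simp
qed

lemma pmon_superset:
  assumes "finite A" "keys v \<subseteq> A"
  shows "pmon x v = (\<Prod>j\<in>A. x j ^ lookup v j)"
  unfolding pmon_def
  by (rule prod.mono_neutral_left) (use assms in \<open>auto simp: in_keys_iff\<close>)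

lemma pmon_add: "pmon x (u + v) = pmon x u * pmon x v"
proof -
  let ?A = "keys u \<union> keys v"
  have "keys (u + v) \<subseteq> ?A" by (rule keys_add)
  then show ?thesis
    by (simp add: pmon_superset[where A = ?A] lookup_add power_add prod.distrib)
qed

lemma pmon_0 [simp]: "pmon x 0 = 1" by (simp add: pmon_def)

lemma peval_0 [simp]: "peval x 0 = 0" by (simp add: peval_def)

lemma peval_single: "peval x (single v c) = c * pmon x v"
  by (cases "c = 0") (auto simp: peval_def)

lemma peval_const [simp]: "peval x (single 0 c) = c" by (simp add: peval_single)

lemma peval_1 [simp]: "peval x 1 = 1" unfolding single_one[symmetric] by (rule peval_const)

lemma peval_of_nat [simp]: "peval x (of_nat n) = of_nat n"
  by (metis peval_const single_of_nat)

lemma peval_var [simp]: "peval x (single (single j 1) 1) = x j"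
  by (simp add: peval_single pmon_def)

lemmas peval_var_Suc [simp] = peval_var[unfolded One_nat_def]

lemma peval_add [simp]: "peval x (p + q) = peval x p + peval x q"
  unfolding peval_def by (rule sum_keys_add) (auto simp: distrib_right)

lemma peval_sum [simp]: "peval x (sum g A) = (\<Sum>a\<in>A. peval x (g a))"
  by (induction A rule: infinite_finite_induct) auto

lemma peval_mult [simp]: "peval x (p * q) = peval x p * peval x q"
proof -
  let ?s = "\<lambda>p u. single u (lookup p u)"
  have "peval x ((\<Sum>u\<in>keys p. ?s p u) * (\<Sum>v\<in>keys q. ?s q v)) =
      peval x (\<Sum>u\<in>keys p. ?s p u) * peval x (\<Sum>v\<in>keys q. ?s q v)"
    unfolding sum_product peval_sum
    by (simp add: mult_single peval_single pmon_add sum_product mult_ac)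
  then show ?thesis
    unfolding poly_mapping_sum_single[symmetric] .
qed

lemma peval_uminus [simp]: "peval x (- p) = - peval x p"
  using peval_add[of x p "- p"] by (simp add: eq_neg_iff_add_eq_0 add.commute)

lemma peval_diff [simp]: "peval x (p - q) = peval x p - peval x q"
  using peval_add[of x p "- q"] by simp

lemma peval_prod [simp]: "peval x (prod g A) = (\<Prod>a\<in>A. peval x (g a))"
  by (induction A rule: infinite_finite_induct) auto

lemma peval_power [simp]: "peval x (p ^ k) = peval x p ^ k"
  by (induction k) auto

section \<open>Families indexed by multisets and the change of generators\<close>

abbreviation cnt :: "nat multiset \<Rightarrow> nat \<Rightarrow> 'b::semiring_1" where
  "cnt M \<equiv> \<lambda>j. of_nat (count M j)"

lemma module_mult: "module ((*) :: 'a::comm_ring_1 \<Rightarrow> _)"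
  by (unfold_locales; simp add: algebra_simps)

definition gen_prod :: "(nat \<Rightarrow> 'n cpoly) \<Rightarrow> nat multiset \<Rightarrow> 'n::{finite,linorder} cpoly" where
  "gen_prod f M = prod_mset (image_mset f M)"

text \<open>
  The operator \<open>s\<^sub>j t\<^sub>j\<^sup>-\<^sup>1\<close> at natural parameters.  Truncated subtraction on multisets gives
  \<open>M - {j}\<close> a meaningless value when \<open>j \<notin> M\<close>, which the factor \<open>M\<^sub>j = 0\<close> cancels.
\<close>

definition tau :: "nat \<Rightarrow> (nat multiset \<Rightarrow> 'n::{finite,linorder} cpoly) \<Rightarrow> nat multiset \<Rightarrow> 'n cpoly" where
  "tau j H M = of_nat (count M j) * H (M - {#j#})"

text \<open>
  For \<open>J = {j}\<close> this is \<open>t\<^sub>j\<close>; for larger \<open>J\<close> it is a product of the commuting operators \<open>t\<^sub>j\<close>.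
\<close>

definition tshift :: "nat multiset \<Rightarrow> (nat multiset \<Rightarrow> 'n::{finite,linorder} cpoly) \<Rightarrow> nat multiset \<Rightarrow> 'n cpoly" where
  "tshift J H M = H (J + M)"

text \<open>
  The index counts shifts minus applications of \<open>tau\<close>.  The operators \<open>s\<^sub>i t\<^sub>i\<^sup>-\<^sup>1 t\<^sub>j\<close> keep it
  fixed, so that \<open>V\<^sup>1\<close> contains all \<open>P t\<^sub>k \<Prod>\<^sub>i f\<^sub>i\<^bsup>s\<^sub>i\<^esup>\<close> of the functional equation.  Since the
  steps may occur in any order, the converse inclusion needs a commutation argument.  Terms
  \<open>c x\<^sup>u\<close> suffice as multipliers and keep inductions over this predicate simple.
\<close>

inductive Vfilt :: "nat \<Rightarrow> (nat \<Rightarrow> 'n::{finite,linorder} cpoly) \<Rightarrow> nat \<Rightarrow> (nat multiset \<Rightarrow> 'n cpoly) \<Rightarrow> bool"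
  for r f where
  base: "Vfilt r f 0 (gen_prod f)"
| add: "Vfilt r f m H \<Longrightarrow> Vfilt r f m H' \<Longrightarrow> Vfilt r f m (\<lambda>M. H M + H' M)"
| mono: "Vfilt r f m H \<Longrightarrow> Vfilt r f m (\<lambda>M. single u c * H M)"
| deriv: "Vfilt r f m H \<Longrightarrow> Vfilt r f m (\<lambda>M. xderiv k (H M))"
| shift: "j < r \<Longrightarrow> Vfilt r f m H \<Longrightarrow> Vfilt r f (Suc m) (tshift {#j#} H)"
| tau: "j < r \<Longrightarrow> Vfilt r f (Suc m) H \<Longrightarrow> Vfilt r f m (tau j H)"

lemma Vfilt_zero: "Vfilt r f m H \<Longrightarrow> Vfilt r f m (\<lambda>M. 0)"
  using Vfilt.mono[of r f m H 0 0] by simp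

lemma Vfilt_sum:
  assumes "Vfilt r f m H0" "finite A" "\<And>a. a \<in> A \<Longrightarrow> Vfilt r f m (H a)"
  shows "Vfilt r f m (\<lambda>M. \<Sum>a\<in>A. H a M)"
  using assms(2,3)
  by (induction A rule: finite_induct) (auto intro: Vfilt.add Vfilt_zero[OF assms(1)])

lemma Vfilt_mult:
  assumes "Vfilt r f m H"
  shows "Vfilt r f m (\<lambda>M. p * H M)"
proof -
  have "(\<lambda>M. p * H M) = (\<lambda>M. \<Sum>u\<in>keys p.
          single u (lookup p u) * H M)"
    unfolding sum_distrib_right[symmetric] poly_mapping_sum_single[symmetric] ..
  then show ?thesis
    using Vfilt_sum[OF assms, of "keys p"] Vfilt.mono[OF assms] by simp
qed

lemma Vfilt_diff:
  assumes "Vfilt r f m H" "Vfilt r f m H'"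
  shows "Vfilt r f m (\<lambda>M. H M - H' M)"
  using Vfilt.add[OF assms(1) Vfilt_mult[OF assms(2), of "-1"]] by simp

lemma gen_prod_empty [simp]: "gen_prod f {#} = 1" by (simp add: gen_prod_def)
lemma gen_prod_add_mset [simp]: "gen_prod f (add_mset a M) = f a * gen_prod f M" by (simp add: gen_prod_def)
lemma gen_prod_union: "gen_prod f (M + N) = gen_prod f M * gen_prod f N" by (simp add: gen_prod_def)

lemma tshift_single: "tshift {#j#} H M = H (add_mset j M)" by (simp add: tshift_def)

lemma tshift_eq: "tshift J H = (\<lambda>M. H (J + M))"
  by (auto simp: tshift_def)

lemma tshift_tshift: "tshift J (tshift K H) = tshift (J + K) H"
  by (auto simp: tshift_def fun_eq_iff ac_simps)

lemma tau_empty [simp]: "tau j H {#} = 0" by (simp add: tau_def)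

lemma tau_add_mset:
  "tau j H (add_mset a M) = (if a = j then H M else 0) + tau j (tshift {#a#} H) M"
proof (cases "j \<in># M")
  case True
  then show ?thesis by (auto simp: tau_def tshift_def distrib_right)
next
  case False
  then show ?thesis by (auto simp: tau_def tshift_def not_in_iff)
qed

text \<open>
  This is the relation \<open>[t\<^sub>j, s\<^sub>j t\<^sub>j\<^sup>-\<^sup>1] = 1\<close> of a Weyl algebra, iterated over the elements of \<open>J\<close>;
  different indices commute.
\<close>

lemma tshift_tau:
  "tshift J (tau j H) M = tau j (tshift J H) M + of_nat (count J j) * tshift (J - {#j#}) H M"
proof -
  consider "j \<in># J" | "j \<in># M" "j \<notin># J" | "j \<notin># M" "j \<notin># J" by blast
  then show ?thesis
  proof cases
    case 1
    show ?thesis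
    proof (cases "j \<in># M")
      case True
      then have "J + M - {#j#} = J + (M - {#j#})" by simp
      with 1 show ?thesis by (simp add: tau_def tshift_def algebra_simps)
    qed (use 1 in \<open>simp add: tau_def tshift_def algebra_simps not_in_iff\<close>)
  qed (simp_all add: tau_def tshift_def algebra_simps not_in_iff)
qed

lemma tau_sum: "tau j (\<lambda>M. \<Sum>a\<in>A. c a * H a M) M = (\<Sum>a\<in>A. c a * tau j (H a) M)"
  by (simp add: tau_def sum_distrib_left mult.left_commute)

text \<open>
  With \<open>f\<^sub>a = \<Sum>\<^sub>b h\<^sub>a\<^sub>b g\<^sub>b\<close>, replacing \<open>f\<^sub>a\<close> by \<open>\<Sum>\<^sub>b h\<^sub>a\<^sub>b t\<^sub>b\<close> in the product over a word and
  applying the result to \<open>H\<close>.  The value does not depend on the order of the letters because the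
  shifts commute, which is why it descends to multisets in \<open>change_gens\<close> below.
\<close>

primrec change_gens_word :: "nat \<Rightarrow> (nat \<Rightarrow> nat \<Rightarrow> 'n::{finite,linorder} cpoly) \<Rightarrow> nat list
    \<Rightarrow> (nat multiset \<Rightarrow> 'n cpoly) \<Rightarrow> 'n cpoly" where
  "change_gens_word l h [] H = H {#}"
| "change_gens_word l h (a # w) H = (\<Sum>b<l. h a b * change_gens_word l h w (tshift {#b#} H))"

lemma change_gens_word_swap:
  "change_gens_word l h (a # b # w) H = change_gens_word l h (b # a # w) H"
proof -
  have "change_gens_word l h (a # b # w) H =
     (\<Sum>i<l. \<Sum>k<l. h a i * (h b k * change_gens_word l h w (tshift {#i,k#} H)))"
    by (simp add: sum_distrib_left tshift_tshift add_mset_commute)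
  also have "\<dots> = (\<Sum>k<l. \<Sum>i<l. h a i * (h b k * change_gens_word l h w (tshift {#i,k#} H)))"
    by (rule sum.swap)
  also have "\<dots> = change_gens_word l h (b # a # w) H"
    by (simp add: sum_distrib_left tshift_tshift add_mset_commute mult.left_commute)
  finally show ?thesis .
qed

lemma change_gens_word_move:
  "change_gens_word l h (u @ a # w) H = change_gens_word l h (a # u @ w) H"
proof (induction u arbitrary: H)
  case (Cons b u)
  have "change_gens_word l h ((b # u) @ a # w) H = change_gens_word l h (b # a # u @ w) H"
    using Cons by simp
  also have "\<dots> = change_gens_word l h (a # (b # u) @ w) H" by (subst change_gens_word_swap) simp
  finally show ?case .
qed simp

lemma change_gens_word_cong: "mset w = mset w' \<Longrightarrow> change_gens_word l h w H = change_gens_word l h w' H"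
proof (induction w arbitrary: w' H)
  case (Cons a w)
  then have "a \<in> set w'" by (metis list.set_intros(1) mset_eq_setD)
  then obtain u v where w': "w' = u @ a # v" by (meson split_list)
  with Cons.prems have "mset w = mset (u @ v)" by simp
  then have "change_gens_word l h (a # w) H = change_gens_word l h (a # u @ v) H"
    using Cons.IH[of "u @ v"] by simp
  then show ?case using change_gens_word_move[of l h u a v H] by (simp add: w')
qed simp

definition change_gens :: "nat \<Rightarrow> (nat \<Rightarrow> nat \<Rightarrow> 'n::{finite,linorder} cpoly)
    \<Rightarrow> (nat multiset \<Rightarrow> 'n cpoly) \<Rightarrow> nat multiset \<Rightarrow> 'n cpoly" where
  "change_gens l h H M = change_gens_word l h (SOME w. mset w = M) H"

lemma change_gens_mset: "change_gens l h H (mset w) = change_gens_word l h w H"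
  unfolding change_gens_def by (rule change_gens_word_cong) (rule someI, rule refl)

lemma change_gens_empty [simp]: "change_gens l h H {#} = H {#}"
  using change_gens_mset[of l h H "[]"] by simp

lemma change_gens_add_mset:
  "change_gens l h H (add_mset a M) = (\<Sum>b<l. h a b * change_gens l h (tshift {#b#} H) M)"
proof -
  obtain w where "M = mset w" by (metis ex_mset)
  then show ?thesis using change_gens_mset[of l h H "a # w"] by (simp add: change_gens_mset)
qed

lemma change_gens_add: "change_gens l h (\<lambda>M. H M + H' M) M = change_gens l h H M + change_gens l h H' M"
proof (induction M arbitrary: H H')
  case (add a M)
  have "tshift {#b#} (\<lambda>M. H M + H' M) = (\<lambda>M. tshift {#b#} H M + tshift {#b#} H' M)" for b
    by (auto simp: tshift_def)
  then show ?case by (simp add: change_gens_add_mset add.IH sum.distrib algebra_simps)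
qed simp

lemma change_gens_mult: "change_gens l h (\<lambda>M. p * H M) M = p * change_gens l h H M"
proof (induction M arbitrary: H)
  case (add a M)
  have "tshift {#b#} (\<lambda>M. p * H M) = (\<lambda>M. p * tshift {#b#} H M)" for b
    by (auto simp: tshift_def)
  then show ?case by (simp add: change_gens_add_mset add.IH sum_distrib_left algebra_simps)
qed simp

lemma change_gens_size:
  "change_gens l h (\<lambda>M. c (size M) * H M) M = c (size M) * change_gens l h H M"
proof (induction M arbitrary: H c)
  case (add a M)
  have "tshift {#b#} (\<lambda>M. c (size M) * H M) = (\<lambda>M. c (Suc (size M)) * tshift {#b#} H M)" for b
    by (auto simp: tshift_def)
  then show ?case using add.IH[of "\<lambda>n. c (Suc n)"]
    by (simp add: change_gens_add_mset sum_distrib_left mult.left_commute)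
qed simp

lemma change_gens_gen_prod:
  assumes "\<And>a. f a = (\<Sum>b<l. h a b * g b)"
  shows "change_gens l h (gen_prod g) M = gen_prod f M"
proof (induction M)
  case (add a M)
  have "tshift {#b#} (gen_prod g) = (\<lambda>M. g b * gen_prod g M)" for b by (auto simp: tshift_def)
  then show ?case
    by (simp add: change_gens_add_mset change_gens_mult add.IH assms sum_distrib_right algebra_simps)
qed simp

lemma sum_mult_delta:
  fixes c :: "nat \<Rightarrow> 'a::comm_semiring_1"
  shows "(\<Sum>i<r. c i * (if a = i then x else 0)) = (if a < r then c a * x else 0)"
proof -
  have "(\<Sum>i<r. c i * (if a = i then x else 0)) = (\<Sum>i<r. if a = i then c i * x else 0)"
    by (rule sum.cong) auto
  then show ?thesis by simp
qed

text \<open>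
  Dually to \<open>t\<^sub>a \<mapsto> \<Sum>\<^sub>b h\<^sub>a\<^sub>b t\<^sub>b\<close>, the operators \<open>tau\<close> transform by the transposed matrix.
\<close>

lemma change_gens_tau:
  assumes h: "\<And>a b. a \<ge> r \<Longrightarrow> h a b = 0" and "j < l"
  shows "change_gens l h (tau j H) M = (\<Sum>i<r. h i j * tau i (change_gens l h H) M)"
proof (induction M arbitrary: H)
  case (add a M)
  let ?S = "change_gens l h"
  have "tshift {#b#} (tau j H) = (\<lambda>M. tau j (tshift {#b#} H) M + (if j = b then 1 else 0) * H M)"
    for b by (auto simp: tshift_tau fun_eq_iff, auto simp: tshift_def)
  then have tt: "?S (tshift {#b#} (tau j H)) M =
      (\<Sum>i<r. h i j * tau i (?S (tshift {#b#} H)) M) + (if j = b then 1 else 0) * ?S H M" for b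
    by (simp only: change_gens_add change_gens_mult add.IH)
  have ta: "tshift {#a#} (?S H) = (\<lambda>M. \<Sum>b<l. h a b * ?S (tshift {#b#} H) M)"
    by (auto simp: tshift_def change_gens_add_mset)
  have h1: "h a j * ?S H M = (\<Sum>i<r. h i j * (if a = i then ?S H M else 0))"
    using h[of a j] by (subst sum_mult_delta) auto
  have "?S (tau j H) (add_mset a M) =
     (\<Sum>b<l. \<Sum>i<r. h a b * (h i j * tau i (?S (tshift {#b#} H)) M))
      + (\<Sum>b<l. h a b * ((if j = b then 1 else 0) * ?S H M))"
    by (simp only: change_gens_add_mset tt distrib_left sum.distrib sum_distrib_left)
  also have "(\<Sum>b<l. h a b * ((if j = b then 1 else 0) * ?S H M)) =
      (\<Sum>b<l. h a b * (if j = b then ?S H M else 0))"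
    by (rule sum.cong) auto
  also have "\<dots> = h a j * ?S H M"
    by (subst sum_mult_delta) (use \<open>j < l\<close> in simp)
  also have "(\<Sum>b<l. \<Sum>i<r. h a b * (h i j * tau i (?S (tshift {#b#} H)) M))
     = (\<Sum>i<r. \<Sum>b<l. h i j * (h a b * tau i (?S (tshift {#b#} H)) M))"
    by (subst sum.swap) (intro sum.cong refl mult.left_commute)
  also have "\<dots> = (\<Sum>i<r. h i j * tau i (tshift {#a#} (?S H)) M)"
    by (simp only: ta tau_sum sum_distrib_left)
  finally show ?case
    by (simp only: h1 tau_add_mset distrib_left sum.distrib add.commute)
qed simp

lemma xderiv_0 [simp]: "xderiv k 0 = 0" by (rule xderiv_zero)

text \<open>
  The Leibniz rule differentiates also the coefficients \<open>h\<^sub>i\<^sub>j\<close>.  The corrections have the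
  form \<open>tau\<^sub>i \<circ> t\<^sub>j\<close>, which does not lower the filtration.
\<close>

lemma change_gens_xderiv:
  assumes h: "\<And>a b. a \<ge> r \<Longrightarrow> h a b = 0"
  shows "xderiv k (change_gens l h H M) = change_gens l h (\<lambda>M. xderiv k (H M)) M
     + (\<Sum>i<r. \<Sum>j<l. xderiv k (h i j) * tau i (change_gens l h (tshift {#j#} H)) M)"
proof (induction M arbitrary: H)
  case (add a M)
  let ?D = "\<lambda>i j. xderiv k (h i j)"
  let ?S = "change_gens l h"
  have ts: "tshift {#b#} (\<lambda>M. xderiv k (H M)) = (\<lambda>M. xderiv k (tshift {#b#} H M))" for b
    by (auto simp: tshift_def)
  have ta: "tshift {#a#} (?S G) = (\<lambda>M. \<Sum>b<l. h a b * ?S (tshift {#b#} G) M)" for G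
    by (auto simp: tshift_def change_gens_add_mset)
  have sw: "tshift {#b#} (tshift {#j#} H) = tshift {#j#} (tshift {#b#} H)" for b j
    by (simp add: tshift_tshift add_mset_commute)
  have Da: "(\<Sum>j<l. ?D a j * ?S (tshift {#j#} H) M) =
      (\<Sum>i<r. \<Sum>j<l. ?D i j * (if a = i then ?S (tshift {#j#} H) M else 0))"
    using h[of a] by (subst sum.swap, subst sum_mult_delta) (auto intro: sum.cong)
  have "xderiv k (?S H (add_mset a M)) =
      (\<Sum>b<l. ?D a b * ?S (tshift {#b#} H) M) + (\<Sum>b<l. h a b * xderiv k (?S (tshift {#b#} H) M))"
    by (simp only: change_gens_add_mset xderiv_sum xderiv_mult sum.distrib)
  also have "(\<Sum>b<l. h a b * xderiv k (?S (tshift {#b#} H) M)) =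
      ?S (\<lambda>M. xderiv k (H M)) (add_mset a M)
      + (\<Sum>b<l. \<Sum>i<r. \<Sum>j<l. h a b * (?D i j * tau i (?S (tshift {#j#} (tshift {#b#} H))) M))"
    by (simp only: change_gens_add_mset add.IH ts distrib_left sum.distrib sum_distrib_left)
  also have "(\<Sum>b<l. \<Sum>i<r. \<Sum>j<l. h a b * (?D i j * tau i (?S (tshift {#j#} (tshift {#b#} H))) M))
     = (\<Sum>b<l. \<Sum>i<r. \<Sum>j<l. ?D i j * (h a b * tau i (?S (tshift {#b#} (tshift {#j#} H))) M))"
    unfolding sw by (intro sum.cong refl mult.left_commute)
  also have "\<dots> = (\<Sum>i<r. \<Sum>b<l. \<Sum>j<l. ?D i j * (h a b * tau i (?S (tshift {#b#} (tshift {#j#} H))) M))"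
    by (rule sum.swap)
  also have "\<dots> = (\<Sum>i<r. \<Sum>j<l. \<Sum>b<l. ?D i j * (h a b * tau i (?S (tshift {#b#} (tshift {#j#} H))) M))"
    by (intro sum.cong refl sum.swap)
  also have "\<dots> = (\<Sum>i<r. \<Sum>j<l. ?D i j * tau i (tshift {#a#} (?S (tshift {#j#} H))) M)"
    unfolding ta tau_sum by (simp only: sum_distrib_left)
  finally show ?case
    unfolding Da by (simp only: tau_add_mset distrib_left sum.distrib ac_simps)
qed simp

text \<open>
  The products \<open>f\<^sub>i \<Prod> f\<close> are shifts, so each multiplication of the family
  \<open>gen_prod f\<close> by an element of the ideal of the \<open>f\<^sub>i\<close> raises the filtration by one.
\<close>

lemma Vfilt_ideal_power:
  assumes "0 < r" and g: "\<And>j. j \<in> set_mset J \<Longrightarrow> \<exists>k. g j = (\<Sum>i<r. k i * f i)"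
  shows "Vfilt r f (size J) (\<lambda>M. gen_prod g J * gen_prod f M)"
  using g
proof (induction J)
  case empty
  show ?case using Vfilt.base by simp
next
  case (add j J)
  obtain k where k: "g j = (\<Sum>i<r. k i * f i)" using add.prems by auto
  have IH: "Vfilt r f (size J) (\<lambda>M. gen_prod g J * gen_prod f M)" using add by auto
  have sh: "Vfilt r f (Suc (size J)) (\<lambda>M. k i * tshift {#i#} (\<lambda>M. gen_prod g J * gen_prod f M) M)"
    if "i < r" for i
    by (intro Vfilt_mult Vfilt.shift that IH)
  have "Vfilt r f (Suc (size J)) (\<lambda>M. \<Sum>i<r. k i * tshift {#i#} (\<lambda>M. gen_prod g J * gen_prod f M) M)"
    using sh \<open>0 < r\<close> by (intro Vfilt_sum[OF sh[of 0]]) auto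
  also have "(\<lambda>M. \<Sum>i<r. k i * tshift {#i#} (\<lambda>M. gen_prod g J * gen_prod f M) M)
     = (\<lambda>M. gen_prod g (add_mset j J) * gen_prod f M)"
    by (auto simp: tshift_eq k sum_distrib_left sum_distrib_right algebra_simps)
  finally show ?case by simp
qed

lemma tshift_xderiv: "tshift J (\<lambda>M. xderiv k (H M)) = (\<lambda>M. xderiv k (tshift J H M))"
  by (auto simp: tshift_def)

text \<open>
  The induction over \<open>H\<close> needs all shifts of \<open>H\<close> at once: the derivative of a transformed family
  involves the transform of a shifted family, one step deeper in the filtration.
\<close>

lemma Vfilt_change_gens:
  assumes fg: "\<And>a. f a = (\<Sum>b<l. h a b * g b)"
    and h0: "\<And>a b. a \<ge> r \<Longrightarrow> h a b = 0"
    and gf: "\<And>j. \<exists>k. g j = (\<Sum>i<r. k i * f i)"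
    and "0 < r"
    and "Vfilt l g m H" "set_mset J \<subseteq> {..<l}"
  shows "Vfilt r f (m + size J) (change_gens l h (tshift J H))"
  using assms(5,6)
proof (induction arbitrary: J rule: Vfilt.induct)
  case base
  have "tshift J (gen_prod g) = (\<lambda>M. gen_prod g J * gen_prod g M)"
    by (auto simp: tshift_def gen_prod_union)
  then have "change_gens l h (tshift J (gen_prod g)) = (\<lambda>M. gen_prod g J * gen_prod f M)"
    by (auto simp: change_gens_mult change_gens_gen_prod[where f = f, OF fg])
  then show ?case using Vfilt_ideal_power[of r J g f] gf \<open>0 < r\<close> by simp
next
  case (add m H H')
  have "change_gens l h (tshift J (\<lambda>M. H M + H' M)) = (\<lambda>M. change_gens l h (tshift J H) M + change_gens l h (tshift J H') M)"
    by (auto simp: tshift_eq change_gens_add)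
  then show ?case using add by (auto intro: Vfilt.add)
next
  case (mono m H u c)
  have "change_gens l h (tshift J (\<lambda>M. single u c * H M)) =
      (\<lambda>M. single u c * change_gens l h (tshift J H) M)"
    by (auto simp: tshift_eq change_gens_mult)
  then show ?case using mono by (auto intro: Vfilt.mono)
next
  case (deriv m H k)
  have IH1: "Vfilt r f (m + size J) (\<lambda>M. xderiv k (change_gens l h (tshift J H) M))"
    using deriv by (intro Vfilt.deriv) auto
  have IH2: "Vfilt r f (m + size J) (\<lambda>M. xderiv k (h i j) * tau i (change_gens l h (tshift {#j#} (tshift J H))) M)"
    if "i < r" "j < l" for i j
    using deriv.IH[of "add_mset j J"] deriv.prems that
    by (intro Vfilt_mult Vfilt.tau) (auto simp: tshift_tshift)
  have "change_gens l h (tshift J (\<lambda>M. xderiv k (H M))) = (\<lambda>M. xderiv k (change_gens l h (tshift J H) M)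
       - (\<Sum>i<r. \<Sum>j<l. xderiv k (h i j) * tau i (change_gens l h (tshift {#j#} (tshift J H))) M))"
    by (auto simp: change_gens_xderiv[OF h0] tshift_xderiv)
  moreover have "Vfilt r f (m + size J) (\<lambda>M. xderiv k (change_gens l h (tshift J H) M)
       - (\<Sum>i<r. \<Sum>j<l. xderiv k (h i j) * tau i (change_gens l h (tshift {#j#} (tshift J H))) M))"
    by (intro Vfilt_diff IH1 Vfilt_sum[OF IH1] IH2) auto
  ultimately show ?case by simp
next
  case (shift j m H)
  then show ?case using shift.IH[of "add_mset j J"] by (simp add: tshift_tshift)
next
  case (tau j m H)
  have "change_gens l h (tshift J (tau j H)) = (\<lambda>M. (\<Sum>i<r. h i j * tau i (change_gens l h (tshift J H)) M)
      + of_nat (count J j) * change_gens l h (tshift (J - {#j#}) H) M)"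
    using change_gens_tau[of r h j l, OF h0 tau.hyps(1)]
    by (auto simp: fun_eq_iff tshift_tau[abs_def] change_gens_add change_gens_mult)
  moreover have V1: "Vfilt r f (m + size J) (\<lambda>M. h i j * tau i (change_gens l h (tshift J H)) M)"
    if "i < r" for i
    using tau.IH[OF tau.prems] that by (intro Vfilt_mult Vfilt.tau) auto
  moreover have "Vfilt r f (m + size J) (\<lambda>M. of_nat (count J j) * change_gens l h (tshift (J - {#j#}) H) M)"
  proof (cases "j \<in># J")
    case True
    have "set_mset (J - {#j#}) \<subseteq> {..<l}" using tau.prems by (meson in_diffD subset_iff)
    moreover have "Suc m + size (J - {#j#}) = m + size J"
      using size_Suc_Diff1[OF True] by linarith
    ultimately show ?thesis using tau.IH[of "J - {#j#}"] by (intro Vfilt_mult) metis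
  next
    case False
    then show ?thesis using Vfilt_zero[OF V1[OF \<open>0 < r\<close>]] by (simp add: not_in_iff)
  qed
  moreover have "Vfilt r f (m + size J) (\<lambda>M. \<Sum>i<r. h i j * tau i (change_gens l h (tshift J H)) M)"
    by (rule Vfilt_sum[OF V1[OF \<open>0 < r\<close>]]) (use V1 in auto)
  ultimately show ?case by (auto intro: Vfilt.add)
qed

text \<open>
  The relation that defines Bernstein-Sato polynomials, at natural values of the parameters: the
  sum \<open>s\<^sub>1 + \<dots> + s\<^sub>r\<close> becomes \<open>|M|\<close>.
\<close>

definition model_relation :: "nat \<Rightarrow> (nat \<Rightarrow> 'n::{finite,linorder} cpoly) \<Rightarrow> complex poly \<Rightarrow> bool" where
  "model_relation r f b \<longleftrightarrow>
     Vfilt r f 1 (\<lambda>M. single 0 (poly b (of_nat (size M))) * gen_prod f M)"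

lemma model_relation_transfer:
  assumes fg: "\<And>a. f a = (\<Sum>b<l. h a b * g b)"
    and h0: "\<And>a b. a \<ge> r \<Longrightarrow> h a b = 0"
    and gf: "\<And>j. \<exists>k. g j = (\<Sum>i<r. k i * f i)"
    and "0 < r"
    and "model_relation l g b"
  shows "model_relation r f b"
proof -
  have "Vfilt r f 1 (change_gens l h (tshift {#} (\<lambda>M. single 0 (poly b (of_nat (size M))) * gen_prod g M)))"
    using Vfilt_change_gens[OF fg h0 gf \<open>0 < r\<close>, where J = "{#}"] assms(5) by (fastforce simp: model_relation_def)
  moreover have "change_gens l h (tshift {#} (\<lambda>M. single 0 (poly b (of_nat (size M))) * gen_prod g M))
     = (\<lambda>M. single 0 (poly b (of_nat (size M))) * gen_prod f M)"
    using change_gens_size[of l h "\<lambda>n. single 0 (poly b (of_nat n))" "gen_prod g"]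
    by (auto simp: tshift_eq change_gens_gen_prod[where f = f, OF fg])
  ultimately show ?thesis by (simp add: model_relation_def)
qed

lemma size_conv_sum:
  fixes r :: nat
  shows "set_mset M \<subseteq> {..<r} \<Longrightarrow> of_nat (size M) = (\<Sum>j<r. of_nat (count M j) :: 'b::comm_semiring_1)"
proof (induction M)
  case (add x M)
  have "(\<Sum>j<r. of_nat (count (add_mset x M) j) :: 'b) = (\<Sum>j<r. (if x = j then 1 else 0) + of_nat (count M j))"
    by (rule sum.cong) auto
  also have "\<dots> = (\<Sum>j<r. if x = j then 1 else 0) + of_nat (size M)"
    using add by (simp add: sum.distrib)
  also have "(\<Sum>j<r. if x = j then 1 else 0) = (1 :: 'b)"
    using add.prems by (subst sum.delta') auto
  finally show ?case by simp
qed simp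

section \<open>From the functional equation to its values at natural numbers\<close>

lemma xderiv_fract_Fract:
  "b \<noteq> 0 \<Longrightarrow> xderiv_fract k (Fract a b) = Fract (xderiv k a * b - a * xderiv k b) (b * b)"
  unfolding Fract.abs_eq by (subst xderiv_fract.abs_eq) (simp_all add: eq_onp_def)

lemma xderiv_1 [simp]: "xderiv k 1 = 0"
  using xderiv_mult[of k 1 1] by simp

abbreviation emb :: "'n::{finite,linorder} cpoly \<Rightarrow> 'n cpoly fract" where
  "emb p \<equiv> Fract p 1"

lemma emb_add: "emb (p + q) = emb p + emb q" by simp
lemma emb_mult: "emb (p * q) = emb p * emb q" by simp
lemma emb_eq: "emb p = emb q \<longleftrightarrow> p = q" by (simp add: eq_fract)
lemma emb_0: "emb 0 = 0" by (simp add: Zero_fract_def)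
lemma emb_1: "emb 1 = 1" by (simp add: One_fract_def)
lemma emb_of_nat: "emb (of_nat n) = of_nat n"
  by (induction n) (simp_all only: of_nat_0 of_nat_Suc emb_0 emb_1 emb_add)

lemma emb_diff: "emb (p - q) = emb p - emb q" by simp
lemma emb_nonzero: "p \<noteq> 0 \<Longrightarrow> emb p \<noteq> 0" using emb_eq[of p 0] emb_0 by metis
lemma Fract_conv: "Fract a b = emb a / emb b" by (cases "b = 0") (simp_all add: eq_fract divide_fract)

lemma xderiv_fract_divide:
  assumes "b \<noteq> 0"
  shows "xderiv_fract k (emb a / emb b) =
    (emb (xderiv k a) * emb b - emb a * emb (xderiv k b)) / (emb b * emb b)"
proof -
  have "xderiv_fract k (emb a / emb b) = Fract (xderiv k a * b - a * xderiv k b) (b * b)"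
    unfolding Fract_conv[symmetric] by (rule xderiv_fract_Fract[OF assms])
  also have "\<dots> = (emb (xderiv k a) * emb b - emb a * emb (xderiv k b)) / (emb b * emb b)"
    by (subst Fract_conv) (simp only: emb_diff emb_mult)
  finally show ?thesis .
qed

lemma fract_cases_div:
  obtains a b where "x = emb a / emb b" "b \<noteq> 0"
proof -
  obtain a b where "x = Fract a b" "b \<noteq> 0" by (cases x) auto
  then have "x = emb a / emb b" by (simp only: Fract_conv[of a b])
  then show ?thesis using \<open>b \<noteq> 0\<close> by (rule that)
qed

text \<open>
  The next two identities, between the values given by the quotient rule for a sum or a product of
  fractions and for the fractions themselves, make the extension of \<open>\<partial>\<^sub>k\<close> to \<open>\<complex>(x)\<close> a derivation.
\<close>

lemma quotient_rule_add:
  fixes B D :: "'a::field"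
  assumes "B \<noteq> 0" "D \<noteq> 0"
  shows "((A' * D + A * D' + (C' * B + C * B')) * (B * D) - (A * D + C * B) * (B' * D + B * D')) / (B * D * (B * D))
    = (A' * B - A * B') / (B * B) + (C' * D - C * D') / (D * D)"
proof -
  have "(A' * B - A * B') / (B * B) + (C' * D - C * D') / (D * D) =
      ((A' * B - A * B') * (D * D) + (C' * D - C * D') * (B * B)) / ((B * B) * (D * D))"
    using assms by (intro add_frac_eq) auto
  moreover have "(A' * B - A * B') * (D * D) + (C' * D - C * D') * (B * B) =
     (A' * D + A * D' + (C' * B + C * B')) * (B * D) - (A * D + C * B) * (B' * D + B * D')"
    by (simp add: algebra_simps)
  moreover have "(B * B) * (D * D) = B * D * (B * D)" by (simp add: ac_simps)
  ultimately show ?thesis by simp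
qed

lemma quotient_rule_mult:
  fixes B D :: "'a::field"
  assumes "B \<noteq> 0" "D \<noteq> 0"
  shows "((A' * C + A * C') * (B * D) - (A * C) * (B' * D + B * D')) / (B * D * (B * D))
    = (A' * B - A * B') / (B * B) * (C / D) + (A / B) * ((C' * D - C * D') / (D * D))"
proof -
  have "(A' * B - A * B') / (B * B) * (C / D) = ((A' * B - A * B') * C * D) / (B * D * (B * D))"
    "(A / B) * ((C' * D - C * D') / (D * D)) = (A * (C' * D - C * D') * B) / (B * D * (B * D))"
    using assms by (auto simp: ac_simps)
  moreover have "(A' * C + A * C') * (B * D) - (A * C) * (B' * D + B * D') =
      (A' * B - A * B') * C * D + A * (C' * D - C * D') * B"
    by (simp add: algebra_simps)
  ultimately show ?thesis by (simp only: add_divide_distrib)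
qed

lemma xderiv_fract_add: "xderiv_fract k (x + y) = xderiv_fract k x + xderiv_fract k y"
proof -
  obtain a b where x: "x = emb a / emb b" "b \<noteq> 0" by (rule fract_cases_div)
  obtain c d where y: "y = emb c / emb d" "d \<noteq> 0" by (rule fract_cases_div)
  have nz: "emb b \<noteq> 0" "emb d \<noteq> 0" "b * d \<noteq> 0" by (rule emb_nonzero[OF x(2)], rule emb_nonzero[OF y(2)], rule no_zero_divisors[OF x(2) y(2)])
  have "x + y = emb (a * d + c * b) / emb (b * d)"
    unfolding x(1) y(1) emb_add emb_mult using nz(1,2) by (rule add_frac_eq)
  then have "xderiv_fract k (x + y) = xderiv_fract k (emb (a * d + c * b) / emb (b * d))" by (rule arg_cong)
  also have "\<dots> = xderiv_fract k x + xderiv_fract k y"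
    unfolding x(1) y(1)
    by (subst xderiv_fract_divide[OF nz(3)], subst xderiv_fract_divide[OF x(2)], subst xderiv_fract_divide[OF y(2)])
      (simp only: xderiv_add xderiv_mult emb_add emb_mult quotient_rule_add[OF nz(1,2)])
  finally show ?thesis .
qed

lemma xderiv_fract_mult: "xderiv_fract k (x * y) = xderiv_fract k x * y + x * xderiv_fract k y"
proof -
  obtain a b where x: "x = emb a / emb b" "b \<noteq> 0" by (rule fract_cases_div)
  obtain c d where y: "y = emb c / emb d" "d \<noteq> 0" by (rule fract_cases_div)
  have nz: "emb b \<noteq> 0" "emb d \<noteq> 0" "b * d \<noteq> 0" by (rule emb_nonzero[OF x(2)], rule emb_nonzero[OF y(2)], rule no_zero_divisors[OF x(2) y(2)])
  have "x * y = emb (a * c) / emb (b * d)"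
    unfolding x(1) y(1) emb_mult by (rule times_divide_times_eq)
  then have "xderiv_fract k (x * y) = xderiv_fract k (emb (a * c) / emb (b * d))" by (rule arg_cong)
  also have "\<dots> = xderiv_fract k x * y + x * xderiv_fract k y"
    unfolding x(1) y(1)
    by (subst xderiv_fract_divide[OF nz(3)], subst xderiv_fract_divide[OF x(2)], subst xderiv_fract_divide[OF y(2)])
      (simp only: xderiv_mult emb_add emb_mult quotient_rule_mult[OF nz(1,2)])
  finally show ?thesis .
qed

lemma xderiv_fract_emb: "xderiv_fract k (emb p) = emb (xderiv k p)"
  by (simp add: xderiv_fract_Fract)

lemma xderiv_fract_0 [simp]: "xderiv_fract k 0 = 0"
  by (metis emb_0 xderiv_fract_emb xderiv_zero)

lemma xderiv_fract_of_nat [simp]: "xderiv_fract k (of_nat n) = 0"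
proof (induction n)
  case (Suc n)
  have "xderiv_fract k 1 = 0" by (metis emb_0 emb_1 xderiv_fract_emb xderiv_1)
  with Suc show ?case by (simp add: xderiv_fract_add)
qed simp

lemma xderiv_fract_sum: "xderiv_fract k (sum g A) = (\<Sum>a\<in>A. xderiv_fract k (g a))"
  by (induction A rule: infinite_finite_induct) (auto simp: xderiv_fract_add)

lemma inj_of_nat_fract: "inj (of_nat :: nat \<Rightarrow> 'n::{finite,linorder} cpoly fract)"
proof (rule injI)
  fix m n :: nat assume "(of_nat m :: 'n cpoly fract) = of_nat n"
  then have "emb (of_nat m :: 'n cpoly) = emb (of_nat n)" by (simp only: emb_of_nat)
  then have "(of_nat m :: 'n cpoly) = of_nat n" by (simp only: emb_eq)
  then show "m = n" by (simp only: of_nat_eq_iff)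
qed

definition vars_below :: "nat \<Rightarrow> ((nat \<Rightarrow>\<^sub>0 nat) \<Rightarrow>\<^sub>0 'b::comm_ring_1) set" where
  "vars_below r = {p. \<forall>v\<in>keys p. keys v \<subseteq> {..<r}}"

lemma poly_vanish_of_nat:
  fixes q :: "'a::idom poly"
  assumes inj: "inj (of_nat :: nat \<Rightarrow> 'a)" and "\<And>n::nat. poly q (of_nat n) = 0"
  shows "q = 0"
proof (rule ccontr)
  assume "q \<noteq> 0"
  then have "finite {x. poly q x = 0}" by (rule poly_roots_finite)
  moreover have "range of_nat \<subseteq> {x. poly q x = 0}" using assms by auto
  ultimately have "finite (range (of_nat :: nat \<Rightarrow> 'a))" by (rule rev_finite_subset)
  then show False using inj by (metis finite_imageD infinite_UNIV_nat)
qed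

text \<open>
  By induction on the number of variables: split off the powers of the last variable and use that
  a polynomial in one variable with infinitely many roots is zero.
\<close>

lemma peval_vanish:
  fixes p :: "(nat \<Rightarrow>\<^sub>0 nat) \<Rightarrow>\<^sub>0 'b::idom"
  assumes inj: "inj (of_nat :: nat \<Rightarrow> 'b)"
    and "p \<in> vars_below r" "\<And>n :: nat \<Rightarrow> nat. (\<And>j. j \<ge> r \<Longrightarrow> n j = 0) \<Longrightarrow> peval (\<lambda>j. of_nat (n j)) p = 0"
  shows "p = 0"
  using assms(2,3)
proof (induction r arbitrary: p)
  case 0
  have k0: "v = 0" if "v \<in> keys p" for v
    using 0(1) that by (auto simp: vars_below_def)
  then have "p = single 0 (lookup p 0)"
    by (intro poly_mapping_eqI) (auto simp: lookup_single when_def in_keys_iff)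
  then have "peval (\<lambda>j. 0) p = lookup p 0" by (metis peval_const)
  then have "lookup p 0 = 0" using 0(2)[of "\<lambda>_. 0"] by simp
  with \<open>p = _\<close> show ?case by simp
next
  case (Suc r)
  let ?K = "\<lambda>k. {v \<in> keys p. lookup v r = k}"
  \<comment> \<open>The coefficient of the \<open>k\<close>-th power of the last variable.\<close>
  define q where "q k = (\<Sum>v\<in>?K k. single (v - single r k) (lookup p v))" for k
  have split: "v - single r k + single r k = v" if "lookup v r = k" for v :: "nat \<Rightarrow>\<^sub>0 nat" and k
    by (rule poly_mapping_eqI)
      (use that in \<open>auto simp: lookup_add lookup_minus lookup_single when_def\<close>)
  have qz: "q k = 0" for k
  proof (rule Suc.IH)
    have "keys (q k) \<subseteq> (\<Union>v\<in>?K k. keys (single (v - single r k) (lookup p v)))"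
      unfolding q_def by (rule keys_sum)
    also have "\<dots> \<subseteq> (\<lambda>v. v - single r k) ` ?K k" by auto
    finally have sub: "keys (q k) \<subseteq> (\<lambda>v. v - single r k) ` ?K k" .
    show "q k \<in> vars_below r"
      unfolding vars_below_def
    proof (intro CollectI ballI)
      fix w assume "w \<in> keys (q k)"
      with sub obtain v where v: "v \<in> keys p" "lookup v r = k" "w = v - single r k"
        by auto
      show "keys w \<subseteq> {..<r}"
      proof
        fix j assume "j \<in> keys w"
        then have "lookup v j - (k when r = j) \<noteq> 0"
          by (simp add: v(3) in_keys_iff lookup_minus lookup_single)
        then have "j \<noteq> r" "j \<in> keys v" using v(2) by (auto simp: in_keys_iff when_def split: if_splits)
        with Suc.prems(1) v(1) have "j < Suc r" by (auto simp: vars_below_def)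
        with \<open>j \<noteq> r\<close> show "j \<in> {..<r}" by simp
      qed
    qed
  next
    fix n :: "nat \<Rightarrow> nat" assume n: "\<And>j. j \<ge> r \<Longrightarrow> n j = 0"
    let ?x = "\<lambda>t. (\<lambda>j. of_nat (n j) :: 'b)(r := t)"
    define N where "N = Suc (Max (insert 0 ((\<lambda>v. lookup v r) ` keys p)))"
    define Q where "Q = (\<Sum>k<N. monom (peval (\<lambda>j. of_nat (n j)) (q k)) k)"
    have mon: "pmon (?x t) v = pmon (\<lambda>j. of_nat (n j)) (v - single r k) * t ^ k"
      if "lookup v r = k" for t v k
    proof -
      let ?w = "v - single r k"
      have "pmon (?x t) ?w = pmon (\<lambda>j. of_nat (n j)) ?w"
        unfolding pmon_def
        by (rule prod.cong) (use that in \<open>auto simp: in_keys_iff lookup_minus lookup_single\<close>)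
      moreover have "pmon (?x t) (single r k) = t ^ k"
        by (cases "k = 0") (simp_all add: pmon_def)
      ultimately show ?thesis using pmon_add[of "?x t" ?w "single r k"] split[OF that] by simp
    qed
    have ev: "peval (?x t) p = poly Q t" for t
    proof -
      have "peval (?x t) p = (\<Sum>v\<in>keys p. lookup p v * pmon (?x t) v)"
        by (simp add: peval_def)
      also have "\<dots> = (\<Sum>k<N. \<Sum>v\<in>?K k. lookup p v * pmon (?x t) v)"
      proof (rule sum.group[symmetric])
        show "(\<lambda>v. lookup v r) ` keys p \<subseteq> {..<N}"
          by (auto simp: N_def less_Suc_eq_le intro!: Max_ge)
      qed auto
      also have "\<dots> = (\<Sum>k<N. peval (\<lambda>j. of_nat (n j)) (q k) * t ^ k)"
      proof (rule sum.cong[OF refl])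
        fix k
        show "(\<Sum>v\<in>?K k. lookup p v * pmon (?x t) v) = peval (\<lambda>j. of_nat (n j)) (q k) * t ^ k"
          unfolding q_def peval_sum sum_distrib_right
          by (rule sum.cong) (auto simp: peval_single mon mult.assoc)
      qed
      also have "\<dots> = poly Q t" by (simp add: Q_def poly_sum poly_monom)
      finally show ?thesis .
    qed
    have "Q = 0"
    proof (rule poly_vanish_of_nat[OF inj])
      fix m
      have "?x (of_nat m) = (\<lambda>j. of_nat ((n(r := m)) j))" by auto
      moreover have "peval (\<lambda>j. of_nat ((n(r := m)) j)) p = 0" by (rule Suc.prems(2)) (use n in auto)
      ultimately show "poly Q (of_nat m) = 0" unfolding ev[symmetric] by simp
    qed
    show "peval (\<lambda>j. of_nat (n j)) (q k) = 0"
    proof (cases "k < N")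
      case True
      have "coeff Q k = peval (\<lambda>j. of_nat (n j)) (q k)"
        unfolding Q_def coeff_sum using True by (simp add: coeff_monom)
      with \<open>Q = 0\<close> show ?thesis by simp
    next
      case False
      have "?K k = {}"
      proof (rule ccontr)
        assume "?K k \<noteq> {}"
        then have "k \<le> Max (insert 0 ((\<lambda>v. lookup v r) ` keys p))" by (intro Max_ge) auto
        with False show False by (simp add: N_def)
      qed
      then have "q k = 0" unfolding q_def by (simp only: sum.empty)
      then show ?thesis by simp
    qed
  qed
  show ?case
  proof (rule poly_mapping_eqI)
    fix v :: "nat \<Rightarrow>\<^sub>0 nat"
    let ?k = "lookup v r"
    have "lookup (q ?k) (v - single r ?k) =
        (\<Sum>w\<in>?K ?k. if w = v then lookup p w else 0)"
      unfolding q_def lookup_sum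
    proof (rule sum.cong[OF refl])
      fix w assume w: "w \<in> ?K ?k"
      then have lw: "lookup w r = ?k" by simp
      have "w - single r ?k = v - single r ?k \<longleftrightarrow> w = v"
        using split[OF lw] split[OF refl, of v] by metis
      then show "lookup (single (w - single r ?k) (lookup p w)) (v - single r ?k)
        = (if w = v then lookup p w else 0)"
        by (simp add: lookup_single)
    qed
    also have "\<dots> = lookup p v" by (auto simp: in_keys_iff)
    finally show "lookup p v = lookup 0 v" using qz by simp
  qed
qed

text \<open>
  Setting the generator to \<open>0\<close> beyond the end of the list makes products over multisets with
  superfluous indices vanish, so that families carry no information at these multisets.
\<close>

definition gen_seq :: "'n::{finite,linorder} cpoly list \<Rightarrow> nat \<Rightarrow> 'n cpoly" where
  "gen_seq fs j = (if j < length fs then fs ! j else 0)"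

text \<open>
  The family \<open>H\<close> consists of the values of \<open>h \<cdot> \<Prod>\<^sub>i f\<^sub>i\<^bsup>s\<^sub>i\<^esup>\<close> at natural parameters, and it
  is required that they are polynomials.
\<close>

definition represents :: "'n::{finite,linorder} cpoly list \<Rightarrow> 'n coef \<Rightarrow> (nat multiset \<Rightarrow> 'n cpoly) \<Rightarrow> bool" where
  "represents fs h H \<longleftrightarrow> (\<forall>M. peval (cnt M) h * emb (gen_prod (gen_seq fs) M) = emb (H M))"

lemma representsD: "represents fs h H \<Longrightarrow> peval (cnt M) h * emb (gen_prod (gen_seq fs) M) = emb (H M)"
  by (simp add: represents_def)

lemma represents_unique: "represents fs h H \<Longrightarrow> represents fs h H' \<Longrightarrow> H = H'"
  unfolding represents_def by (metis emb_eq ext)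

lemma peval_coef_const [simp]: "peval x (coef_const q) = q"
  by (simp add: coef_const_def)

lemma peval_coef_poly [simp]: "peval x (coef_poly p) = emb p"
  by (simp add: coef_poly_def)

lemma peval_svar [simp]: "peval x (svar j) = x j"
  by (simp add: svar_def)

lemma gen_prod_gen_seq_outside: "\<not> set_mset M \<subseteq> {..<length fs} \<Longrightarrow> gen_prod (gen_seq fs) M = 0"
  by (induction M) (auto simp: gen_seq_def)

lemma gen_prod_gen_seq_nonzero: "0 \<notin> set fs \<Longrightarrow> set_mset M \<subseteq> {..<length fs} \<Longrightarrow> gen_prod (gen_seq fs) M \<noteq> 0"
  by (induction M) (auto simp: gen_seq_def in_set_conv_nth)

lemma represents_one: "represents fs 1 (gen_prod (gen_seq fs))"
  by (simp add: represents_def)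

lemma represents_add: "represents fs h H \<Longrightarrow> represents fs h' H' \<Longrightarrow> represents fs (h + h') (\<lambda>M. H M + H' M)"
  by (simp add: represents_def distrib_right emb_add del: add_fract)

lemma represents_mult: "represents fs h H \<Longrightarrow> represents fs (coef_poly p * h) (\<lambda>M. p * H M)"
  by (simp add: represents_def emb_mult mult.assoc del: mult_fract)

lemma peval_s_shift: "peval x (s_shift i c h) = peval (\<lambda>j. x j + (if j = i then of_int c else 0)) h"
proof -
  have "peval x (of_int c) = of_int c" for c
    by (cases c) (simp_all add: of_nat_diff)
  then have "peval x (if j = i then of_int c else 0) = (if j = i then of_int c else 0)" for j
    by simp
  then show ?thesis
    unfolding s_shift_def peval_sum peval_mult peval_prod peval_power peval_add peval_coef_const peval_svar
    by (simp add: peval_def pmon_def)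
qed

lemma represents_t_op:
  assumes "i < length fs" "represents fs h H"
  shows "represents fs (t_op fs i h) (tshift {#i#} H)"
  unfolding represents_def
proof
  fix M
  have "(\<lambda>j. cnt M j + (if j = i then of_int 1 else 0)) = (cnt (add_mset i M) :: nat \<Rightarrow> 'a cpoly fract)"
    by auto
  then have "peval (cnt M) (t_op fs i h) * emb (gen_prod (gen_seq fs) M) =
      peval (cnt (add_mset i M)) h * emb (gen_prod (gen_seq fs) (add_mset i M))"
    using assms(1) by (simp only: t_op_def peval_mult peval_s_shift peval_coef_poly gen_prod_add_mset gen_seq_def if_True emb_mult mult.assoc)
  then show "peval (cnt M) (t_op fs i h) * emb (gen_prod (gen_seq fs) M) = emb (tshift {#i#} H M)"
    using representsD[OF assms(2), of "add_mset i M"] by (simp only: tshift_single)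
qed

lemma represents_s_op:
  assumes nz: "0 \<notin> set fs" and i: "i < length fs" and j: "j < length fs" and h: "represents fs h H"
  shows "represents fs (s_op fs i j h) (tau i (tshift {#j#} H))"
  unfolding represents_def
proof
  fix M
  show "peval (cnt M) (s_op fs i j h) * emb (gen_prod (gen_seq fs) M) = emb (tau i (tshift {#j#} H) M)"
  proof (cases "i \<in># M")
    case True
    then obtain N where M: "M = add_mset i N" by (meson multi_member_split)
    have fi: "emb (fs ! i) \<noteq> 0" using nz i by (intro emb_nonzero) (auto simp: in_set_conv_nth)
    have "(\<lambda>k. cnt M k + (if k = i then of_int (- 1) else 0)) = (cnt N :: nat \<Rightarrow> 'a cpoly fract)"
      by (auto simp: M)
    then have "peval (cnt M) (s_op fs i j h) * emb (gen_prod (gen_seq fs) M) =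
        of_nat (count M i) * (peval (cnt N) (t_op fs j h) * (Fract 1 (fs ! i) * emb (fs ! i)) * emb (gen_prod (gen_seq fs) N))"
      using i by (simp only: s_op_def t_inv_op_def peval_mult peval_s_shift peval_svar peval_coef_const M gen_prod_add_mset gen_seq_def if_True emb_mult ac_simps)
    also have "Fract 1 (fs ! i) * emb (fs ! i) = 1"
      using fi by (subst Fract_conv) (simp add: emb_1)
    also have "peval (cnt N) (t_op fs j h) * 1 * emb (gen_prod (gen_seq fs) N) = emb (tshift {#j#} H N)"
      using representsD[OF represents_t_op[OF j h], of N] by simp
    finally show ?thesis
      by (simp add: tau_def M emb_mult emb_of_nat del: mult_fract of_nat_Suc)
  next
    case False
    then show ?thesis by (simp add: s_op_def tau_def not_in_iff emb_0)
  qed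
qed

lemma lookup_map0: "f 0 = 0 \<Longrightarrow> lookup (Poly_Mapping.map f p) v = f (lookup p v)"
  by transfer (auto simp: when_def)

lemma peval_map_xderiv:
  "peval (cnt M) (Poly_Mapping.map (xderiv_fract k) h) = xderiv_fract k (peval (cnt M) h)"
proof -
  have c: "pmon (cnt M) v = (of_nat (\<Prod>j\<in>keys v. count M j ^ lookup v j) :: 'a cpoly fract)" for v
    by (simp add: pmon_def)
  have d: "xderiv_fract k (q * pmon (cnt M) v) = xderiv_fract k q * pmon (cnt M) v" for q :: "'a cpoly fract" and v
    unfolding c by (simp only: xderiv_fract_mult xderiv_fract_of_nat) simp
  have "keys (Poly_Mapping.map (xderiv_fract k) h) \<subseteq> keys h"
    by (auto simp: in_keys_iff lookup_map0)
  then have "peval (cnt M) (Poly_Mapping.map (xderiv_fract k) h) =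
     (\<Sum>v\<in>keys h. lookup (Poly_Mapping.map (xderiv_fract k) h) v * pmon (cnt M) v)"
    unfolding peval_def by (intro sum_keys_superset) auto
  also have "\<dots> = xderiv_fract k (peval (cnt M) h)"
    by (simp only: peval_def xderiv_fract_sum d lookup_map0[of "xderiv_fract k", OF xderiv_fract_0])
  finally show ?thesis .
qed

text \<open>
  Logarithmic derivative: at natural parameters, the rule that defines \<open>\<partial>\<^sub>k\<close> on
  \<open>\<Prod>\<^sub>i f\<^sub>i\<^bsup>s\<^sub>i\<^esup>\<close> is the usual differentiation of a product.
\<close>

lemma xderiv_fract_gen_prod:
  assumes nz: "0 \<notin> set fs"
  shows "xderiv_fract k (emb (gen_prod (gen_seq fs) M)) =
    (\<Sum>i<length fs. cnt M i * Fract (xderiv k (fs ! i)) (fs ! i)) * emb (gen_prod (gen_seq fs) M)"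
proof (cases "set_mset M \<subseteq> {..<length fs}")
  case True
  then show ?thesis
  proof (induction M)
    case empty
    show ?case by (simp add: xderiv_fract_emb emb_0)
  next
    case (add a M)
    let ?L = "\<lambda>i. Fract (xderiv k (fs ! i)) (fs ! i)"
    have a: "a < length fs" using add.prems by simp
    have fa: "emb (fs ! a) \<noteq> 0" using nz a by (intro emb_nonzero) (auto simp: in_set_conv_nth)
    have "(\<Sum>i<length fs. cnt (add_mset a M) i * ?L i) = (\<Sum>i<length fs. (if a = i then ?L i else 0) + cnt M i * ?L i)"
      by (rule sum.cong) (auto simp: distrib_right)
    also have "\<dots> = ?L a + (\<Sum>i<length fs. cnt M i * ?L i)"
      unfolding sum.distrib using a by (subst sum.delta') auto
    finally have S: "(\<Sum>i<length fs. cnt (add_mset a M) i * ?L i) = ?L a + (\<Sum>i<length fs. cnt M i * ?L i)" .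
    have "?L a * emb (fs ! a) = emb (xderiv k (fs ! a))"
      using nonzero_eq_divide_eq[OF fa] Fract_conv[of "xderiv k (fs ! a)" "fs ! a"] by blast
    then have D: "xderiv_fract k (emb (fs ! a)) = ?L a * emb (fs ! a)"
      by (simp only: xderiv_fract_emb)
    have "xderiv_fract k (emb (gen_prod (gen_seq fs) (add_mset a M))) = xderiv_fract k (emb (fs ! a) * emb (gen_prod (gen_seq fs) M))"
      using a by (simp only: gen_prod_add_mset gen_seq_def if_True emb_mult)
    also have "\<dots> = ?L a * emb (fs ! a) * emb (gen_prod (gen_seq fs) M)
        + emb (fs ! a) * ((\<Sum>i<length fs. cnt M i * ?L i) * emb (gen_prod (gen_seq fs) M))"
      using add.IH add.prems by (simp only: xderiv_fract_mult D set_mset_add_mset_insert insert_subset)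
    also have "\<dots> = (?L a + (\<Sum>i<length fs. cnt M i * ?L i)) * (emb (fs ! a) * emb (gen_prod (gen_seq fs) M))"
      by (simp only: distrib_right distrib_left ac_simps)
    also have "\<dots> = (\<Sum>i<length fs. cnt (add_mset a M) i * ?L i) * emb (gen_prod (gen_seq fs) (add_mset a M))"
      using a by (simp only: S gen_prod_add_mset gen_seq_def if_True emb_mult)
    finally show ?case .
  qed
qed (simp add: gen_prod_gen_seq_outside emb_0)

lemma represents_partial:
  assumes nz: "0 \<notin> set fs" and h: "represents fs h H"
  shows "represents fs (partial_op fs k h) (\<lambda>M. xderiv k (H M))"
  unfolding represents_def
proof
  fix M
  have "peval (cnt M) (partial_op fs k h) * emb (gen_prod (gen_seq fs) M) =
    xderiv_fract k (peval (cnt M) h) * emb (gen_prod (gen_seq fs) M)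
    + peval (cnt M) h * xderiv_fract k (emb (gen_prod (gen_seq fs) M))"
    unfolding xderiv_fract_gen_prod[OF nz]
    by (simp only: partial_op_def peval_add peval_mult peval_sum peval_svar peval_coef_const peval_map_xderiv distrib_right mult.assoc)
  also have "\<dots> = xderiv_fract k (emb (H M))"
    unfolding xderiv_fract_mult[symmetric] representsD[OF h] ..
  finally show "peval (cnt M) (partial_op fs k h) * emb (gen_prod (gen_seq fs) M) = emb (xderiv k (H M))"
    by (simp only: xderiv_fract_emb)
qed

text \<open>
  The elements of \<open>V\<^sup>m\<close> are stable under the generators of the operator ring; in particular
  \<open>s\<^sub>i\<^sub>,\<^sub>j\<close> is a shift followed by \<open>tau\<close>.
\<close>

lemma DS_ring_represents:
  assumes nz: "0 \<notin> set fs" and "P \<in> DS_ring fs" "represents fs h H" "Vfilt (length fs) (gen_seq fs) m H"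
  shows "\<exists>H'. represents fs (P h) H' \<and> Vfilt (length fs) (gen_seq fs) m H'"
  using assms(2-)
proof (induction arbitrary: h H)
  case (mult p)
  then show ?case using represents_mult Vfilt_mult by blast
next
  case (partial k)
  then show ?case using represents_partial[OF nz] Vfilt.deriv by blast
next
  case (s_op i j)
  then show ?case using represents_s_op[OF nz] Vfilt.shift Vfilt.tau by blast
next
  case (plus P P')
  obtain H1 where 1: "represents fs (P h) H1" "Vfilt (length fs) (gen_seq fs) m H1"
    using plus.IH(1)[OF plus.prems] by blast
  obtain H2 where 2: "represents fs (P' h) H2" "Vfilt (length fs) (gen_seq fs) m H2"
    using plus.IH(2)[OF plus.prems] by blast
  show ?case using represents_add[OF 1(1) 2(1)] Vfilt.add[OF 1(2) 2(2)] by blast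
next
  case (comp P P')
  then show ?case unfolding comp_def by meson
qed

lemma peval_eval_at_s:
  "peval (cnt M) (eval_at_s (length fs) b :: 'n::{finite,linorder} coef) * emb (gen_prod (gen_seq fs) M) =
     emb (single 0 (poly b (of_nat (size M))) * gen_prod (gen_seq fs) M)"
proof (cases "set_mset M \<subseteq> {..<length fs}")
  case True
  have s: "(\<Sum>i<length fs. cnt M i :: 'n cpoly fract) = of_nat (size M)"
    by (rule size_conv_sum[OF True, symmetric])
  have "peval (cnt M) (eval_at_s (length fs) b :: 'n coef) = emb (single 0 (poly b (of_nat (size M))))"
  proof (induction b)
    case 0
    show ?case by (simp add: eval_at_s_def emb_0)
  next
    case (pCons c b)
    have c0: "coef_poly (single 0 0) = (0 :: 'n coef)" by (simp add: coef_poly_def coef_const_def emb_0)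
    have "eval_at_s (length fs) (pCons c b) = coef_poly (single 0 c) + (\<Sum>i<length fs. svar i) * (eval_at_s (length fs) b :: 'n coef)"
      using pCons.hyps c0 by (simp add: eval_at_s_def map_poly_pCons)
    then have "peval (cnt M) (eval_at_s (length fs) (pCons c b) :: 'n coef) =
       emb (single 0 c) + emb (of_nat (size M)) * emb (single 0 (poly b (of_nat (size M))))"
      by (simp only: peval_add peval_mult peval_sum peval_svar peval_coef_poly s pCons.IH emb_of_nat)
    also have "\<dots> = emb (single 0 c + of_nat (size M) * single 0 (poly b (of_nat (size M))))"
      by (simp only: emb_add emb_mult)
    also have "single 0 c + of_nat (size M) * single 0 (poly b (of_nat (size M))) =
        (single 0 (poly (pCons c b) (of_nat (size M))) :: 'n cpoly)"
      by (simp only: single_of_nat[symmetric] mult_single add_0_left single_add[symmetric] poly_pCons)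
    finally show ?case .
  qed
  then show ?thesis by (simp only: emb_mult)
qed (simp add: gen_prod_gen_seq_outside emb_0)

lemma model_relation_of_bernstein_sato:
  assumes nz: "0 \<notin> set fs" and ne: "fs \<noteq> []" and rel: "bernstein_sato_relation fs b"
  shows "model_relation (length fs) (gen_seq fs) b"
proof -
  obtain P where P: "\<And>k. k < length fs \<Longrightarrow> P k \<in> DS_ring fs"
    and eq: "eval_at_s (length fs) b = (\<Sum>k<length fs. P k (t_op fs k 1))"
    using rel unfolding bernstein_sato_relation_def by auto
  have "\<exists>H'. represents fs (P k (t_op fs k 1)) H' \<and> Vfilt (length fs) (gen_seq fs) 1 H'" if "k < length fs" for k
    using DS_ring_represents[OF nz P[OF that] represents_t_op[OF that represents_one] Vfilt.shift[OF that Vfilt.base]] by simp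
  then obtain H where H: "\<And>k. k < length fs \<Longrightarrow> represents fs (P k (t_op fs k 1)) (H k)"
    and V: "\<And>k. k < length fs \<Longrightarrow> Vfilt (length fs) (gen_seq fs) 1 (H k)" by metis
  have "represents fs (\<Sum>k\<in>A. P k (t_op fs k 1)) (\<lambda>M. \<Sum>k\<in>A. H k M)" if "finite A" "A \<subseteq> {..<length fs}" for A
    using that
  proof (induction A rule: finite_induct)
    case empty
    show ?case by (simp add: represents_def emb_0)
  next
    case (insert x A)
    then show ?case using represents_add[OF H] by auto
  qed
  then have "represents fs (eval_at_s (length fs) b) (\<lambda>M. \<Sum>k<length fs. H k M)" unfolding eq by simp
  moreover have "represents fs (eval_at_s (length fs) b) (\<lambda>M. single 0 (poly b (of_nat (size M))) * gen_prod (gen_seq fs) M)"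
    unfolding represents_def by (intro allI peval_eval_at_s)
  ultimately have "(\<lambda>M. \<Sum>k<length fs. H k M) = (\<lambda>M. single 0 (poly b (of_nat (size M))) * gen_prod (gen_seq fs) M)"
    by (rule represents_unique)
  moreover have "Vfilt (length fs) (gen_seq fs) 1 (\<lambda>M. \<Sum>k<length fs. H k M)"
    using ne V by (intro Vfilt_sum[OF V[of 0]]) auto
  ultimately show ?thesis by (simp add: model_relation_def)
qed

text \<open>
  The submodule generated by the \<open>t\<^sub>k \<Prod>\<^sub>i f\<^sub>i\<^bsup>s\<^sub>i\<^esup>\<close> over the ring that occurs in the functional
  equation, in terms of families.
\<close>

inductive DS_module :: "nat \<Rightarrow> (nat \<Rightarrow> 'n::{finite,linorder} cpoly) \<Rightarrow> (nat multiset \<Rightarrow> 'n cpoly) \<Rightarrow> bool"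
  for r f where
  base: "k < r \<Longrightarrow> DS_module r f (tshift {#k#} (gen_prod f))"
| add: "DS_module r f H \<Longrightarrow> DS_module r f H' \<Longrightarrow> DS_module r f (\<lambda>M. H M + H' M)"
| mult: "DS_module r f H \<Longrightarrow> DS_module r f (\<lambda>M. p * H M)"
| deriv: "DS_module r f H \<Longrightarrow> DS_module r f (\<lambda>M. xderiv k (H M))"
| st: "i < r \<Longrightarrow> j < r \<Longrightarrow> DS_module r f H \<Longrightarrow> DS_module r f (tau i (tshift {#j#} H))"

lemma DS_module_zero: "0 < r \<Longrightarrow> DS_module r f (\<lambda>M. 0)"
  using DS_module.mult[OF DS_module.base, of 0 r f 0] by simp

primrec tau_list :: "nat list \<Rightarrow> (nat multiset \<Rightarrow> 'n::{finite,linorder} cpoly) \<Rightarrow> nat multiset \<Rightarrow> 'n cpoly" where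
  "tau_list [] H = H"
| "tau_list (i # is) H = tau i (tau_list is H)"

lemma tau_add: "tau j (\<lambda>M. H M + H' M) = (\<lambda>M. tau j H M + tau j H' M)"
  by (auto simp: tau_def distrib_left)

lemma tau_mult: "tau j (\<lambda>M. p * H M) = (\<lambda>M. p * tau j H M)"
  by (auto simp: tau_def mult.left_commute)

lemma xderiv_of_nat_mult: "xderiv k (of_nat n * p) = of_nat n * xderiv k p"
  by (induction n) (simp_all add: distrib_right xderiv_add xderiv_zero)

lemma tau_xderiv: "tau j (\<lambda>M. xderiv k (H M)) = (\<lambda>M. xderiv k (tau j H M))"
  by (auto simp: tau_def xderiv_of_nat_mult)

lemma tau_list_add: "tau_list is (\<lambda>M. H M + H' M) = (\<lambda>M. tau_list is H M + tau_list is H' M)"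
  by (induction "is") (auto simp: tau_add)

lemma tau_list_mult: "tau_list is (\<lambda>M. p * H M) = (\<lambda>M. p * tau_list is H M)"
  by (induction "is") (auto simp: tau_mult)

lemma tau_list_xderiv: "tau_list is (\<lambda>M. xderiv k (H M)) = (\<lambda>M. xderiv k (tau_list is H M))"
  by (induction "is") (auto simp: tau_xderiv)

lemma tau_list_append: "tau_list (is @ js) H = tau_list is (tau_list js H)"
  by (induction "is") auto

text \<open>
  The commutator of \<open>t\<^sub>j\<close> with a composition of operators \<open>tau\<close>: by the product rule for
  commutators, each factor \<open>tau j\<close> is deleted in turn.
\<close>

primrec tau_commutator :: "nat \<Rightarrow> nat list \<Rightarrow> (nat multiset \<Rightarrow> 'n::{finite,linorder} cpoly) \<Rightarrow> nat multiset \<Rightarrow> 'n cpoly" where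
  "tau_commutator j [] H = (\<lambda>M. 0)"
| "tau_commutator j (i # is) H = (\<lambda>M. tau i (tau_commutator j is H) M + (if i = j then 1 else 0) * tau_list is H M)"

lemma tshift_tau_list: "tshift {#j#} (tau_list is H) = (\<lambda>M. tau_list is (tshift {#j#} H) M + tau_commutator j is H M)"
proof (induction "is")
  case (Cons i "is")
  have "tshift {#j#} (tau i (tau_list is H)) =
      (\<lambda>M. tau i (tshift {#j#} (tau_list is H)) M + (if i = j then 1 else 0) * tau_list is H M)"
    by (rule ext) (auto simp: tshift_tau, simp add: tshift_def)
  then show ?case by (simp only: tau_list.simps tau_commutator.simps Cons.IH tau_add add.assoc)
qed simp

lemma tau_list_commutator_mem:
  assumes "0 < r"
    and "\<And>ls. Suc (length ls) = length pre + length is \<Longrightarrow> set ls \<subseteq> set pre \<union> set is \<Longrightarrow> DS_module r f (tau_list ls H)"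
  shows "DS_module r f (tau_list pre (tau_commutator j is H))"
  using assms(2)
proof (induction "is" arbitrary: pre)
  case Nil
  have "tau_list pre (\<lambda>M. 0 * H M) = (\<lambda>M. 0 * tau_list pre H M)" by (rule tau_list_mult)
  then show ?case using DS_module_zero[OF assms(1)] by simp
next
  case (Cons i "is")
  have 1: "DS_module r f (tau_list (pre @ [i]) (tau_commutator j is H))"
    by (rule Cons.IH) (use Cons.prems in auto)
  have 2: "DS_module r f (tau_list (pre @ is) H)"
    by (rule Cons.prems) auto
  have "tau_list pre (tau_commutator j (i # is) H) =
     (\<lambda>M. tau_list (pre @ [i]) (tau_commutator j is H) M + (if i = j then 1 else 0) * tau_list (pre @ is) H M)"
    by (simp only: tau_commutator.simps tau_list_add tau_list_mult tau_list_append tau_list.simps)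
  then show ?case using DS_module.add[OF 1 DS_module.mult[OF 2]] by simp
qed

text \<open>
  A composition of \<open>p\<close> operators \<open>tau\<close> after \<open>p + 1\<close> shifts is a combination of products of
  at most \<open>p\<close> operators \<open>tau\<^sub>i t\<^sub>j\<close> after one shift: move one shift to the left through all but one \<open>tau\<close>
  and treat the commutator, which contains fewer \<open>tau\<close>, by induction.
\<close>

lemma DS_module_tau_list_gen_prod:
  assumes "0 < r"
  shows "set is \<subseteq> {..<r} \<Longrightarrow> set_mset J \<subseteq> {..<r} \<Longrightarrow> size J = Suc (length is) \<Longrightarrow>
    DS_module r f (tau_list is (tshift J (gen_prod f)))"
proof (induction "length is" arbitrary: "is" J)
  case 0
  then obtain k where "J = {#k#}" by (metis length_0_conv One_nat_def size_1_singleton_mset list.size(3))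
  with 0 show ?case by (auto intro: DS_module.base)
next
  case (Suc n)
  then obtain i is' where is_eq: "is = i # is'" by (cases "is") auto
  obtain j J' where J: "J = add_mset j J'" using Suc.prems(3) by (metis size_eq_Suc_imp_eq_union)
  let ?G = "tshift J' (gen_prod f)"
  have len: "length is' = n" "size J' = Suc n" using Suc.hyps(2) Suc.prems(3) is_eq J by auto
  have IH: "DS_module r f (tau_list ls ?G)" if "length ls = n" "set ls \<subseteq> {..<r}" for ls
    using Suc.hyps(1)[of ls J'] that Suc.prems J len by auto
  have "tau_list is' (tshift {#j#} ?G) = (\<lambda>M. tshift {#j#} (tau_list is' ?G) M + (- 1) * tau_commutator j is' ?G M)"
    unfolding tshift_tau_list by auto
  then have "tau_list is (tshift J (gen_prod f)) =
      (\<lambda>M. tau i (tshift {#j#} (tau_list is' ?G)) M + (- 1) * tau_list [i] (tau_commutator j is' ?G) M)"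
    by (simp only: is_eq J tau_list.simps tau_add tau_mult tshift_tshift[of "{#j#}" J', symmetric, unfolded add_mset_add_single[symmetric] union_commute[of "{#j#}"]])
  moreover have 1: "DS_module r f (tau i (tshift {#j#} (tau_list is' ?G)))"
    using Suc.prems is_eq J len by (intro DS_module.st IH) auto
  moreover have 2: "DS_module r f (tau_list [i] (tau_commutator j is' ?G))"
    using Suc.prems is_eq len by (intro tau_list_commutator_mem assms IH) auto
  ultimately show ?case using DS_module.add[OF 1 DS_module.mult[OF 2, of "- 1"]] by (simp only:)
qed

text \<open>
  This is the normal form argument that makes \<open>V\<^sup>1\<close> equal to the submodule above.  An element of
  \<open>V\<^sup>m\<close> is brought into degree \<open>1\<close> by further shifts \<open>J\<close> and operators \<open>tau\<close>; with these free, the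
  induction over \<open>H\<close> only has to move its outermost operator into the list or into \<open>J\<close>.
\<close>

lemma DS_module_tau_list_Vfilt:
  assumes r: "0 < r" and "Vfilt r f m H" "set is \<subseteq> {..<r}" "set_mset J \<subseteq> {..<r}" "Suc (length is) = m + size J"
  shows "DS_module r f (tau_list is (tshift J H))"
  using assms(2-)
proof (induction arbitrary: "is" J rule: Vfilt.induct)
  case base
  then show ?case by (intro DS_module_tau_list_gen_prod r) auto
next
  case (add m H H')
  have "tau_list is (tshift J (\<lambda>M. H M + H' M)) = (\<lambda>M. tau_list is (tshift J H) M + tau_list is (tshift J H') M)"
    by (simp add: tshift_eq tau_list_add)
  then show ?case using add by (auto intro: DS_module.add)
next
  case (mono m H u c)
  have "tau_list is (tshift J (\<lambda>M. single u c * H M)) = (\<lambda>M. single u c * tau_list is (tshift J H) M)"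
    by (simp add: tshift_eq tau_list_mult)
  then show ?case using mono by (auto intro: DS_module.mult)
next
  case (deriv m H k)
  have "tau_list is (tshift J (\<lambda>M. xderiv k (H M))) = (\<lambda>M. xderiv k (tau_list is (tshift J H) M))"
    by (simp add: tshift_eq tau_list_xderiv)
  then show ?case using deriv by (auto intro: DS_module.deriv)
next
  case (shift j m H)
  have "tshift J (tshift {#j#} H) = tshift (add_mset j J) H" by (simp add: tshift_tshift)
  then show ?case using shift by auto
next
  case (tau j m H)
  have "tshift J (tau j H) = (\<lambda>M. tau j (tshift J H) M + of_nat (count J j) * tshift (J - {#j#}) H M)"
    by (rule ext) (rule tshift_tau)
  then have eq: "tau_list is (tshift J (tau j H)) =
      (\<lambda>M. tau_list (is @ [j]) (tshift J H) M + of_nat (count J j) * tau_list is (tshift (J - {#j#}) H) M)"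
    by (simp only: tau_list_add tau_list_mult tau_list_append tau_list.simps)
  have 1: "DS_module r f (tau_list (is @ [j]) (tshift J H))"
    using tau.prems tau.hyps by (intro tau.IH) auto
  have 2: "DS_module r f (\<lambda>M. of_nat (count J j) * tau_list is (tshift (J - {#j#}) H) M)"
  proof (cases "j \<in># J")
    case True
    have "set_mset (J - {#j#}) \<subseteq> {..<r}" using tau.prems by (meson in_diffD subset_iff)
    moreover have "Suc (length is) = Suc m + size (J - {#j#})"
      using tau.prems size_Suc_Diff1[OF True] by linarith
    ultimately show ?thesis using tau.prems by (intro DS_module.mult tau.IH) auto
  next
    case False
    then show ?thesis using DS_module_zero[OF r] by (simp add: not_in_iff)
  qed
  show ?case unfolding eq by (rule DS_module.add[OF 1 2])
qed

lemma Vfilt_DS_module: "0 < r \<Longrightarrow> Vfilt r f 1 H \<Longrightarrow> DS_module r f H"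
  using DS_module_tau_list_Vfilt[of r f 1 H "[]" "{#}"] by (simp add: tshift_eq)

lemma vars_belowD: "p \<in> vars_below r \<Longrightarrow> v \<in> keys p \<Longrightarrow> keys v \<subseteq> {..<r}"
  by (auto simp: vars_below_def)

lemma vars_below_0 [simp]: "0 \<in> vars_below r" by (simp add: vars_below_def)

lemma vars_below_const [simp]: "single 0 c \<in> vars_below r" by (auto simp: vars_below_def)

lemma vars_below_1 [simp]: "1 \<in> vars_below r" unfolding single_one[symmetric] by (rule vars_below_const)

lemma vars_below_coef_const [simp]: "coef_const q \<in> vars_below r" by (simp add: coef_const_def)

lemma vars_below_coef_poly [simp]: "coef_poly q \<in> vars_below r" by (simp add: coef_poly_def)

lemma vars_below_svar: "j < r \<Longrightarrow> svar j \<in> vars_below r"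
  by (auto simp: vars_below_def svar_def split: if_splits)

lemma vars_below_add:
  assumes "p \<in> vars_below r" "q \<in> vars_below r" shows "p + q \<in> vars_below r"
proof -
  have "v \<in> keys p \<or> v \<in> keys q" if "v \<in> keys (p + q)" for v
    using keys_add[of p q] that by blast
  then show ?thesis using assms by (auto simp: vars_below_def)
qed

lemma vars_below_uminus: "p \<in> vars_below r \<Longrightarrow> - p \<in> vars_below r"
  by (simp add: vars_below_def)

lemma vars_below_mult:
  assumes "p \<in> vars_below r" "q \<in> vars_below r" shows "p * q \<in> vars_below r"
  unfolding vars_below_def
proof (intro CollectI ballI)
  fix v assume "v \<in> keys (p * q)"
  then obtain a b where "v = a + b" "a \<in> keys p" "b \<in> keys q"
    using keys_mult[of p q] by auto
  then show "keys v \<subseteq> {..<r}"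
    using assms keys_add[of a b] unfolding vars_below_def by blast
qed

lemma vars_below_sum: "(\<And>a. a \<in> A \<Longrightarrow> g a \<in> vars_below r) \<Longrightarrow> sum g A \<in> vars_below r"
  by (induction A rule: infinite_finite_induct) (auto intro: vars_below_add)

lemma vars_below_prod: "(\<And>a. a \<in> A \<Longrightarrow> g a \<in> vars_below r) \<Longrightarrow> prod g A \<in> vars_below r"
  by (induction A rule: infinite_finite_induct) (auto intro: vars_below_mult)

lemma vars_below_power: "p \<in> vars_below r \<Longrightarrow> p ^ n \<in> vars_below r"
  by (induction n) (auto intro: vars_below_mult)

lemma vars_below_of_int: "of_int c \<in> vars_below r"
proof -
  have n: "of_nat n \<in> vars_below r" for n by (induction n) (auto intro: vars_below_add)
  show ?thesis by (cases c rule: int_cases2) (auto intro: n vars_below_uminus)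
qed

text \<open>
  Coefficients are polynomials in infinitely many variables \<open>s\<^sub>j\<close>, but evaluation at multisets
  over \<open>{..<r}\<close> sees only the first \<open>r\<close> of them.  The operators of the functional equation do not
  introduce others.
\<close>

lemma vars_below_s_shift:
  assumes h: "h \<in> vars_below r"
  shows "s_shift i c h \<in> vars_below r"
proof -
  have "svar j + (if j = i then of_int c else 0) \<in> vars_below r"
    if "v \<in> keys h" "j \<in> keys v" for v j
  proof -
    have "j < r" using vars_belowD[OF h that(1)] that(2) by blast
    then show ?thesis by (simp add: vars_below_add vars_below_svar vars_below_of_int)
  qed
  then show ?thesis
    unfolding s_shift_def by (intro vars_below_sum vars_below_mult vars_below_prod vars_below_power vars_below_coef_const)
qed

lemma vars_below_t_op: "h \<in> vars_below r \<Longrightarrow> t_op fs i h \<in> vars_below r"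
  unfolding t_op_def by (intro vars_below_mult vars_below_s_shift) auto

lemma vars_below_s_op: "i < r \<Longrightarrow> h \<in> vars_below r \<Longrightarrow> s_op fs i j h \<in> vars_below r"
  unfolding s_op_def t_inv_op_def by (intro vars_below_mult vars_below_s_shift vars_below_t_op vars_below_svar) auto

lemma vars_below_partial_op: "h \<in> vars_below (length fs) \<Longrightarrow> partial_op fs k h \<in> vars_below (length fs)"
  unfolding partial_op_def
proof (intro vars_below_add vars_below_mult vars_below_sum vars_below_coef_const)
  assume h: "h \<in> vars_below (length fs)"
  have "keys (Poly_Mapping.map (xderiv_fract k) h) \<subseteq> keys h"
    by (auto simp: in_keys_iff lookup_map0)
  then show "Poly_Mapping.map (xderiv_fract k) h \<in> vars_below (length fs)"
    using h by (auto simp: vars_below_def)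
qed (auto intro: vars_below_svar)

lemma vars_below_eval_at_s: "(eval_at_s r b :: 'n::{finite,linorder} coef) \<in> vars_below r"
proof (induction b)
  case 0
  show ?case by (simp add: eval_at_s_def)
next
  case (pCons c b)
  have c0: "coef_poly (single 0 0) = (0 :: 'n coef)" by (simp add: coef_poly_def coef_const_def emb_0)
  have "eval_at_s r (pCons c b) = coef_poly (single 0 c) + (\<Sum>i<r. svar i) * (eval_at_s r b :: 'n coef)"
    using pCons.hyps c0 by (simp add: eval_at_s_def map_poly_pCons)
  then show ?case using pCons.IH by (auto intro!: vars_below_add vars_below_mult vars_below_sum vars_below_svar)
qed

lemma s_shift_add: "s_shift i c (g + h) = s_shift i c g + s_shift i c h"
  unfolding s_shift_def
  by (rule sum_keys_add) (auto simp: coef_const_def single_add distrib_right)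

lemma DS_ring_add:
  assumes "P \<in> DS_ring fs" shows "P (g + h) = P g + P h"
  using assms
proof (induction arbitrary: g h)
  case (partial k)
  have "Poly_Mapping.map (xderiv_fract k) (g + h) = Poly_Mapping.map (xderiv_fract k) g + Poly_Mapping.map (xderiv_fract k) h"
    by (rule poly_mapping_eqI) (simp add: lookup_map0 lookup_add xderiv_fract_add)
  then show ?case by (simp add: partial_op_def distrib_right algebra_simps)
qed (auto simp: distrib_left distrib_right s_op_def t_inv_op_def t_op_def s_shift_add algebra_simps)

lemma DS_ring_sum:
  assumes "P \<in> DS_ring fs" shows "P (sum g A) = (\<Sum>a\<in>A. P (g a))"
proof -
  have "P 0 = 0" using DS_ring_add[OF assms, of 0 0] by (simp only: add_0_left add_cancel_right_right)
  then show ?thesis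
    by (induction A rule: infinite_finite_induct) (auto simp: DS_ring_add[OF assms])
qed

definition DS_span :: "'n::{finite,linorder} cpoly list \<Rightarrow> 'n coef set" where
  "DS_span fs = {h. \<exists>P. (\<forall>k<length fs. P k \<in> DS_ring fs) \<and> h = (\<Sum>k<length fs. P k (t_op fs k 1))}"

lemma DS_span_apply:
  assumes "P \<in> DS_ring fs" "h \<in> DS_span fs" shows "P h \<in> DS_span fs"
proof -
  obtain Q where Q: "\<forall>k<length fs. Q k \<in> DS_ring fs" "h = (\<Sum>k<length fs. Q k (t_op fs k 1))"
    using assms(2) by (auto simp: DS_span_def)
  have "P h = (\<Sum>k<length fs. (P \<circ> Q k) (t_op fs k 1))"
    unfolding Q(2) DS_ring_sum[OF assms(1)] by simp
  then show ?thesis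
    using Q(1) DS_ring.comp[OF assms(1)] unfolding DS_span_def by (intro CollectI exI[of _ "\<lambda>k. P \<circ> Q k"]) simp
qed

lemma DS_span_add:
  assumes "g \<in> DS_span fs" "h \<in> DS_span fs" shows "g + h \<in> DS_span fs"
proof -
  obtain P where P: "\<forall>k<length fs. P k \<in> DS_ring fs" "g = (\<Sum>k<length fs. P k (t_op fs k 1))"
    using assms(1) by (auto simp: DS_span_def)
  obtain Q where Q: "\<forall>k<length fs. Q k \<in> DS_ring fs" "h = (\<Sum>k<length fs. Q k (t_op fs k 1))"
    using assms(2) by (auto simp: DS_span_def)
  show ?thesis unfolding DS_span_def P(2) Q(2)
    using P(1) Q(1) by (intro CollectI exI[of _ "\<lambda>k h. P k h + Q k h"]) (auto simp: sum.distrib intro: DS_ring.plus)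
qed

lemma DS_span_base: "k < length fs \<Longrightarrow> t_op fs k 1 \<in> DS_span fs"
proof -
  assume k: "k < length fs"
  have "coef_poly (if j = k then 1 else 0) * t_op fs j 1 = (if k = j then t_op fs j 1 else 0)" for j
    by (simp add: coef_poly_def coef_const_def emb_0 emb_1)
  then have "t_op fs k 1 = (\<Sum>j<length fs. (\<lambda>h. coef_poly (if j = k then 1 else 0) * h) (t_op fs j 1))"
    using k by simp
  then show ?thesis unfolding DS_span_def
    by (intro CollectI exI[of _ "\<lambda>j h. coef_poly (if j = k then 1 else 0) * h"]) (auto intro: DS_ring.mult)
qed

lemma DS_module_represented:
  assumes nz: "0 \<notin> set fs" and "DS_module (length fs) (gen_seq fs) H"
  shows "\<exists>h. h \<in> DS_span fs \<and> h \<in> vars_below (length fs) \<and> represents fs h H"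
  using assms(2)
proof (induction rule: DS_module.induct)
  case (base k)
  then show ?case using DS_span_base vars_below_t_op[OF vars_below_1] represents_t_op[OF _ represents_one] by blast
next
  case (add H H')
  then obtain g h where "g \<in> DS_span fs" "g \<in> vars_below (length fs)" "represents fs g H"
    "h \<in> DS_span fs" "h \<in> vars_below (length fs)" "represents fs h H'" by blast
  then show ?case by (intro exI[of _ "g + h"]) (simp add: DS_span_add vars_below_add represents_add)
next
  case (mult H p)
  then obtain h where h: "h \<in> DS_span fs" "h \<in> vars_below (length fs)" "represents fs h H" by blast
  then show ?case using DS_span_apply[OF DS_ring.mult] vars_below_mult[OF vars_below_coef_poly] represents_mult by blast
next
  case (deriv H k)
  then show ?case using DS_span_apply[OF DS_ring.partial] vars_below_partial_op represents_partial[OF nz] by blast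
next
  case (st i j H)
  then obtain h where h: "h \<in> DS_span fs" "h \<in> vars_below (length fs)" "represents fs h H" by blast
  show ?case
    using DS_span_apply[OF DS_ring.s_op[OF st(1,2)] h(1)] vars_below_s_op[OF st(1) h(2)]
      represents_s_op[OF nz st(1,2) h(3)] by blast
qed

text \<open>
  The generators are nonzero, so the values of \<open>h \<cdot> \<Prod>\<^sub>i f\<^sub>i\<^bsup>s\<^sub>i\<^esup>\<close> at natural parameters
  determine those of \<open>h\<close>, and \<open>peval_vanish\<close> determines \<open>h\<close>.
\<close>

lemma represents_inj:
  fixes g h :: "'n::{finite,linorder} coef"
  assumes nz: "0 \<notin> set fs" and "g \<in> vars_below (length fs)" "h \<in> vars_below (length fs)" "represents fs g H" "represents fs h H"
  shows "g = h"
proof -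
  have "g - h = 0"
  proof (rule peval_vanish[OF inj_of_nat_fract])
    show "g - h \<in> vars_below (length fs)" using vars_below_add[OF assms(2) vars_below_uminus[OF assms(3)]] by simp
    fix n :: "nat \<Rightarrow> nat" assume n: "\<And>j. j \<ge> length fs \<Longrightarrow> n j = 0"
    define M where "M = (\<Sum>j<length fs. replicate_mset (n j) j)"
    have cM: "count M j = n j" for j using n[of j] by (auto simp: M_def count_sum)
    then have "j < length fs" if "j \<in># M" for j using that n[of j] by (metis count_greater_zero_iff not_less less_irrefl)
    then have M: "set_mset M \<subseteq> {..<length fs}" by auto
    have "emb (gen_prod (gen_seq fs) M) \<noteq> 0" using gen_prod_gen_seq_nonzero[OF nz M] by (rule emb_nonzero)
    moreover have "peval (cnt M) g * emb (gen_prod (gen_seq fs) M) = peval (cnt M) h * emb (gen_prod (gen_seq fs) M)"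
      using representsD[OF assms(4)] representsD[OF assms(5)] by (simp only:)
    ultimately have "peval (cnt M) g = peval (cnt M) h" by (simp only: mult_cancel_right simp_thms)
    then show "peval (\<lambda>j. of_nat (n j)) (g - h) = 0" by (simp add: cM)
  qed
  then show ?thesis by simp
qed

text \<open>
  Forwards, evaluate.  Backwards, lift the element of the submodule to an element of the original
  module and use that the lift is unique.
\<close>

theorem bernstein_sato_relation_iff:
  assumes nz: "0 \<notin> set fs" and ne: "fs \<noteq> []"
  shows "bernstein_sato_relation fs b \<longleftrightarrow> model_relation (length fs) (gen_seq fs) b"
proof
  assume "model_relation (length fs) (gen_seq fs) b"
  then have "DS_module (length fs) (gen_seq fs) (\<lambda>M. single 0 (poly b (of_nat (size M))) * gen_prod (gen_seq fs) M)"
    unfolding model_relation_def using ne by (intro Vfilt_DS_module) auto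
  from DS_module_represented[OF nz this] obtain h where h: "h \<in> DS_span fs" "h \<in> vars_below (length fs)"
    "represents fs h (\<lambda>M. single 0 (poly b (of_nat (size M))) * gen_prod (gen_seq fs) M)" by blast
  have "represents fs (eval_at_s (length fs) b) (\<lambda>M. single 0 (poly b (of_nat (size M))) * gen_prod (gen_seq fs) M)"
    unfolding represents_def by (intro allI peval_eval_at_s)
  from represents_inj[OF nz vars_below_eval_at_s h(2) this h(3)] h(1)
  show "bernstein_sato_relation fs b" by (simp add: bernstein_sato_relation_def DS_span_def)
qed (rule model_relation_of_bernstein_sato[OF assms])

section \<open>Monomial generators: stuck points give roots\<close>

text \<open>
  The exponent of \<open>x\<^sub>i\<close> in \<open>\<Prod>\<^sub>j (x\<^bsup>a\<^sub>j\<^esup>)\<^bsup>z\<^sub>j\<^esup>\<close>, for formal exponents \<open>z\<^sub>j\<close>.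
\<close>

definition ell :: "nat \<Rightarrow> (nat \<Rightarrow> 'n \<Rightarrow>\<^sub>0 nat) \<Rightarrow> (nat \<Rightarrow> 'b::comm_semiring_1) \<Rightarrow> 'n \<Rightarrow> 'b" where
  "ell r a z i = (\<Sum>j<r. z j * of_nat (lookup (a j) i))"

definition negint :: "complex set" where
  "negint = {- of_nat (Suc n) | n. True}"

text \<open>
  In a family obtained from the basic one by operators of total degree one, the monomial of
  exponent \<open>\<ell>(z)\<close> at the parameter \<open>z\<close> comes from the monomial of exponent \<open>\<ell>(z + c)\<close> at a
  translated parameter \<open>z + c\<close>.  The two conditions on \<open>c\<close> must hold then: the factor \<open>s\<^sub>j\<close> of
  \<open>tau\<close> keeps natural parameters natural, and the constants, killed by \<open>\<partial>\<^sub>i\<close>, cannot contribute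
  to negative exponents.  At a stuck point there is no such \<open>c\<close>.
\<close>

definition stuck :: "nat \<Rightarrow> (nat \<Rightarrow> 'n \<Rightarrow>\<^sub>0 nat) \<Rightarrow> (nat \<Rightarrow> complex) \<Rightarrow> bool" where
  "stuck r a z \<longleftrightarrow> \<not> (\<exists>c :: nat \<Rightarrow> int. (\<Sum>j<r. c j) = 1 \<and>
      (\<forall>j<r. z j \<in> \<nat> \<longrightarrow> z j + of_int (c j) \<in> \<nat>) \<and>
      (\<forall>i. ell r a z i \<in> negint \<longrightarrow> ell r a z i + of_int (ell r a c i) \<in> negint))"

definition monomial_gens :: "nat \<Rightarrow> (nat \<Rightarrow> 'n \<Rightarrow>\<^sub>0 nat) \<Rightarrow> nat \<Rightarrow> 'n::{finite,linorder} cpoly" where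
  "monomial_gens r a j = (if j < r then xmonom (a j) else 0)"

definition exponent_sum :: "(nat \<Rightarrow> 'n \<Rightarrow>\<^sub>0 nat) \<Rightarrow> nat multiset \<Rightarrow> 'n \<Rightarrow>\<^sub>0 nat" where
  "exponent_sum a M = sum_mset (image_mset a M)"

lemma ell_add: "ell r a (\<lambda>j. y j + z j) i = ell r a y i + ell r a z i"
  by (simp add: ell_def distrib_right sum.distrib)

lemma ell_of_int: "ell r a (\<lambda>j. of_int (c j)) i = of_int (ell r a c i)"
  by (simp add: ell_def)

lemma ell_delta:
  "j < r \<Longrightarrow> ell r a (\<lambda>k. if k = j then x else 0) i = x * of_nat (lookup (a j) i)"
  unfolding ell_def by (subst sum.remove[of _ j]) auto

lemma gen_prod_monomial_gens:
  "gen_prod (monomial_gens r a) M = (if set_mset M \<subseteq> {..<r} then xmonom (exponent_sum a M) else 0)"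
  by (induction M) (auto simp: monomial_gens_def exponent_sum_def xmonom_def mult_single)

lemma lookup_exponent_sum:
  assumes "set_mset M \<subseteq> {..<r}"
  shows "of_nat (lookup (exponent_sum a M) i) = (ell r a (cnt M) i :: 'b::comm_ring_1)"
  using assms
proof (induction M)
  case empty
  show ?case by (simp add: exponent_sum_def ell_def)
next
  case (add j M)
  have "(cnt (add_mset j M) :: nat \<Rightarrow> 'b) = (\<lambda>k. (if k = j then 1 else 0) + cnt M k)"
    by (auto simp: fun_eq_iff)
  then show ?case using add by (simp add: exponent_sum_def lookup_add ell_add ell_delta)
qed

lemma negint_not_Nats: "x \<in> negint \<Longrightarrow> x \<notin> \<nat>"
proof (rule notI)
  assume "x \<in> negint" "x \<in> \<nat>"
  then obtain n m where "x = - of_nat (Suc n)" "x = of_nat m" unfolding negint_def by (blast elim: Nats_cases)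
  then have "complex_of_nat (m + Suc n) = 0" by (simp only: of_nat_add) (simp add: add_eq_0_iff)
  then show False unfolding of_nat_eq_0_iff by simp
qed

lemma negint_diff_nat: "x \<in> negint \<Longrightarrow> x - of_nat k \<in> negint"
proof -
  assume "x \<in> negint"
  then obtain n where "x = - of_nat (Suc n)" by (auto simp: negint_def)
  then have "x - of_nat k = - of_nat (Suc (n + k))" by simp
  then show ?thesis unfolding negint_def by blast
qed

lemma negint_plus_one: "x \<in> negint \<Longrightarrow> x + 1 \<noteq> 0 \<Longrightarrow> x + 1 \<in> negint"
proof -
  assume "x \<in> negint" "x + 1 \<noteq> 0"
  then obtain n where n: "x = - of_nat (Suc n)" by (auto simp: negint_def)
  with \<open>x + 1 \<noteq> 0\<close> obtain m where "n = Suc m" by (cases n) auto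
  then have "x + 1 = - of_nat (Suc m)" using n by simp
  then show ?thesis unfolding negint_def by blast
qed

lemma nat_minus_one: "x \<in> \<nat> \<Longrightarrow> x \<noteq> 0 \<Longrightarrow> x - 1 \<in> (\<nat> :: complex set)"
proof -
  assume "x \<in> \<nat>" "x \<noteq> 0"
  then obtain n where "x = of_nat (Suc n)" by (metis Nats_cases not0_implies_Suc of_nat_0)
  then show ?thesis by simp
qed

lemma ell_Nats: "(\<And>j. j < r \<Longrightarrow> z j \<in> \<nat>) \<Longrightarrow> ell r a z i \<in> (\<nat> :: complex set)"
  unfolding ell_def by (induction r) auto

inductive polyfun :: "((nat \<Rightarrow> complex) \<Rightarrow> complex) \<Rightarrow> bool" where
  const: "polyfun (\<lambda>s. c)"
| var: "polyfun (\<lambda>s. s j)"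
| add: "polyfun F \<Longrightarrow> polyfun G \<Longrightarrow> polyfun (\<lambda>s. F s + G s)"
| mult: "polyfun F \<Longrightarrow> polyfun G \<Longrightarrow> polyfun (\<lambda>s. F s * G s)"

lemma polyfun_diff: "polyfun F \<Longrightarrow> polyfun G \<Longrightarrow> polyfun (\<lambda>s. F s - G s)"
  using polyfun.add[OF _ polyfun.mult[OF polyfun.const[of "-1"]], of F G] by simp

lemma polyfun_sum: "(\<And>a. a \<in> A \<Longrightarrow> polyfun (F a)) \<Longrightarrow> polyfun (\<lambda>s. \<Sum>a\<in>A. F a s)"
  by (induction A rule: infinite_finite_induct) (auto intro: polyfun.intros)

lemma polyfun_poly: "polyfun F \<Longrightarrow> polyfun (\<lambda>s. poly b (F s))"
  by (induction b) (auto intro: polyfun.intros)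

lemma polyfun_ell: "polyfun (\<lambda>s. ell r a s i)"
  unfolding ell_def by (intro polyfun_sum polyfun.intros)

lemma polyfun_shift: "polyfun F \<Longrightarrow> polyfun (\<lambda>s. F (\<lambda>k. s k + e k))"
  by (induction rule: polyfun.induct) (auto intro: polyfun.intros)

lemma polyfun_line:
  assumes "polyfun F"
  shows "\<exists>q. \<forall>t. F (z(k := t)) = poly q t"
  using assms
proof (induction rule: polyfun.induct)
  case (const c)
  show ?case by (rule exI[of _ "[:c:]"]) simp
next
  case (var j)
  show ?case by (rule exI[of _ "if j = k then [:0,1:] else [:z j:]"]) auto
next
  case (add F G)
  then obtain p q where "\<forall>t. F (z(k := t)) = poly p t" "\<forall>t. G (z(k := t)) = poly q t" by blast
  then show ?case by (intro exI[of _ "p + q"]) (simp del: fun_upd_apply)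
next
  case (mult F G)
  then obtain p q where "\<forall>t. F (z(k := t)) = poly p t" "\<forall>t. G (z(k := t)) = poly q t" by blast
  then show ?case by (intro exI[of _ "p * q"]) (simp del: fun_upd_apply)
qed

text \<open>
  Variables are freed from \<open>\<nat>\<close> one at a time, on lines on which the function is a polynomial.
\<close>

lemma polyfun_vanish:
  assumes F: "polyfun F"
    and van: "\<And>n :: nat \<Rightarrow> nat. (\<And>j. j \<ge> r \<Longrightarrow> n j = 0) \<Longrightarrow> F (\<lambda>j. of_nat (n j)) = 0"
    and z: "\<And>j. j \<ge> r \<Longrightarrow> z j = 0"
  shows "F z = 0"
proof -
  have "F z = 0" if "k \<le> r" "\<And>j. j \<ge> r \<Longrightarrow> z j = 0" "\<And>j. j \<ge> k \<Longrightarrow> z j \<in> \<nat>" for k z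
    using that
  proof (induction k arbitrary: z)
    case 0
    then have "\<forall>j. \<exists>n. z j = of_nat n" by (meson Nats_cases le0)
    then obtain n where n: "\<And>j. z j = of_nat (n j)" by metis
    then have "n j = 0" if "j \<ge> r" for j using 0(2)[OF that] by simp
    then have "F (\<lambda>j. of_nat (n j)) = 0" by (rule van)
    moreover have "z = (\<lambda>j. of_nat (n j))" using n by (rule ext)
    ultimately show ?case by simp
  next
    case (Suc k)
    obtain q where q: "\<And>t. F (z(k := t)) = poly q t" using polyfun_line[OF F] by metis
    have "poly q (of_nat n) = 0" for n
      unfolding q[symmetric] using Suc.prems by (intro Suc.IH) (auto simp: Suc_le_eq)
    then have "q = 0" by (rule poly_vanish_of_nat[OF inj_of_nat])
    then show ?case using q[of "z k"] by simp
  qed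
  from this[of r z] z show ?thesis by simp
qed

lemma lookup_single_mult:
  fixes u v :: "'n \<Rightarrow>\<^sub>0 nat"
  shows "lookup (single u c * q) v =
    (if \<forall>i. lookup u i \<le> lookup v i then c * lookup q (v - u) else 0)"
proof -
  have "lookup (single u c * q) v =
    (\<Sum>w\<in>keys q. lookup (single u c * single w (lookup q w)) v)"
    by (subst (1) poly_mapping_sum_single[of q])
      (simp only: sum_distrib_left lookup_sum)
  also have "\<dots> = (\<Sum>w\<in>keys q. if u + w = v then c * lookup q w else 0)"
    by (simp add: mult_single lookup_single when_def)
  also have "\<dots> = (if \<forall>i. lookup u i \<le> lookup v i then c * lookup q (v - u) else 0)"
  proof (cases "\<forall>i. lookup u i \<le> lookup v i")
    case True
    then have "u + (v - u) = v"
      by (intro poly_mapping_eqI) (simp add: lookup_add lookup_minus)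
    then have "(u + w = v) \<longleftrightarrow> (v - u = w)" for w by (metis add_left_cancel)
    then show ?thesis using True by (auto simp: in_keys_iff)
  next
    case False
    then have "u + w \<noteq> v" for w by (auto simp: lookup_add)
    then show ?thesis unfolding if_not_P[OF False] by simp
  qed
  finally show ?thesis .
qed

lemma lookup_xderiv:
  "lookup (xderiv k q) v =
     of_nat (Suc (lookup v k)) * lookup q (v + single k 1)"
proof -
  let ?w = "v + single k 1"
  have eq: "lookup (single (u - single k 1)
        (of_nat (lookup u k) * lookup q u)) v
     = (if u = ?w then of_nat (Suc (lookup v k)) * lookup q ?w else 0)" for u
  proof (cases "u = ?w")
    case True
    have "lookup u k = Suc (lookup v k)" "u - single k 1 = v"
      unfolding True by (simp_all add: lookup_add)
    then show ?thesis by (simp add: True)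
  next
    case False
    have "lookup u k = 0 \<or> u - single k 1 \<noteq> v"
    proof (rule ccontr)
      assume "\<not> ?thesis"
      then have "v + single k 1 = u + single k 1 - single k 1"
        using exponent_diff_add[of u k "single k 1"] by simp
      with False show False by simp
    qed
    then show ?thesis using False by (auto simp: lookup_single)
  qed
  show ?thesis unfolding xderiv_def lookup_sum eq
    by (simp add: in_keys_iff)
qed

text \<open>
  After operators of total degree \<open>m\<close>, the monomial of exponent \<open>y\<close> at the parameter \<open>s\<close> can
  receive a contribution from that of exponent \<open>\<ell>(s + k)\<close> at \<open>s + k\<close>, for some integer
  translation \<open>k\<close>.  Stuck points \<open>s\<close> are those where this fails for \<open>m = 1\<close> and \<open>y = \<ell>(s)\<close>.
\<close>

abbreviation reachable :: "nat \<Rightarrow> (nat \<Rightarrow> 'n \<Rightarrow>\<^sub>0 nat) \<Rightarrow> nat \<Rightarrow> (nat \<Rightarrow> complex) \<Rightarrow> ('n \<Rightarrow> complex) \<Rightarrow> bool" where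
  "reachable r a m s y \<equiv> (\<exists>k :: nat \<Rightarrow> int. (\<Sum>j<r. k j) = int m \<and>
     (\<forall>j<r. s j \<in> \<nat> \<longrightarrow> s j + of_int (k j) \<in> \<nat>) \<and>
     (\<forall>i. y i \<in> negint \<longrightarrow> ell r a s i + of_int (ell r a k i) \<in> negint))"

text \<open>
  The coefficients of a family in \<open>V\<^sup>m\<close>, extended to complex parameters \<open>s\<close> and complex exponents
  \<open>y\<close>.  As monomial ideals are homogeneous for the torus action, the operators only add fixed
  vectors to \<open>y - \<ell>(s)\<close>; hence polynomiality is required for fixed \<open>y - \<ell>(s)\<close>.  The last clause
  is the vanishing that makes stuck points roots.
\<close>

definition continuation ::
  "nat \<Rightarrow> (nat \<Rightarrow> 'n \<Rightarrow>\<^sub>0 nat) \<Rightarrow> nat \<Rightarrow> (nat multiset \<Rightarrow> 'n::{finite,linorder} cpoly)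
    \<Rightarrow> ((nat \<Rightarrow> complex) \<Rightarrow> ('n \<Rightarrow> complex) \<Rightarrow> complex) \<Rightarrow> bool" where
  "continuation r a m H c \<longleftrightarrow>
     (\<forall>M u. set_mset M \<subseteq> {..<r} \<longrightarrow>
        c (cnt M) (\<lambda>i. of_nat (lookup u i)) = lookup (H M) u) \<and>
     (\<forall>d. polyfun (\<lambda>s. c s (\<lambda>i. ell r a s i + d i))) \<and>
     (\<forall>s y. c s y \<noteq> 0 \<longrightarrow> reachable r a m s y)"

lemma continuationD:
  assumes "continuation r a m H c"
  shows "set_mset M \<subseteq> {..<r} \<Longrightarrow>
        c (cnt M) (\<lambda>i. of_nat (lookup u i)) = lookup (H M) u"
    and "polyfun (\<lambda>s. c s (\<lambda>i. ell r a s i + d i))"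
    and "c s y \<noteq> 0 \<Longrightarrow> reachable r a m s y"
  using assms unfolding continuation_def by blast+

text \<open>
  At natural parameters a translated exponent is again natural, so it cannot be negative.
\<close>

lemma continuation_neg:
  assumes c: "continuation r a m H c" and y: "y i \<in> negint"
  shows "c (cnt M) y = 0"
proof (rule ccontr)
  assume "c (cnt M) y \<noteq> 0"
  from continuationD(3)[OF c this] obtain k :: "nat \<Rightarrow> int"
    where k: "\<And>j. j < r \<Longrightarrow> of_nat (count M j) + of_int (k j) \<in> (\<nat> :: complex set)"
      and e: "ell r a (cnt M) i + of_int (ell r a k i) \<in> negint"
    using y by auto
  have "ell r a (\<lambda>j. cnt M j + of_int (k j)) i \<in> (\<nat> :: complex set)"
    by (rule ell_Nats) (rule k)
  then show False using negint_not_Nats[OF e] by (simp add: ell_add ell_of_int)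
qed

lemma lookup_of_nat_mult:
  fixes q :: "'n::{finite,linorder} cpoly"
  shows "lookup (of_nat n * q) v = of_nat n * lookup q v"
  by (induction n) (auto simp: distrib_right lookup_add)

text \<open>
  Each operator is continued by the evident formula: \<open>x\<^sup>u\<close> translates \<open>y\<close>, \<open>\<partial>\<^sub>k\<close> multiplies by
  \<open>y\<^sub>k + 1\<close>, a shift translates \<open>s\<close>, and \<open>tau\<close> multiplies by \<open>s\<^sub>j\<close>.  The two factors vanish exactly
  where reachability could otherwise fail: \<open>y\<^sub>k + 1 = 0\<close> when \<open>\<partial>\<^sub>k\<close> leads from exponent \<open>0\<close> to
  \<open>-1\<close>, and \<open>s\<^sub>j = 0\<close> when \<open>tau\<close> would leave \<open>\<nat>\<close>.
\<close>

lemma continuation_exists: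
  assumes "Vfilt r (monomial_gens r a) m H"
  shows "\<exists>c. continuation r a m H c"
  using assms
proof (induction rule: Vfilt.induct)
  case base
  let ?c = "\<lambda>(s :: nat \<Rightarrow> complex) y. if y = ell r a s then 1 else 0 :: complex"
  have 1: "?c (cnt M) (\<lambda>i. of_nat (lookup u i)) = lookup (gen_prod (monomial_gens r a) M) u"
    if "set_mset M \<subseteq> {..<r}" for M u
  proof -
    have "((\<lambda>i. of_nat (lookup u i)) = (ell r a (cnt M) :: 'a \<Rightarrow> complex)) \<longleftrightarrow> u = exponent_sum a M"
      unfolding fun_eq_iff lookup_exponent_sum[OF that, symmetric] of_nat_eq_iff by (auto intro: poly_mapping_eqI)
    then show ?thesis using that by (auto simp: gen_prod_monomial_gens xmonom_def lookup_single)
  qed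
  have "?c s (\<lambda>i. ell r a s i + d i) = (if d = (\<lambda>i. 0) then 1 else 0)" for s d
    by (auto simp: fun_eq_iff)
  then have 2: "polyfun (\<lambda>s. ?c s (\<lambda>i. ell r a s i + d i))" for d
    by (simp only: polyfun.const)
  have 3: "reachable r a 0 s y"
    if "?c s y \<noteq> 0" for s y
    using that by (intro exI[of _ "\<lambda>_. 0"]) (auto simp: ell_def split: if_splits)
  show ?case
    unfolding continuation_def by (rule exI[of _ ?c]) (use 1 2 3 in blast)
next
  case (add m H H')
  then obtain c c' where c: "continuation r a m H c" and c': "continuation r a m H' c'" by blast
  have "continuation r a m (\<lambda>M. H M + H' M) (\<lambda>s y. c s y + c' s y)"
    unfolding continuation_def
  proof (intro conjI allI impI)
    fix s y assume "c s y + c' s y \<noteq> 0"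
    then have "c s y \<noteq> 0 \<or> c' s y \<noteq> 0" by auto
    then show "reachable r a m s y"
      using continuationD(3)[OF c] continuationD(3)[OF c'] by blast
  qed (auto intro!: polyfun.add simp: lookup_add continuationD(1,2)[OF c] continuationD(1,2)[OF c'])
  then show ?case by blast
next
  case (mono m H u b)
  then obtain c where c: "continuation r a m H c" by blast
  let ?sub = "\<lambda>(y :: 'a \<Rightarrow> complex) i. y i - of_nat (lookup u i)"
  let ?c = "\<lambda>s y. b * c s (?sub y)"
  have "continuation r a m (\<lambda>M. single u b * H M) ?c"
    unfolding continuation_def
  proof (intro conjI allI impI)
    fix M v assume M: "set_mset M \<subseteq> {..<r}"
    show "?c (cnt M) (\<lambda>i. of_nat (lookup v i)) =
        lookup (single u b * H M) v"
    proof (cases "\<forall>i. lookup u i \<le> lookup v i")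
      case True
      then have "?sub (\<lambda>i. of_nat (lookup v i)) = (\<lambda>i. of_nat (lookup (v - u) i))"
        by (auto simp: lookup_minus of_nat_diff)
      then show ?thesis using True by (simp add: continuationD(1)[OF c M] lookup_single_mult)
    next
      case False
      then obtain i where "lookup v i < lookup u i" by (meson not_le)
      then obtain k where k: "lookup u i = lookup v i + Suc k"
        using less_iff_Suc_add by auto
      have "?sub (\<lambda>i. of_nat (lookup v i)) i \<in> negint"
        unfolding negint_def k by (auto simp: algebra_simps)
      from continuation_neg[OF c, where y = "?sub (\<lambda>i. of_nat (lookup v i))", OF this]
      show ?thesis unfolding lookup_single_mult if_not_P[OF False] by simp
    qed
  next
    fix d
    have "(\<lambda>s. ?c s (\<lambda>i. ell r a s i + d i)) =
        (\<lambda>s. b * c s (\<lambda>i. ell r a s i + (d i - of_nat (lookup u i))))"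
      by (simp add: add_diff_eq)
    then show "polyfun (\<lambda>s. ?c s (\<lambda>i. ell r a s i + d i))"
      by (simp only:) (intro polyfun.mult polyfun.const continuationD(2)[OF c])
  next
    fix s y assume "?c s y \<noteq> 0"
    then have "c s (?sub y) \<noteq> 0" by simp
    from continuationD(3)[OF c this] show "reachable r a m s y"
      using negint_diff_nat by blast
  qed
  then show ?case by blast
next
  case (deriv m H k)
  then obtain c where c: "continuation r a m H c" by blast
  let ?up = "\<lambda>y :: 'a \<Rightarrow> complex. y(k := y k + 1)"
  let ?c = "\<lambda>s y. (y k + 1) * c s (?up y)"
  have "continuation r a m (\<lambda>M. xderiv k (H M)) ?c"
    unfolding continuation_def
  proof (intro conjI allI impI)
    fix M v assume M: "set_mset M \<subseteq> {..<r}"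
    have "?up (\<lambda>i. of_nat (lookup v i)) =
        (\<lambda>i. of_nat (lookup (v + single k 1) i))"
      by (auto simp: lookup_add lookup_single when_def)
    then show "?c (cnt M) (\<lambda>i. of_nat (lookup v i)) = lookup (xderiv k (H M)) v"
      by (simp only: continuationD(1)[OF c M] lookup_xderiv) (simp add: add.commute)
  next
    fix d :: "'a \<Rightarrow> complex"
    have "(\<lambda>s. ?c s (\<lambda>i. ell r a s i + d i)) =
        (\<lambda>s. (ell r a s k + (d k + 1)) * c s (\<lambda>i. ell r a s i + (d(k := d k + 1)) i))"
      by (auto simp: fun_eq_iff add.assoc intro!: arg_cong[where f = "c _"])
    then show "polyfun (\<lambda>s. ?c s (\<lambda>i. ell r a s i + d i))"
      by (simp only:) (intro polyfun.mult polyfun.add polyfun.const polyfun_ell continuationD(2)[OF c])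
  next
    fix s y assume nz: "?c s y \<noteq> 0"
    then have "c s (?up y) \<noteq> 0" by simp
    from continuationD(3)[OF c this] obtain k' :: "nat \<Rightarrow> int" where
      k': "(\<Sum>j<r. k' j) = int m" "\<forall>j<r. s j \<in> \<nat> \<longrightarrow> s j + of_int (k' j) \<in> \<nat>"
        "\<forall>i. ?up y i \<in> negint \<longrightarrow> ell r a s i + of_int (ell r a k' i) \<in> negint" by blast
    have "?up y i \<in> negint" if "y i \<in> negint" for i
      using that nz negint_plus_one[of "y k"] by auto
    with k' show "reachable r a m s y"
      by blast
  qed
  then show ?case by blast
next
  case (shift j m H)
  then obtain c where c: "continuation r a m H c" by blast
  let ?e = "\<lambda>k. if k = j then 1 else 0"
  let ?c = "\<lambda>s y. c (\<lambda>k. s k + ?e k) y"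
  have "continuation r a (Suc m) (tshift {#j#} H) ?c"
    unfolding continuation_def
  proof (intro conjI allI impI)
    fix M v assume M: "set_mset M \<subseteq> {..<r}"
    have "(\<lambda>k. cnt M k + ?e k) = (cnt (add_mset j M) :: nat \<Rightarrow> complex)" by auto
    then show "?c (cnt M) (\<lambda>i. of_nat (lookup v i)) = lookup (tshift {#j#} H M) v"
      using continuationD(1)[OF c, of "add_mset j M"] M shift.hyps by (simp add: tshift_single)
  next
    fix d :: "'a \<Rightarrow> complex"
    have "(\<lambda>s. ?c s (\<lambda>i. ell r a s i + d i)) =
        (\<lambda>s. c (\<lambda>k. s k + ?e k) (\<lambda>i. ell r a (\<lambda>k. s k + ?e k) i + (d i - of_nat (lookup (a j) i))))"
      by (simp add: ell_add ell_delta[OF shift.hyps(1)])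
    then show "polyfun (\<lambda>s. ?c s (\<lambda>i. ell r a s i + d i))"
      using polyfun_shift[OF continuationD(2)[OF c, where d = "\<lambda>i. d i - of_nat (lookup (a j) i)"], where e = ?e]
      by (simp only:)
  next
    fix s y assume "?c s y \<noteq> 0"
    from continuationD(3)[OF c this] obtain k :: "nat \<Rightarrow> int" where
      k: "(\<Sum>j<r. k j) = int m" "\<forall>l<r. s l + ?e l \<in> \<nat> \<longrightarrow> s l + ?e l + of_int (k l) \<in> \<nat>"
        "\<forall>i. y i \<in> negint \<longrightarrow> ell r a (\<lambda>k. s k + ?e k) i + of_int (ell r a k i) \<in> negint" by blast
    let ?k = "\<lambda>l. k l + ?e l"
    have "s l + of_int (?k l) \<in> \<nat>" if "l < r" "s l \<in> \<nat>" for l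
      using k(2)[rule_format, OF that(1)] that(2) by (auto simp: algebra_simps)
    moreover have "(\<Sum>j<r. ?k j) = int (Suc m)"
      using k(1) shift.hyps by (simp add: sum.distrib)
    moreover have "ell r a s i + of_int (ell r a ?k i) \<in> negint" if "y i \<in> negint" for i
      using k(3)[rule_format, OF that] by (simp add: ell_add ell_delta[OF shift.hyps(1)] algebra_simps)
    ultimately show "reachable r a (Suc m) s y"
      by (intro exI[of _ ?k]) blast
  qed
  then show ?case by blast
next
  case (tau j m H)
  then obtain c where c: "continuation r a (Suc m) H c" by blast
  let ?e = "\<lambda>k. if k = j then - 1 else 0"
  let ?c = "\<lambda>s y. s j * c (\<lambda>k. s k + ?e k) y"
  have "continuation r a m (tau j H) ?c"
    unfolding continuation_def
  proof (intro conjI allI impI)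
    fix M v assume M: "set_mset M \<subseteq> {..<r}"
    show "?c (cnt M) (\<lambda>i. of_nat (lookup v i)) = lookup (tau j H M) v"
    proof (cases "j \<in># M")
      case True
      then have "(\<lambda>k. cnt M k + ?e k) = (cnt (M - {#j#}) :: nat \<Rightarrow> complex)"
        by (auto simp: fun_eq_iff of_nat_diff Suc_le_eq)
      moreover have "set_mset (M - {#j#}) \<subseteq> {..<r}" using M by (meson in_diffD subset_iff)
      ultimately show ?thesis
        using continuationD(1)[OF c, of "M - {#j#}"]
        by (simp add: tau_def lookup_of_nat_mult)
    qed (simp add: tau_def not_in_iff)
  next
    fix d :: "'a \<Rightarrow> complex"
    have "(\<lambda>s. ?c s (\<lambda>i. ell r a s i + d i)) =
        (\<lambda>s. s j * c (\<lambda>k. s k + ?e k) (\<lambda>i. ell r a (\<lambda>k. s k + ?e k) i + (d i + of_nat (lookup (a j) i))))"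
      by (simp add: ell_add ell_delta[OF tau.hyps(1)])
    then show "polyfun (\<lambda>s. ?c s (\<lambda>i. ell r a s i + d i))"
      using polyfun.mult[OF polyfun.var[of j] polyfun_shift[OF continuationD(2)[OF c, where d = "\<lambda>i. d i + of_nat (lookup (a j) i)"], where e = ?e]]
      by (simp only:)
  next
    fix s y assume nz: "?c s y \<noteq> 0"
    then have "c (\<lambda>k. s k + ?e k) y \<noteq> 0" by simp
    from continuationD(3)[OF c this] obtain k :: "nat \<Rightarrow> int" where
      k: "(\<Sum>j<r. k j) = int (Suc m)" "\<forall>l<r. s l + ?e l \<in> \<nat> \<longrightarrow> s l + ?e l + of_int (k l) \<in> \<nat>"
        "\<forall>i. y i \<in> negint \<longrightarrow> ell r a (\<lambda>k. s k + ?e k) i + of_int (ell r a k i) \<in> negint" by blast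
    let ?k = "\<lambda>l. k l + ?e l"
    have "s l + of_int (?k l) \<in> \<nat>" if "l < r" "s l \<in> \<nat>" for l
      using k(2)[rule_format, OF that(1)] that(2) nz nat_minus_one[of "s l"] by (auto simp: algebra_simps split: if_splits)
    moreover have "(\<Sum>j<r. ?k j) = int m"
      using k(1) tau.hyps by (simp add: sum.distrib)
    moreover have "ell r a s i + of_int (ell r a ?k i) \<in> negint" if "y i \<in> negint" for i
      using k(3)[rule_format, OF that] by (simp add: ell_add ell_delta[OF tau.hyps(1)] algebra_simps)
    ultimately show "reachable r a m s y"
      by (intro exI[of _ ?k]) blast
  qed
  then show ?case by blast
qed

text \<open>
  The continuation of \<open>b(|M|) \<cdot> gen_prod M\<close> at \<open>y = \<ell>(s)\<close> agrees with \<open>b(\<Sum>\<^sub>j s\<^sub>j)\<close> on \<open>\<nat>\<^sup>r\<close>, hence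
  everywhere, and it vanishes at stuck points.
\<close>

lemma model_relation_root:
  assumes rel: "model_relation r (monomial_gens r a) b" and st: "stuck r a z"
  shows "poly b (\<Sum>j<r. z j) = 0"
proof -
  \<comment> \<open>Vanishing on \<open>\<nat>\<^sup>r\<close> controls only the points whose coordinates beyond \<open>r\<close> are zero.\<close>
  define z' where "z' = (\<lambda>j. if j < r then z j else 0)"
  have ell': "ell r a z' = ell r a z" by (auto simp: ell_def z'_def)
  obtain c where c: "continuation r a 1 (\<lambda>M. single 0 (poly b (of_nat (size M))) * gen_prod (monomial_gens r a) M) c"
    using continuation_exists rel unfolding model_relation_def by blast
  let ?F = "\<lambda>s. c s (\<lambda>i. ell r a s i + 0) - poly b (\<Sum>j<r. s j)"
  have pf: "polyfun ?F"
    by (intro polyfun_diff polyfun_poly polyfun_sum polyfun.var continuationD(2)[OF c])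
  have "?F z' = 0"
  proof (rule polyfun_vanish[OF pf])
    fix n :: "nat \<Rightarrow> nat" assume n: "\<And>j. j \<ge> r \<Longrightarrow> n j = 0"
    define M where "M = (\<Sum>j<r. replicate_mset (n j) j)"
    have cM: "count M j = n j" for j
      using n[of j] by (auto simp: M_def count_sum)
    then have "j < r" if "j \<in># M" for j using that n[of j] by (metis count_greater_zero_iff not_less less_irrefl)
    then have M: "set_mset M \<subseteq> {..<r}" by auto
    have "(\<lambda>i. ell r a (cnt M) i + 0) = (\<lambda>i. complex_of_nat (lookup (exponent_sum a M) i))"
      by (simp add: lookup_exponent_sum[OF M])
    then show "?F (\<lambda>j. of_nat (n j)) = 0"
      using continuationD(1)[OF c M, of "exponent_sum a M"] M size_conv_sum[OF M, where 'b = complex]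
      by (simp add: cM gen_prod_monomial_gens xmonom_def mult_single)
  qed (simp add: z'_def)
  moreover have "c z' (\<lambda>i. ell r a z' i + 0) = 0"
  proof (rule ccontr)
    assume "c z' (\<lambda>i. ell r a z' i + 0) \<noteq> 0"
    from continuationD(3)[OF c this] st show False
      unfolding stuck_def ell' by (auto simp: z'_def)
  qed
  moreover have "(\<Sum>j<r. z' j) = (\<Sum>j<r. z j)" by (simp add: z'_def)
  ultimately show ?thesis by simp
qed

section \<open>Monomial generators: a relation whose roots come from stuck points\<close>

lemma is_ideal_iff:
  "module.subspace (*) J \<longleftrightarrow> (0 :: 'a::comm_ring_1) \<in> J \<and> (\<forall>x\<in>J. \<forall>y\<in>J. x + y \<in> J) \<and> (\<forall>c. \<forall>x\<in>J. c * x \<in> J)"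
  by (rule module.subspace_def[OF module_mult])

text \<open>
  Krull's lemma: an ideal that is maximal among those disjoint from a multiplicative set is prime.
\<close>

lemma prime_ideal_avoiding:
  fixes J S :: "'a::comm_ring_1 set"
  assumes J: "module.subspace (*) J" and S1: "1 \<in> S"
    and Sm: "\<And>x y. x \<in> S \<Longrightarrow> y \<in> S \<Longrightarrow> x * y \<in> S" and disj: "J \<inter> S = {}"
  obtains P where "module.subspace (*) P" "J \<subseteq> P" "P \<inter> S = {}"
    "\<And>x y. x * y \<in> P \<Longrightarrow> x \<in> P \<or> y \<in> P"
proof -
  let ?A = "{K. module.subspace (*) K \<and> J \<subseteq> K \<and> K \<inter> S = {}}"
  have "\<exists>M\<in>?A. \<forall>X\<in>?A. M \<subseteq> X \<longrightarrow> X = M"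
  proof (rule subset_Zorn_nonempty)
    show "?A \<noteq> {}" using J disj by blast
  next
    fix C assume ne: "C \<noteq> {}" and ch: "subset.chain ?A C"
    then have sub: "\<And>K. K \<in> C \<Longrightarrow> K \<in> ?A" and lin: "\<And>K L. K \<in> C \<Longrightarrow> L \<in> C \<Longrightarrow> K \<subseteq> L \<or> L \<subseteq> K"
      unfolding subset.chain_def by blast+
    have "x + y \<in> \<Union>C" if "x \<in> \<Union>C" "y \<in> \<Union>C" for x y
    proof -
      from that obtain K L where "x \<in> K" "K \<in> C" "y \<in> L" "L \<in> C" by blast
      then obtain N where "N \<in> C" "x \<in> N" "y \<in> N" using lin by blast
      then show ?thesis using sub[of N] unfolding is_ideal_iff by blast
    qed
    moreover have "c * x \<in> \<Union>C" if "x \<in> \<Union>C" for c x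
      using that sub unfolding is_ideal_iff by blast
    moreover have "0 \<in> \<Union>C" using ne sub unfolding is_ideal_iff by blast
    ultimately have "module.subspace (*) (\<Union>C)" unfolding is_ideal_iff by blast
    then show "\<Union>C \<in> ?A" using ne sub by blast
  qed
  then obtain P where PA: "P \<in> ?A" and mx: "\<forall>X\<in>?A. P \<subseteq> X \<longrightarrow> X = P" by (rule bexE)
  then have P: "module.subspace (*) P" "J \<subseteq> P" "P \<inter> S = {}" by simp_all
  have max: "X = P" if "module.subspace (*) X" "J \<subseteq> X" "X \<inter> S = {}" "P \<subseteq> X" for X
    using mx that by simp
  have P0: "0 \<in> P" and Pa: "\<And>x y. x \<in> P \<Longrightarrow> y \<in> P \<Longrightarrow> x + y \<in> P" and Pm: "\<And>c x. x \<in> P \<Longrightarrow> c * x \<in> P"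
    using P(1)[unfolded is_ideal_iff] by simp_all
  have meets: "\<exists>p\<in>P. \<exists>c. p + c * a \<in> S" if "a \<notin> P" for a
  proof (rule ccontr)
    assume no: "\<not> ?thesis"
    let ?X = "{p + c * a | p c. p \<in> P}"
    have "module.subspace (*) ?X"
      unfolding is_ideal_iff
    proof (intro conjI ballI allI)
      have "0 = 0 + 0 * a" by simp
      with P0 show "0 \<in> ?X" by blast
    next
      fix x y assume "x \<in> ?X" "y \<in> ?X"
      then obtain p c q d where pq: "p \<in> P" "q \<in> P" and xy: "x = p + c * a" "y = q + d * a" by blast
      have "x + y = (p + q) + (c + d) * a" by (simp add: xy algebra_simps)
      with Pa[OF pq] show "x + y \<in> ?X" by blast
    next
      fix b x assume "x \<in> ?X"
      then obtain p c where p: "p \<in> P" and x: "x = p + c * a" by blast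
      have "b * x = b * p + (b * c) * a" by (simp add: x algebra_simps)
      with Pm[OF p] show "b * x \<in> ?X" by blast
    qed
    moreover have "P \<subseteq> ?X"
    proof
      fix p assume p: "p \<in> P"
      have "p = p + 0 * a" by simp
      with p show "p \<in> ?X" by blast
    qed
    moreover have "a \<in> ?X"
    proof -
      have "a = 0 + 1 * a" by simp
      with P0 show ?thesis by blast
    qed
    moreover have "?X \<inter> S = {}" using no by blast
    ultimately have "?X = P" using max[of ?X] P(2) by blast
    with \<open>a \<in> ?X\<close> that show False by blast
  qed
  have "x \<in> P \<or> y \<in> P" if "x * y \<in> P" for x y
  proof (rule ccontr)
    assume "\<not> ?thesis"
    then obtain p c q d where pq: "p \<in> P" "q \<in> P" and s: "p + c * x \<in> S" "q + d * y \<in> S"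
      using meets by blast
    have "(p + c * x) * (q + d * y) = (q + d * y) * p + ((c * x) * q + (c * d) * (x * y))"
      by (simp add: algebra_simps)
    also have "\<dots> \<in> P" by (intro Pa Pm[OF pq(1)] Pm[OF pq(2)] Pm[OF that])
    finally show False using Sm[OF s] P(3) by blast
  qed
  with that P show ?thesis by blast
qed

lemma prod_mem_prime:
  assumes "finite A" "\<And>x y. x * y \<in> P \<Longrightarrow> x \<in> P \<or> y \<in> P" "1 \<notin> P" "prod f A \<in> P"
  shows "\<exists>a\<in>A. f a \<in> P"
  using assms(1,4)
proof (induction A rule: finite_induct)
  case empty
  then show ?case using assms(3) by simp
next
  case (insert x F)
  then show ?case using assms(2)[of "f x" "prod f F"] by auto
qed

text \<open>
  The freedom to prescribe the value at \<open>w\<close>, when \<open>w\<close> is independent of \<open>u\<close> modulo \<open>P\<close>, is used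
  below to produce a nonreal value.
\<close>

lemma separating_functional:
  fixes scale :: "complex \<Rightarrow> 'b::ab_group_add \<Rightarrow> 'b"
  assumes vs: "vector_space scale" and P: "module.subspace scale P" and u: "u \<notin> P"
  obtains \<phi> where "\<And>x y. \<phi> (x + y) = \<phi> x + \<phi> y" "\<And>c x. \<phi> (scale c x) = c * \<phi> x"
    "\<And>x. x \<in> P \<Longrightarrow> \<phi> x = 0" "\<phi> u = 1" "w \<notin> module.span scale (insert u P) \<Longrightarrow> \<phi> w = t"
proof -
  have vc: "vector_space ((*) :: complex \<Rightarrow> _)" by (unfold_locales; simp add: algebra_simps)
  interpret vector_space_pair scale "(*) :: complex \<Rightarrow> complex \<Rightarrow> complex"
    using vs vc by (simp add: vector_space_pair_def)
  obtain B where B: "B \<subseteq> P" "vs1.independent B" "P \<subseteq> vs1.span B"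
    using vs1.maximal_independent_subset[of P] by metis
  have "vs1.span B \<subseteq> P" using B(1) P by (rule vs1.span_minimal)
  with u have "u \<notin> vs1.span B" by blast
  then have iu: "vs1.independent (insert u B)" using B(2) by (simp add: vs1.independent_insert)
  have sub: "vs1.span (insert u B) \<subseteq> vs1.span (insert u P)" using B(1) by (intro vs1.span_mono) auto
  define C where "C = (if w \<in> vs1.span (insert u P) then insert u B else insert w (insert u B))"
  have "vs1.independent C"
    using iu sub unfolding C_def by (auto simp: vs1.independent_insert vs1.span_base)
  define f where "f = (\<lambda>x. if x = u then 1 else if x = w \<and> w \<notin> vs1.span (insert u P) then t else 0)"
  from \<open>vs1.independent C\<close> obtain \<phi> where lin: "Vector_Spaces.linear scale (*) \<phi>" and \<phi>: "\<forall>x\<in>C. \<phi> x = f x"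
    using linear_independent_extend[of C f] by blast
  interpret l: Vector_Spaces.linear scale "(*)" \<phi> by (rule lin)
  have B0: "\<phi> x = 0" if "x \<in> B" for x
  proof -
    have "x \<noteq> u" using that B(1) u by blast
    moreover have "x \<noteq> w \<or> w \<in> vs1.span (insert u P)" using that B(1) by (auto intro: vs1.span_base)
    moreover have "x \<in> C" using that by (simp add: C_def)
    ultimately show ?thesis using \<phi> by (auto simp: f_def)
  qed
  show ?thesis
  proof (rule that)
    show "\<phi> (x + y) = \<phi> x + \<phi> y" "\<phi> (scale c x) = c * \<phi> x" for x y c
      by (rule l.add) (rule l.scale)
    show "\<phi> x = 0" if "x \<in> P" for x
      using l.eq_0_on_span[of B x] B0 B(3) that by blast
    show "\<phi> u = 1" using \<phi> by (auto simp: C_def f_def)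
    show "\<phi> w = t" if "w \<notin> vs1.span (insert u P)"
    proof -
      have "w \<noteq> u" using that by (auto intro: vs1.span_base)
      then show ?thesis using \<phi> that by (auto simp: C_def f_def)
    qed
  qed
qed

abbreviation pvar :: "nat \<Rightarrow> (nat \<Rightarrow>\<^sub>0 nat) \<Rightarrow>\<^sub>0 complex" where
  "pvar j \<equiv> single (single j 1) 1"

abbreviation pconst :: "complex \<Rightarrow> (nat \<Rightarrow>\<^sub>0 nat) \<Rightarrow>\<^sub>0 complex" where
  "pconst c \<equiv> single 0 c"

lemma poly_mapping_generated:
  fixes Q :: "((nat \<Rightarrow>\<^sub>0 nat) \<Rightarrow>\<^sub>0 'a::comm_ring_1) \<Rightarrow> bool"
  assumes add: "\<And>p q. Q p \<Longrightarrow> Q q \<Longrightarrow> Q (p + q)" and mult: "\<And>p q. Q p \<Longrightarrow> Q q \<Longrightarrow> Q (p * q)"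
    and const: "\<And>c. Q (single 0 c)" and var: "\<And>j. Q (single (single j 1) 1)"
  shows "Q p"
proof -
  have Q1: "Q 1" using const[of 1] by simp
  have pow: "Q (single (single j n) 1)" for j n
  proof (induction n)
    case (Suc n)
    have "single (single j (Suc n)) (1::'a) =
        single (single j 1) 1 * single (single j n) 1"
      by (simp add: mult_single single_add[symmetric])
    then show ?case using mult[OF var Suc.IH, of j] by simp
  qed (simp add: Q1)
  have mon: "Q (single (\<Sum>j\<in>A. single j (n j)) 1)" if "finite A" for A n
    using that
  proof (induction A rule: finite_induct)
    case (insert j A)
    have "single (\<Sum>j\<in>insert j A. single j (n j)) (1::'a) =
        single (single j (n j)) 1 * single (\<Sum>j\<in>A. single j (n j)) 1"
      using insert by (simp add: mult_single)
    then show ?case using mult[OF pow insert.IH] by simp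
  qed (simp add: Q1)
  have single: "Q (single v c)" for v c
  proof -
    have "single v c = single 0 c * single v 1"
      by (simp add: mult_single)
    then show ?thesis
      using mult[OF const[of c] mon[of "keys v" "lookup v"]]
      by (simp add: poly_mapping_sum_single[symmetric])
  qed
  have "Q (\<Sum>v\<in>A. single v (lookup p v))" if "finite A" for A
    using that by (induction A rule: finite_induct) (use const[of 0] in \<open>auto intro: add single\<close>)
  from this[of "keys p"] show ?thesis by (simp add: poly_mapping_sum_single[symmetric])
qed

lemma of_nat_mult_single:
  fixes q :: "'n::{finite,linorder} cpoly"
  shows "of_nat n * (single 0 c * q) = single 0 (of_nat n * c) * q"
  by (simp only: single_of_nat[symmetric] mult.assoc[symmetric] mult_single add_0_left)

text \<open>
  The polynomials \<open>p\<close> in \<open>s\<^sub>1, \<dots>, s\<^sub>r\<close> for which \<open>p(s) \<Prod>\<^sub>j (x\<^bsup>a\<^sub>j\<^esup>)\<^bsup>s\<^sub>j\<^esup>\<close> lies in \<open>V\<^sup>1\<close>.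
\<close>

definition bs_ideal :: "nat \<Rightarrow> (nat \<Rightarrow> 'n::{finite,linorder} \<Rightarrow>\<^sub>0 nat) \<Rightarrow> ((nat \<Rightarrow>\<^sub>0 nat) \<Rightarrow>\<^sub>0 complex) set" where
  "bs_ideal r a =
     {p. Vfilt r (monomial_gens r a) 1 (\<lambda>M. single 0 (peval (cnt M) p) * gen_prod (monomial_gens r a) M)}"

lemma bs_ideal_ideal:
  assumes "0 < r"
  shows "module.subspace (*) (bs_ideal r a)"
proof -
  let ?g = "monomial_gens r a"
  let ?H = "\<lambda>p M. single 0 (peval (cnt M) p) * gen_prod ?g M"
  have z: "Vfilt r ?g 1 (\<lambda>M. 0)"
    using Vfilt_zero[OF Vfilt.shift[OF assms Vfilt.base]] by simp
  have "c * p \<in> bs_ideal r a" if "p \<in> bs_ideal r a" for c p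
  proof -
    have "\<forall>p\<in>bs_ideal r a. c * p \<in> bs_ideal r a"
    proof (rule poly_mapping_generated[of "\<lambda>c. \<forall>p\<in>bs_ideal r a. c * p \<in> bs_ideal r a"])
      fix p q assume "\<forall>x\<in>bs_ideal r a. p * x \<in> bs_ideal r a" "\<forall>x\<in>bs_ideal r a. q * x \<in> bs_ideal r a"
      then show "\<forall>x\<in>bs_ideal r a. (p + q) * x \<in> bs_ideal r a" "\<forall>x\<in>bs_ideal r a. (p * q) * x \<in> bs_ideal r a"
        by (auto simp: mult.assoc) (auto simp: bs_ideal_def distrib_right single_add intro: Vfilt.add)
    next
      fix c
      have "?H (pconst c * p) = (\<lambda>M. single 0 c * ?H p M)" for p
        by (simp add: mult_single flip: mult.assoc)
      then show "\<forall>x\<in>bs_ideal r a. pconst c * x \<in> bs_ideal r a"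
        unfolding bs_ideal_def by (auto intro: Vfilt.mono)
    next
      fix j
      show "\<forall>x\<in>bs_ideal r a. pvar j * x \<in> bs_ideal r a"
      proof
        fix p assume p: "p \<in> bs_ideal r a"
        show "pvar j * p \<in> bs_ideal r a"
        proof (cases "j < r")
          case True
          have eq: "?H (pvar j * p) M = of_nat (count M j) * ?H p M" for M
            by (simp add: of_nat_mult_single)
          have "?H (pvar j * p) = tau j (tshift {#j#} (?H p))"
          proof
            fix M show "?H (pvar j * p) M = tau j (tshift {#j#} (?H p)) M"
              unfolding eq by (cases "j \<in># M") (auto simp: tau_def tshift_single not_in_iff)
          qed
          moreover have "Vfilt r ?g 1 (tau j (tshift {#j#} (?H p)))"
            using p True by (intro Vfilt.tau Vfilt.shift) (auto simp: bs_ideal_def)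
          ultimately show ?thesis by (simp add: bs_ideal_def)
        next
          case False
          have "?H (pvar j * p) M = 0" for M
          proof (cases "j \<in># M")
            case True
            then show ?thesis using False by (auto simp: gen_prod_monomial_gens)
          qed (simp add: not_in_iff)
          then have "?H (pvar j * p) = (\<lambda>M. 0)" by blast
          then show ?thesis using z by (simp add: bs_ideal_def)
        qed
      qed
    qed
    then show ?thesis using that by blast
  qed
  moreover have "p + q \<in> bs_ideal r a" if "p \<in> bs_ideal r a" "q \<in> bs_ideal r a" for p q
    using that by (auto simp: bs_ideal_def distrib_right single_add intro: Vfilt.add)
  moreover have "0 \<in> bs_ideal r a" using z by (simp add: bs_ideal_def)
  ultimately show ?thesis unfolding is_ideal_iff by blast
qed

lemma Vfilt_tshift_multi:
  assumes "set_mset B \<subseteq> {..<r}" "Vfilt r f m H"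
  shows "Vfilt r f (m + size B) (tshift B H)"
  using assms(1)
proof (induction B)
  case empty
  then show ?case using assms(2) by (simp add: tshift_eq)
next
  case (add j B)
  then have "Vfilt r f (Suc (m + size B)) (tshift {#j#} (tshift B H))" by (intro Vfilt.shift) auto
  then show ?case by (simp add: tshift_tshift)
qed

text \<open>
  The product of the falling factorials \<open>s\<^sub>j (s\<^sub>j - 1) \<cdots> (s\<^sub>j - A\<^sub>j + 1)\<close> at \<open>s = M\<close>, which is the
  factor contributed by \<open>\<Prod>\<^sub>j (s\<^sub>j t\<^sub>j\<^sup>-\<^sup>1)\<^bsup>A\<^sub>j\<^esup>\<close>.
\<close>

definition falling :: "nat \<Rightarrow> nat multiset \<Rightarrow> nat multiset \<Rightarrow> complex" where
  "falling r M A = (\<Prod>j<r. \<Prod>k<count A j. of_nat (count M j) - of_nat k)"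

lemma falling_add_mset:
  assumes "j < r"
  shows "falling r M (add_mset j A) = of_nat (count M j) * falling r (M - {#j#}) A"
proof -
  let ?F = "\<lambda>M A l. \<Prod>k<count A l. of_nat (count M l) - of_nat k :: complex"
  have 1: "?F M (add_mset j A) j = of_nat (count M j) * ?F (M - {#j#}) A j"
  proof (cases "count M j")
    case (Suc c)
    show ?thesis
      by (simp add: Suc prod.lessThan_Suc_shift del: prod.lessThan_Suc)
  qed (simp add: prod.lessThan_Suc_shift del: prod.lessThan_Suc)
  have 2: "prod (?F M (add_mset j A)) ({..<r} - {j}) = prod (?F (M - {#j#}) A) ({..<r} - {j})"
    by (rule prod.cong) auto
  show ?thesis unfolding falling_def
    using assms by (subst (1 2) prod.remove[of "{..<r}" j]) (simp_all only: 1 2 mult.assoc, auto)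
qed

lemma Vfilt_tau_multi:
  assumes "set_mset A \<subseteq> {..<r}" "Vfilt r f (m + size A) H"
  shows "Vfilt r f m (\<lambda>M. single 0 (falling r M A) * H (M - A))"
  using assms
proof (induction A arbitrary: m)
  case empty
  then show ?case by (simp add: falling_def)
next
  case (add j A)
  from add.prems have "Vfilt r f (Suc m) (\<lambda>M. single 0 (falling r M A) * H (M - A))"
    by (intro add.IH) auto
  then have "Vfilt r f m (tau j (\<lambda>M. single 0 (falling r M A) * H (M - A)))"
    using add.prems by (intro Vfilt.tau) auto
  also have "tau j (\<lambda>M. single 0 (falling r M A) * H (M - A)) =
      (\<lambda>M. single 0 (falling r M (add_mset j A)) * H (M - add_mset j A))"
  proof
    fix M
    have "M - {#j#} - A = M - add_mset j A" by (simp add: diff_diff_add_mset)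
    then show "tau j (\<lambda>M. single 0 (falling r M A) * H (M - A)) M =
        single 0 (falling r M (add_mset j A)) * H (M - add_mset j A)"
      using add.prems by (simp add: tau_def falling_add_mset of_nat_mult_single)
  qed
  finally show ?case .
qed

lemma Vfilt_deriv_power:
  assumes "Vfilt r f m (\<lambda>M. single (e M + single i n) (P M))"
  shows "Vfilt r f m (\<lambda>M. single (e M)
           (P M * (\<Prod>k<n. of_nat (lookup (e M) i) + of_nat (Suc k))))"
  using assms
proof (induction n arbitrary: P)
  case (Suc n)
  have eq: "e M + single i (Suc n) - single i 1 = e M + single i n" for M
    by (rule poly_mapping_eqI)
      (simp add: lookup_add lookup_minus lookup_single when_def)
  have "Vfilt r f m (\<lambda>M. single (e M + single i n)
      (of_nat (lookup (e M) i + Suc n) * P M))"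
    using Vfilt.deriv[OF Suc.prems, of i] unfolding xderiv_single eq
    by (simp add: lookup_add)
  from Suc.IH[OF this] show ?case by (simp add: ac_simps)
qed simp

lemma Vfilt_deriv_multi:
  assumes "finite F" "Vfilt r f m (\<lambda>M. single (e M + (\<Sum>i\<in>F. single i (n i))) (P M))"
  shows "Vfilt r f m (\<lambda>M. single (e M)
           (P M * (\<Prod>i\<in>F. \<Prod>k<n i. of_nat (lookup (e M) i) + of_nat (Suc k))))"
  using assms
proof (induction F arbitrary: P rule: finite_induct)
  case (insert i F)
  let ?s = "\<Sum>i\<in>F. single i (n i)"
  have "Vfilt r f m (\<lambda>M. single ((e M + ?s) + single i (n i)) (P M))"
    using insert by (simp add: ac_simps)
  note Vfilt_deriv_power[OF this]
  moreover have "lookup ?s i = 0"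
    using insert.hyps by (auto simp: lookup_sum lookup_single when_def intro!: sum.neutral)
  ultimately have "Vfilt r f m (\<lambda>M. single (e M + ?s)
      (P M * (\<Prod>k<n i. of_nat (lookup (e M) i) + of_nat (Suc k))))"
    by (simp add: lookup_add)
  from insert.IH[OF this] show ?case using insert.hyps by (simp add: mult_ac)
qed simp

definition ell_poly :: "nat \<Rightarrow> (nat \<Rightarrow> 'n \<Rightarrow>\<^sub>0 nat) \<Rightarrow> 'n \<Rightarrow> (nat \<Rightarrow>\<^sub>0 nat) \<Rightarrow>\<^sub>0 complex" where
  "ell_poly r a i = (\<Sum>j<r. pvar j * pconst (of_nat (lookup (a j) i)))"

text \<open>
  The polynomial \<open>p\<close> for which \<open>p(s) x\<^bsup>\<ell>(s)\<^esup>\<close> arises when the translation \<open>c\<close> is carried out by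
  shifts and \<open>tau\<close> (first product) and then undone in the exponent by multiplications and
  derivatives (second product).
\<close>

definition obstruction :: "nat \<Rightarrow> (nat \<Rightarrow> 'n::finite \<Rightarrow>\<^sub>0 nat) \<Rightarrow> (nat \<Rightarrow> int) \<Rightarrow> (nat \<Rightarrow>\<^sub>0 nat) \<Rightarrow>\<^sub>0 complex" where
  "obstruction r a c = (\<Prod>j<r. \<Prod>k<nat (- c j). pvar j - pconst (of_nat k)) *
     (\<Prod>i\<in>UNIV. \<Prod>k<nat (ell r a c i). ell_poly r a i + pconst (of_nat (Suc k)))"

lemma peval_ell_poly: "peval x (ell_poly r a i) = ell r a x i"
  by (simp add: ell_poly_def ell_def)

lemma count_sum_replicate: "count (\<Sum>j<r. replicate_mset (n j) j) k = (if k < r then n k else 0)" for r :: nat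
  by (auto simp: count_sum)

lemma set_sum_replicate: "set_mset (\<Sum>j<r. replicate_mset (n j) j) \<subseteq> {..<r}" for r :: nat
proof
  fix k assume "k \<in># (\<Sum>j<r. replicate_mset (n j) j)"
  then have "0 < count (\<Sum>j<r. replicate_mset (n j) j) k" by (simp add: count_greater_zero_iff)
  then show "k \<in> {..<r}" unfolding count_sum_replicate by (simp split: if_splits)
qed

text \<open>
  Split \<open>c = B - A\<close> and \<open>\<ell>(c) = \<gamma> - \<mu>\<close> into positive and negative parts.  The operator
  \<open>\<partial>\<^sup>\<gamma> x\<^sup>\<mu> tau\<^sup>A t\<^sup>B\<close> has degree \<open>|B| - |A| = 1\<close> and maps the basic family to a multiple of itself;
  the factors are the falling factorials from \<open>tau\<^sup>A\<close> and the rising ones from \<open>\<partial>\<^sup>\<gamma>\<close>.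
\<close>

lemma obstruction_in_bs_ideal:
  assumes c: "(\<Sum>j<r. c j) = 1"
  shows "obstruction r a c \<in> bs_ideal r a"
proof -
  let ?g = "monomial_gens r a"
  define B where "B = (\<Sum>j<r. replicate_mset (nat (c j)) j)"
  define A where "A = (\<Sum>j<r. replicate_mset (nat (- c j)) j)"
  have cB: "count B j = (if j < r then nat (c j) else 0)" and cA: "count A j = (if j < r then nat (- c j) else 0)" for j
    unfolding A_def B_def by (rule count_sum_replicate)+
  have sB: "set_mset B \<subseteq> {..<r}" and sA: "set_mset A \<subseteq> {..<r}"
    unfolding A_def B_def by (rule set_sum_replicate)+
  have "int (size B) - int (size A) = (\<Sum>j<r. int (nat (c j)) - int (nat (- c j)))"
    by (simp add: A_def B_def sum_subtractf)
  also have "\<dots> = 1" unfolding c[symmetric] by (rule sum.cong) auto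
  finally have sz: "size B = 1 + size A" by simp
  define \<gamma> where "\<gamma> = (\<Sum>i\<in>UNIV. single i (nat (ell r a c i)))"
  define \<mu> where "\<mu> = (\<Sum>i\<in>UNIV. single i (nat (- ell r a c i)))"
  have lg: "lookup \<gamma> i = nat (ell r a c i)" and lm: "lookup \<mu> i = nat (- ell r a c i)" for i
    by (simp_all add: \<gamma>_def \<mu>_def lookup_sum lookup_single when_def)
  \<comment> \<open>Outside the range of indices both sides of the identities below are zero.\<close>
  define P where "P M = (if set_mset M \<subseteq> {..<r} then falling r M A else 0)" for M
  have "Vfilt r ?g (size B) (tshift B (gen_prod ?g))"
    using Vfilt_tshift_multi[OF sB Vfilt.base] by simp
  then have "Vfilt r ?g 1 (\<lambda>M. single \<mu> 1 *
      (single 0 (falling r M A) * tshift B (gen_prod ?g) (M - A)))"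
    unfolding sz by (intro Vfilt.mono Vfilt_tau_multi[OF sA])
  also have "(\<lambda>M. single \<mu> 1 * (single 0 (falling r M A) * tshift B (gen_prod ?g) (M - A)))
     = (\<lambda>M. single (exponent_sum a M + \<gamma>) (P M))"
  proof
    fix M
    show "single \<mu> 1 * (single 0 (falling r M A) * tshift B (gen_prod ?g) (M - A))
       = single (exponent_sum a M + \<gamma>) (P M)"
    proof (cases "set_mset M \<subseteq> {..<r} \<and> falling r M A \<noteq> 0")
      case True
      have le: "count A j \<le> count M j" for j
      proof (rule ccontr)
        assume n: "\<not> ?thesis"
        then have "j < r" using cA by (metis le0 not_less)
        moreover have "(\<Prod>k<count A j. of_nat (count M j) - of_nat k) = (0 :: complex)"
          by (rule prod_zero) (use n in auto)
        ultimately have "falling r M A = 0" unfolding falling_def by (intro prod_zero) auto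
        with True show False by simp
      qed
      have sN: "set_mset (B + (M - A)) \<subseteq> {..<r}" using True sB by (auto dest: in_diffD)
      have "int (count (B + (M - A)) j) = cnt M j + c j" if "j < r" for j
        using le[of j] that by (auto simp: cA cB of_nat_diff)
      then have "ell r a (cnt (B + (M - A))) i = ell r a (cnt M) i + ell r a c i" for i
        unfolding ell_add[symmetric] by (simp add: ell_def)
      then have "int (lookup (exponent_sum a (B + (M - A))) i) = int (lookup (exponent_sum a M) i) + ell r a c i" for i
        using lookup_exponent_sum[OF sN, where 'b = int, of a i] lookup_exponent_sum[where M = M and r = r and 'b = int and a = a and i = i] True
        by simp
      moreover have bal: "nat (- e) + k = l + nat e" if "int k = int l + e" for e k l
        using that by arith
      ultimately have "\<mu> + exponent_sum a (B + (M - A)) = exponent_sum a M + \<gamma>"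
        by (intro poly_mapping_eqI) (simp only: lookup_add lg lm bal)
      then show ?thesis using True sN
        by (simp add: tshift_def gen_prod_monomial_gens xmonom_def P_def mult_single)
    next
      case False
      then have "P M = 0" by (auto simp: P_def)
      moreover have "falling r M A = 0 \<or> gen_prod ?g (B + (M - A)) = 0"
      proof (cases "falling r M A = 0")
        case nz: False
        with False obtain j where j: "j \<in># M" "\<not> j < r" by auto
        then have "count (M - A) j > 0" by (simp add: cA)
        then have "j \<in># B + (M - A)" by (simp only: count_greater_zero_iff union_iff simp_thms)
        then have "\<not> set_mset (B + (M - A)) \<subseteq> {..<r}" using j(2) by (meson lessThan_iff subsetD)
        then have "gen_prod ?g (B + (M - A)) = 0" by (simp only: gen_prod_monomial_gens if_False)
        then show ?thesis by blast
      qed simp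
      ultimately show ?thesis by (auto simp: tshift_def)
    qed
  qed
  finally have "Vfilt r ?g 1 (\<lambda>M. single (exponent_sum a M)
      (P M * (\<Prod>i\<in>UNIV. \<Prod>k<nat (ell r a c i). of_nat (lookup (exponent_sum a M) i) + of_nat (Suc k))))"
    unfolding \<gamma>_def by (intro Vfilt_deriv_multi) auto
  also have "(\<lambda>M. single (exponent_sum a M)
      (P M * (\<Prod>i\<in>UNIV. \<Prod>k<nat (ell r a c i). of_nat (lookup (exponent_sum a M) i) + of_nat (Suc k))))
    = (\<lambda>M. single 0 (peval (cnt M) (obstruction r a c)) * gen_prod ?g M)"
  proof
    fix M
    show "single (exponent_sum a M)
      (P M * (\<Prod>i\<in>UNIV. \<Prod>k<nat (ell r a c i). of_nat (lookup (exponent_sum a M) i) + of_nat (Suc k)))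
    = single 0 (peval (cnt M) (obstruction r a c)) * gen_prod ?g M"
    proof (cases "set_mset M \<subseteq> {..<r}")
      case True
      have "falling r M A = (\<Prod>j<r. \<Prod>k<nat (- c j). of_nat (count M j) - of_nat k)"
        unfolding falling_def by (rule prod.cong) (simp_all add: cA)
      then show ?thesis using True
        by (simp add: P_def obstruction_def peval_ell_poly gen_prod_monomial_gens xmonom_def mult_single lookup_exponent_sum[OF True] del: of_nat_Suc)
    qed (simp add: P_def gen_prod_monomial_gens)
  qed
  finally show ?thesis by (simp add: bs_ideal_def)
qed

text \<open>
  A translation \<open>c\<close> that contradicts stuckness would make every factor of its obstruction nonzero
  under \<open>\<phi>\<close>, whereas one factor lies in the prime ideal.  The functional need not be
  multiplicative because all factors are affine linear.
\<close>

lemma stuck_of_prime: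
  assumes prime: "\<And>x y. x * y \<in> P \<Longrightarrow> x \<in> P \<or> y \<in> P" and J: "bs_ideal r a \<subseteq> P" and P1: "1 \<notin> P"
    and \<phi>: "\<And>x y. \<phi> (x + y) = \<phi> x + \<phi> y" "\<And>c x. \<phi> (pconst c * x) = c * \<phi> x"
      "\<And>x. x \<in> P \<Longrightarrow> \<phi> x = 0" "\<phi> 1 = 1"
  shows "stuck r a (\<lambda>j. \<phi> (pvar j))"
  unfolding stuck_def
proof
  let ?z = "\<lambda>j. \<phi> (pvar j)"
  have phi_const: "\<phi> (pconst c) = c" for c using \<phi>(2)[of c 1] \<phi>(4) by simp
  have phi0: "\<phi> 0 = 0" using \<phi>(1)[of 0 0] by simp
  have phi_sum: "\<phi> (sum f S) = (\<Sum>s\<in>S. \<phi> (f s))" for f :: "nat \<Rightarrow> _" and S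
    by (induction S rule: infinite_finite_induct) (auto simp: phi0 \<phi>(1))
  have phi_diff: "\<phi> (x - y) = \<phi> x - \<phi> y" for x y using \<phi>(1)[of "x - y" y] by simp
  have phi_var: "\<phi> (pvar j * pconst c) = \<phi> (pvar j) * c" for j c
    using \<phi>(2)[of c "pvar j"] by (simp only: mult.commute)
  have phi_ell: "\<phi> (ell_poly r a i) = ell r a ?z i" for i
    unfolding ell_poly_def ell_def phi_sum phi_var ..
  assume "\<exists>c :: nat \<Rightarrow> int. (\<Sum>j<r. c j) = 1 \<and>
      (\<forall>j<r. ?z j \<in> \<nat> \<longrightarrow> ?z j + of_int (c j) \<in> \<nat>) \<and>
      (\<forall>i. ell r a ?z i \<in> negint \<longrightarrow> ell r a ?z i + of_int (ell r a c i) \<in> negint)"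
  then obtain c :: "nat \<Rightarrow> int" where c: "(\<Sum>j<r. c j) = 1"
    and c1: "\<And>j. j < r \<Longrightarrow> ?z j \<in> \<nat> \<Longrightarrow> ?z j + of_int (c j) \<in> \<nat>"
    and c2: "\<And>i. ell r a ?z i \<in> negint \<Longrightarrow> ell r a ?z i + of_int (ell r a c i) \<in> negint"
    by blast
  from obstruction_in_bs_ideal[OF c, of a] J have "obstruction r a c \<in> P" by blast
  then consider "(\<Prod>j<r. \<Prod>k<nat (- c j). pvar j - pconst (of_nat k)) \<in> P"
    | "(\<Prod>i\<in>UNIV. \<Prod>k<nat (ell r a c i). ell_poly r a i + pconst (of_nat (Suc k))) \<in> P"
    unfolding obstruction_def using prime by blast
  then show False
  proof cases
    case 1
    then obtain j where j: "j < r" "(\<Prod>k<nat (- c j). pvar j - pconst (of_nat k)) \<in> P"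
      using prod_mem_prime[OF _ prime P1, of "{..<r}"] by auto
    then obtain k where k: "k < nat (- c j)" "pvar j - pconst (of_nat k) \<in> P"
      using prod_mem_prime[OF _ prime P1, of "{..<nat (- c j)}"] by auto
    have "\<phi> (pvar j) - \<phi> (pconst (of_nat k)) = 0" using \<phi>(3)[OF k(2)] unfolding phi_diff .
    then have z: "?z j = of_nat k" unfolding phi_const by (rule eq_iff_diff_eq_0[THEN iffD2])
    then have "?z j + of_int (c j) \<in> \<nat>" using c1[OF j(1)] by simp
    then obtain m where "of_nat k + of_int (c j) = complex_of_nat m" using z by (auto elim: Nats_cases)
    then have "of_int (int k + c j) = (of_int (int m) :: complex)" by simp
    then have "int k + c j = int m" by (simp only: of_int_eq_iff)
    then show False using k(1) by linarith
  next
    case 2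
    then obtain i where i: "(\<Prod>k<nat (ell r a c i). ell_poly r a i + pconst (of_nat (Suc k))) \<in> P"
      using prod_mem_prime[OF finite prime P1 2] by blast
    then obtain k where k: "k < nat (ell r a c i)" "ell_poly r a i + pconst (of_nat (Suc k)) \<in> P"
      using prod_mem_prime[OF _ prime P1, of "{..<nat (ell r a c i)}"] by auto
    have "\<phi> (ell_poly r a i) + \<phi> (pconst (of_nat (Suc k))) = 0" using \<phi>(3)[OF k(2)] \<phi>(1) by simp
    then have z: "ell r a ?z i = - of_nat (Suc k)" unfolding phi_ell phi_const by (rule eq_neg_iff_add_eq_0[THEN iffD2])
    then have "ell r a ?z i \<in> negint" unfolding negint_def by blast
    from c2[OF this] obtain m where "- of_nat (Suc k) + of_int (ell r a c i) = - complex_of_nat (Suc m)"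
      unfolding z negint_def by blast
    then have "of_int (- int (Suc k) + ell r a c i) = (of_int (- int (Suc m)) :: complex)" by simp
    then have "- int (Suc k) + ell r a c i = - int (Suc m)" by (simp only: of_int_eq_iff)
    then show False using k(1) by linarith
  qed
qed

text \<open>
  Suppose the ideal contains no product of factors \<open>S - \<Sum>\<^sub>j z\<^sub>j\<close>, where \<open>S = \<Sum>\<^sub>j s\<^sub>j\<close> and \<open>z\<close> is
  stuck, and take a prime ideal \<open>P\<close> above it that contains none of them either.  If \<open>S\<close> were not
  congruent to a constant modulo \<open>P\<close>, a functional could be chosen to have the value \<open>\<i>\<close> at \<open>S\<close>,
  and the stuck point obtained from it would have a nonreal sum.  So \<open>S - c \<in> P\<close> for some
  \<open>c\<close>, and \<open>c\<close> is the sum of a stuck point.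
\<close>

lemma model_relation_exists:
  assumes r: "0 < r" and real: "\<And>z. stuck r a z \<Longrightarrow> (\<Sum>j<r. z j) \<in> \<real>"
  shows "\<exists>cs. (\<forall>c\<in>set cs. \<exists>z. stuck r a z \<and> c = (\<Sum>j<r. z j)) \<and>
     model_relation r (monomial_gens r a) (\<Prod>c\<leftarrow>cs. [:- c, 1:])"
proof -
  let ?R = "{\<Sum>j<r. z j | z. stuck r a z}"
  let ?s = "\<Sum>j<r. pvar j"
  let ?S = "{\<Prod>c\<leftarrow>cs. ?s - pconst c | cs. set cs \<subseteq> ?R}"
  have "bs_ideal r a \<inter> ?S \<noteq> {}"
  proof
    assume disj: "bs_ideal r a \<inter> ?S = {}"
    have S1: "1 \<in> ?S" by (rule CollectI, rule exI[of _ "[]"]) simp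
    have Sm: "x * y \<in> ?S" if "x \<in> ?S" "y \<in> ?S" for x y
    proof -
      from that obtain cs ds where "x = (\<Prod>c\<leftarrow>cs. ?s - pconst c)" "y = (\<Prod>c\<leftarrow>ds. ?s - pconst c)"
        "set cs \<subseteq> ?R" "set ds \<subseteq> ?R" by blast
      then show ?thesis by (intro CollectI exI[of _ "cs @ ds"]) simp
    qed
    obtain P where P: "module.subspace (*) P" "bs_ideal r a \<subseteq> P" "P \<inter> ?S = {}"
      and prime: "\<And>x y. x * y \<in> P \<Longrightarrow> x \<in> P \<or> y \<in> P"
      by (rule prime_ideal_avoiding[OF bs_ideal_ideal[OF r] S1 Sm disj]) auto
    have P1: "1 \<notin> P" using P(3) S1 by blast
    let ?scale = "\<lambda>c p. pconst c * p"
    have vs: "vector_space ?scale"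
      by unfold_locales
        (simp_all add: algebra_simps single_add mult_single flip: mult.assoc)
    interpret v: vector_space ?scale by (rule vs)
    have sub: "module.subspace ?scale P"
      using P(1) unfolding is_ideal_iff v.subspace_def by blast
    obtain \<phi> where \<phi>: "\<And>x y. \<phi> (x + y) = \<phi> x + \<phi> y" "\<And>c x. \<phi> (pconst c * x) = c * \<phi> x"
      "\<And>x. x \<in> P \<Longrightarrow> \<phi> x = 0" "\<phi> 1 = 1"
      and \<phi>s: "?s \<notin> module.span ?scale (insert 1 P) \<Longrightarrow> \<phi> ?s = \<i>"
      by (rule separating_functional[OF vs sub P1, where w = ?s and t = \<i>]) auto
    have st: "stuck r a (\<lambda>j. \<phi> (pvar j))"
      by (rule stuck_of_prime[OF prime P(2) P1 \<phi>])
    have phi0: "\<phi> 0 = 0" using \<phi>(1)[of 0 0] by simp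
    have phi_sum: "\<phi> (sum f A) = (\<Sum>s\<in>A. \<phi> (f s))" for f :: "nat \<Rightarrow> _" and A
      by (induction A rule: infinite_finite_induct) (auto simp: phi0 \<phi>(1))
    have phis: "\<phi> ?s = (\<Sum>j<r. \<phi> (pvar j))" by (rule phi_sum)
    have "?s \<in> module.span ?scale (insert 1 P)"
    proof (rule ccontr)
      assume "\<not> ?thesis"
      then have "\<i> \<in> \<real>" using \<phi>s real[OF st] phis by simp
      then show False by (simp add: complex_is_Real_iff)
    qed
    then obtain c where c: "?s - pconst c * 1 \<in> P"
      unfolding v.span_breakdown_eq v.span_eq_iff[THEN iffD2, OF sub] by blast
    then have "\<phi> (?s - pconst c * 1) = 0" by (rule \<phi>(3))
    then have "c = \<phi> ?s" using \<phi>(1)[of "?s - pconst c * 1" "pconst c * 1"] \<phi>(2)[of c 1] \<phi>(4) by simp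
    then have "c \<in> ?R" using st phis by blast
    then have "?s - pconst c * 1 \<in> ?S" by (intro CollectI exI[of _ "[c]"]) auto
    with c P(3) show False by blast
  qed
  then obtain cs where cs: "set cs \<subseteq> ?R" "(\<Prod>c\<leftarrow>cs. ?s - pconst c) \<in> bs_ideal r a" by blast
  have ev: "single 0 (peval (cnt M) (\<Prod>c\<leftarrow>cs. ?s - pconst c)) * gen_prod (monomial_gens r a) M =
      single 0 (poly (\<Prod>c\<leftarrow>cs. [:- c, 1:]) (of_nat (size M))) * gen_prod (monomial_gens r a) M" for M
  proof (cases "set_mset M \<subseteq> {..<r}")
    case True
    have "peval (cnt M) (\<Prod>c\<leftarrow>cs. ?s - pconst c) = poly (\<Prod>c\<leftarrow>cs. [:- c, 1:]) (of_nat (size M))"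
      unfolding size_conv_sum[OF True] by (induction cs) (auto simp: algebra_simps)
    then show ?thesis by simp
  qed (simp add: gen_prod_monomial_gens)
  have "model_relation r (monomial_gens r a) (\<Prod>c\<leftarrow>cs. [:- c, 1:])"
    using cs(2) unfolding bs_ideal_def model_relation_def mem_Collect_eq ev by (simp only:)
  with cs(1) show ?thesis by (intro exI[of _ cs]) blast
qed

section \<open>The Newton polyhedron and its faces\<close>

lemma keys_ideal_gen:
  assumes "p \<in> ideal_gen (xmonom ` U)" "v \<in> keys p"
  shows "\<exists>u\<in>U. \<exists>w. v = u + w"
proof -
  let ?S = "{p :: 'a cpoly. \<forall>v\<in>keys p. \<exists>u\<in>U. \<exists>w. v = u + w}"
  have sub: "module.subspace (*) ?S"
    unfolding module.subspace_def[OF module_mult]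
  proof (intro conjI ballI allI)
    fix p q assume "p \<in> ?S" "q \<in> ?S"
    then show "p + q \<in> ?S" using keys_add[of p q] by blast
  next
    fix c p :: "'a cpoly" assume p: "p \<in> ?S"
    show "c * p \<in> ?S"
    proof (intro CollectI ballI)
      fix v assume "v \<in> keys (c * p)"
      then obtain x y where v: "v = x + y" "y \<in> keys p" using keys_mult[of c p] by auto
      with p obtain u w where u: "u \<in> U" "y = u + w" by blast
      have "v = u + (x + w)" by (simp add: v(1) u(2) ac_simps)
      with u(1) show "\<exists>u\<in>U. \<exists>w. v = u + w" by blast
    qed
  qed simp
  have "xmonom ` U \<subseteq> ?S"
  proof (intro image_subsetI CollectI ballI)
    fix u v assume "u \<in> U" "v \<in> keys (xmonom u :: 'a cpoly)"
    then have "v = u + 0" by (simp add: xmonom_def)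
    with \<open>u \<in> U\<close> show "\<exists>u\<in>U. \<exists>w. v = u + w" by blast
  qed
  then have "ideal_gen (xmonom ` U) \<subseteq> ?S" by (rule module.span_minimal[OF module_mult _ sub])
  with assms show ?thesis by blast
qed

lemma xmonom_mem_ideal_gen:
  "(xmonom v :: 'n cpoly) \<in> ideal_gen (xmonom ` U) \<longleftrightarrow> (\<exists>u\<in>U. \<exists>w. v = u + w)"
proof
  assume "\<exists>u\<in>U. \<exists>w. v = u + w"
  then obtain u w where "u \<in> U" "v = u + w" by blast
  then have "(xmonom v :: 'n cpoly) = xmonom w * xmonom u" by (simp add: xmonom_def mult_single add.commute)
  moreover have "xmonom w * xmonom u \<in> ideal_gen (xmonom ` U :: 'n cpoly set)"
    using \<open>u \<in> U\<close> by (intro module.span_scale[OF module_mult] module.span_base[OF module_mult]) auto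
  ultimately show "(xmonom v :: 'n cpoly) \<in> ideal_gen (xmonom ` U)" by simp
qed (use keys_ideal_gen[of "xmonom v"] in \<open>auto simp: xmonom_def\<close>)

lemma expvec_add: "expvec (u + v) = expvec u + expvec v"
  by (simp add: expvec_def lookup_add vec_eq_iff)

lemma expvec_nth [simp]: "expvec u $ i = real (lookup u i)"
  by (simp add: expvec_def)

lemma expvec_inj: "expvec u = expvec v \<longleftrightarrow> u = v"
  by (auto simp: vec_eq_iff intro: poly_mapping_eqI)

lemma expvec_surj:
  fixes y :: "real ^ 'n::finite"
  assumes "\<And>i. y $ i \<in> \<nat>"
  shows "\<exists>u. y = expvec u"
proof -
  from assms have "\<forall>i. \<exists>n. y $ i = of_nat n" by (meson Nats_cases)
  then obtain n where n: "\<And>i. y $ i = of_nat (n i)" by metis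
  have "y = expvec (\<Sum>i\<in>UNIV. single i (n i))"
    by (simp add: vec_eq_iff n lookup_sum lookup_single when_def)
  then show ?thesis by blast
qed

lemma Gam_up: "monomial_ideal I \<Longrightarrow> x \<in> Gam I \<Longrightarrow> x + expvec w \<in> Gam I"
proof -
  assume "monomial_ideal I" "x \<in> Gam I"
  then obtain U u where I: "I = ideal_gen (xmonom ` U)" and u: "x = expvec u" "xmonom u \<in> I"
    unfolding monomial_ideal_def Gam_def by blast
  then have "xmonom (u + w) \<in> I" unfolding I xmonom_mem_ideal_gen by (metis add.assoc)
  then show ?thesis unfolding Gam_def u(1) expvec_add[symmetric] by blast
qed

lemma Gam_up_vec: "monomial_ideal I \<Longrightarrow> x \<in> Gam I \<Longrightarrow> (\<And>i. y $ i \<in> \<nat>) \<Longrightarrow> x + y \<in> Gam I"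
  using Gam_up expvec_surj by metis

lemma Gam_nonneg: "x \<in> Gam I \<Longrightarrow> 0 \<le> x $ i"
  by (auto simp: Gam_def)

lemma newton_convex: "convex (newton_polyhedron I)"
  by (simp add: newton_polyhedron_def convex_convex_hull)

lemma Gam_subset_newton: "Gam I \<subseteq> newton_polyhedron I"
  by (simp add: newton_polyhedron_def hull_subset)

lemma newton_nonneg:
  assumes "x \<in> newton_polyhedron I" shows "0 \<le> x $ i"
proof -
  have "convex {x :: real ^ 'a. 0 \<le> x $ i}"
    using convex_halfspace_ge[of 0 "axis i 1 :: real ^ 'a"] by (simp add: inner_axis' cart_eq_inner_axis inner_commute)
  then have "newton_polyhedron I \<subseteq> {x. 0 \<le> x $ i}"
    unfolding newton_polyhedron_def by (intro hull_minimal) (auto simp: Gam_nonneg)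
  with assms show ?thesis by blast
qed

text \<open>
  Large integer multiples of \<open>e\<^sub>i\<close> preserve the set of exponents, hence its hull; smaller
  multiples are obtained by convexity.
\<close>

lemma newton_up_axis:
  assumes I: "monomial_ideal I" and x: "x \<in> newton_polyhedron I" and t: "0 \<le> t"
  shows "x + t *\<^sub>R axis i 1 \<in> newton_polyhedron I"
proof -
  obtain n :: nat where n: "t \<le> real n" "0 < n" using real_arch_simple[of "max t 1"] by (metis max.bounded_iff not_one_le_zero of_nat_0 neq0_conv)
  let ?y = "real n *\<^sub>R axis i 1 :: real ^ 'a"
  have "convex {x. x + ?y \<in> newton_polyhedron I}"
    unfolding convex_alt
  proof (intro ballI allI impI CollectI)
    fix x z and s :: real
    assume "x \<in> {x. x + ?y \<in> newton_polyhedron I}" "z \<in> {x. x + ?y \<in> newton_polyhedron I}" "0 \<le> s \<and> s \<le> 1"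
    then have "(1 - s) *\<^sub>R (x + ?y) + s *\<^sub>R (z + ?y) \<in> newton_polyhedron I"
      using newton_convex[of I] unfolding convex_alt by simp
    also have "(1 - s) *\<^sub>R (x + ?y) + s *\<^sub>R (z + ?y) = (1 - s) *\<^sub>R x + s *\<^sub>R z + ?y"
      by (simp add: algebra_simps)
    finally show "(1 - s) *\<^sub>R x + s *\<^sub>R z + ?y \<in> newton_polyhedron I" .
  qed
  moreover have "Gam I \<subseteq> {x. x + ?y \<in> newton_polyhedron I}"
    using Gam_up_vec[OF I, of _ ?y] Gam_subset_newton[of I] by (auto simp: axis_def)
  ultimately have "newton_polyhedron I \<subseteq> {x. x + ?y \<in> newton_polyhedron I}"
    unfolding newton_polyhedron_def[of I] by (intro hull_minimal) (auto simp: newton_polyhedron_def)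
  with x have y: "x + ?y \<in> newton_polyhedron I" by blast
  have "(1 - t / n) *\<^sub>R x + (t / n) *\<^sub>R (x + ?y) \<in> newton_polyhedron I"
    using n t by (intro convexD[OF newton_convex x y]) (auto simp: field_simps)
  also have "(1 - t / n) *\<^sub>R x + (t / n) *\<^sub>R (x + ?y) = x + t *\<^sub>R axis i 1"
    using n by (simp add: algebra_simps)
  finally show ?thesis .
qed

lemma newton_up:
  assumes I: "monomial_ideal I" and x: "x \<in> newton_polyhedron I" and y: "\<And>i. 0 \<le> y $ i"
  shows "x + y \<in> newton_polyhedron I"
proof -
  have "x + (\<Sum>i\<in>F. (y $ i) *\<^sub>R axis i 1) \<in> newton_polyhedron I" if "finite F" for F
    using that
  proof (induction F rule: finite_induct)
    case (insert i F)
    have "x + (\<Sum>i\<in>F. (y $ i) *\<^sub>R axis i 1) + (y $ i) *\<^sub>R axis i 1 \<in> newton_polyhedron I"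
      by (rule newton_up_axis[OF I insert.IH y])
    then show ?case using insert.hyps by (simp add: ac_simps)
  qed (simp add: x)
  from this[of UNIV] show ?thesis
    using basis_expansion[of y] by (simp add: scalar_mult_eq_scaleR)
qed

text \<open>
  Every point of \<open>Q\<close> is a convex combination of points of \<open>S\<close>, and the defining property of a face
  forces those with positive weight into \<open>Q\<close>.  In the proof the set of points that satisfy the
  claim is shown to be convex.
\<close>

lemma face_subset_hull:
  assumes Q: "Q face_of (convex hull S)"
  shows "Q \<subseteq> convex hull (S \<inter> Q)"
proof -
  let ?T = "{x \<in> convex hull S. x \<in> Q \<longrightarrow> x \<in> convex hull (S \<inter> Q)}"
  have "convex ?T"
  proof (rule convexI)
    fix x y and u v :: real assume x: "x \<in> ?T" and y: "y \<in> ?T" and uv: "0 \<le> u" "0 \<le> v" "u + v = 1"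
    let ?z = "u *\<^sub>R x + v *\<^sub>R y"
    have z: "?z \<in> convex hull S"
      using x y by (intro convexD[OF convex_convex_hull _ _ uv]) auto
    have "?z \<in> convex hull (S \<inter> Q)" if zQ: "?z \<in> Q"
    proof (cases "u = 0 \<or> v = 0 \<or> x = y")
      case True
      then have "?z = x \<or> ?z = y" using uv(3) by (auto simp flip: scaleR_add_left)
      with zQ x y show ?thesis by auto
    next
      case False
      then have "?z \<in> open_segment x y" using uv unfolding in_segment
        by (intro conjI exI[of _ v]) (auto simp: eq_diff_eq[symmetric] intro: arg_cong2)
      then have "x \<in> Q \<and> y \<in> Q" using Q zQ x y unfolding face_of_def by blast
      with x y have "x \<in> convex hull (S \<inter> Q)" "y \<in> convex hull (S \<inter> Q)" by auto
      then show ?thesis by (rule convexD[OF convex_convex_hull _ _ uv])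
    qed
    with z show "?z \<in> ?T" by blast
  qed
  moreover have "S \<subseteq> ?T" by (auto intro: hull_inc)
  ultimately have "convex hull S \<subseteq> ?T" by (intro hull_minimal) auto
  with face_of_imp_subset[OF Q] show ?thesis by blast
qed

text \<open>
  The smallest face that contains \<open>p\<close>: the points \<open>y\<close> such that the segment from \<open>y\<close> to \<open>p\<close> can be
  prolonged beyond \<open>p\<close> within \<open>P\<close>.
\<close>

lemma face_generated_by_point:
  fixes P :: "'a::real_vector set"
  assumes P: "convex P" and p: "p \<in> P"
  shows "{y \<in> P. \<exists>\<epsilon>>0. p + \<epsilon> *\<^sub>R (p - y) \<in> P} face_of P" (is "?Q face_of P")
  unfolding face_of_def
proof (intro conjI ballI impI)
  show "convex ?Q"
    unfolding convex_alt
  proof (intro ballI allI impI)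
    fix x y and t :: real assume x: "x \<in> ?Q" and y: "y \<in> ?Q" and t: "0 \<le> t \<and> t \<le> 1"
    from x obtain d where d: "d > 0" "p + d *\<^sub>R (p - x) \<in> P" by blast
    from y obtain e where e: "e > 0" "p + e *\<^sub>R (p - y) \<in> P" by blast
    define c where "c = min d e"
    have shrink: "p + c *\<^sub>R (p - x) \<in> P" if "b > 0" "p + b *\<^sub>R (p - x) \<in> P" "0 < c" "c \<le> b" for b x
    proof -
      have "(1 - c / b) *\<^sub>R p + (c / b) *\<^sub>R (p + b *\<^sub>R (p - x)) \<in> P"
        using that p by (intro convexD[OF P]) (auto simp: field_simps)
      then show ?thesis using that by (simp add: algebra_simps)
    qed
    have c: "c > 0" using d e by (simp add: c_def)
    have "(1 - t) *\<^sub>R (p + c *\<^sub>R (p - x)) + t *\<^sub>R (p + c *\<^sub>R (p - y)) \<in> P"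
      using t c shrink[OF d(1,2)] shrink[OF e(1,2)] by (intro convexD[OF P]) (auto simp: c_def)
    also have "(1 - t) *\<^sub>R (p + c *\<^sub>R (p - x)) + t *\<^sub>R (p + c *\<^sub>R (p - y)) =
        p + c *\<^sub>R (p - ((1 - t) *\<^sub>R x + t *\<^sub>R y))"
      by (simp add: algebra_simps)
    finally show "(1 - t) *\<^sub>R x + t *\<^sub>R y \<in> ?Q"
      using c x y t P unfolding convex_alt by blast
  qed
next
  have key: "a \<in> ?Q" if a: "a \<in> P" and b: "b \<in> P" and t: "0 < t" "t < 1" and y: "(1 - t) *\<^sub>R a + t *\<^sub>R b \<in> ?Q" for a b t
  proof -
    let ?y = "(1 - t) *\<^sub>R a + t *\<^sub>R b"
    from y obtain e where e: "e > 0" "p + e *\<^sub>R (p - ?y) \<in> P" by blast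
    define s where "s = 1 + e * t"
    have "0 < e * t" using e t by simp
    then have s: "s > 0" "s \<noteq> 0" by (auto simp: s_def)
    have "(1 / s) *\<^sub>R (p + e *\<^sub>R (p - ?y)) + (e * t / s) *\<^sub>R b \<in> P"
      using e t b s by (intro convexD[OF P]) (auto simp: s_def field_simps)
    also have "(1 / s) *\<^sub>R (p + e *\<^sub>R (p - ?y)) + (e * t / s) *\<^sub>R b =
        (1 / s) *\<^sub>R ((1 + e) *\<^sub>R p - (e * (1 - t)) *\<^sub>R a)"
      by (simp add: algebra_simps)
    also have "\<dots> = p + (e * (1 - t) / s) *\<^sub>R (p - a)"
    proof -
      let ?k = "e * (1 - t) / s"
      have eq: "(1 + e) / s = 1 + ?k" using s by (simp add: s_def field_simps)
      have "(1 / s) *\<^sub>R ((1 + e) *\<^sub>R p - (e * (1 - t)) *\<^sub>R a) = ((1 + e) / s) *\<^sub>R p - ?k *\<^sub>R a"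
        by (simp add: scaleR_diff_right)
      also have "\<dots> = (1 + ?k) *\<^sub>R p - ?k *\<^sub>R a" by (simp only: eq)
      also have "\<dots> = p + ?k *\<^sub>R (p - a)" by (simp add: scaleR_add_left scaleR_diff_right)
      finally show ?thesis .
    qed
    finally have "p + (e * (1 - t) / s) *\<^sub>R (p - a) \<in> P" .
    moreover have "0 < e * (1 - t) / s" using e t s by simp
    ultimately show ?thesis using a by blast
  qed
  fix a b x assume a: "a \<in> P" and b: "b \<in> P" and x: "x \<in> ?Q" "x \<in> open_segment a b"
  then obtain t where t: "0 < t" "t < 1" "x = (1 - t) *\<^sub>R a + t *\<^sub>R b" by (auto simp: in_segment)
  show "a \<in> ?Q" using key[OF a b t(1,2)] x(1) t(3) by simp
  show "b \<in> ?Q" using key[OF b a, of "1 - t"] x(1) t by (simp add: add.commute)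
qed auto

section \<open>The linear function of a face, and integer relations\<close>

text \<open>
  A \<open>\<rat>\<close>-linear retraction of \<open>\<real>\<close> onto \<open>\<rat>\<close>.  Applied to coefficients, it turns real solutions
  of inhomogeneous linear systems over \<open>\<rat>\<close> into rational solutions.
\<close>

lemma rational_functional: "\<exists>\<phi> :: real \<Rightarrow> rat. (\<forall>x y. \<phi> (x + y) = \<phi> x + \<phi> y) \<and> (\<forall>n x. \<phi> (of_nat n * x) = of_nat n * \<phi> x) \<and> \<phi> 1 = 1"
proof -
  have "vector_space (\<lambda>q x. of_rat q * x :: real)"
    by unfold_locales (simp_all add: algebra_simps of_rat_add of_rat_mult)
  moreover have "vector_space ((*) :: rat \<Rightarrow> rat \<Rightarrow> rat)" by unfold_locales (simp_all add: algebra_simps)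
  ultimately interpret vector_space_pair "\<lambda>q x. of_rat q * x :: real" "(*) :: rat \<Rightarrow> rat \<Rightarrow> rat"
    by (simp add: vector_space_pair_def)
  have "vs1.independent {1}" by (simp add: vs1.independent_insert)
  then obtain \<phi> where lin: "Vector_Spaces.linear (\<lambda>q x. of_rat q * x :: real) (*) \<phi>" and 1: "\<phi> 1 = 1"
    using linear_independent_extend[of "{1}" "\<lambda>_. 1"] by auto
  interpret l: Vector_Spaces.linear "\<lambda>q x. of_rat q * x :: real" "(*)" \<phi> by (rule lin)
  have "\<phi> (of_nat n * x) = of_nat n * \<phi> x" for n x using l.scale[of "of_nat n" x] by simp
  with 1 l.add show ?thesis by blast
qed

text \<open>
  A supporting hyperplane \<open>h\<close> at a point of the relative interior of \<open>Q\<close> is constant on \<open>Q\<close>, with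
  nonnegative coefficients since the Newton polyhedron is closed under adding unit vectors.
  If the constant were \<open>0\<close>, then \<open>Q\<close> would lie in every coordinate hyperplane \<open>x\<^sub>i = 0\<close> with
  \<open>h\<^sub>i \<noteq> 0\<close>.
\<close>

lemma relevant_face_functional:
  assumes I: "monomial_ideal I" and Q: "Q \<in> relevant_faces I"
  shows "\<exists>h. (\<forall>x\<in>Q. h \<bullet> x = 1)"
proof -
  let ?P = "newton_polyhedron I"
  from Q have F: "Q face_of ?P" "Q \<noteq> ?P" and nh: "\<And>i. \<not> Q \<subseteq> {x. x $ i = 0}"
    by (auto simp: relevant_faces_def)
  then have ne: "Q \<noteq> {}" by auto
  have cQ: "convex Q" by (rule face_of_imp_convex[OF F(1)])
  obtain q where q: "q \<in> rel_interior Q" using rel_interior_eq_empty[OF cQ] ne by auto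
  have qQ: "q \<in> Q" using q rel_interior_subset by blast
  have qP: "q \<in> ?P" using qQ face_of_imp_subset[OF F(1)] by blast
  have "q \<notin> rel_interior ?P" using face_of_disjoint_rel_interior[OF F] qQ by blast
  obtain h where h: "h \<noteq> 0" "\<And>y. y \<in> ?P \<Longrightarrow> h \<bullet> q \<le> h \<bullet> y"
    using supporting_hyperplane_rel_boundary[OF newton_convex qP \<open>q \<notin> rel_interior ?P\<close>]
    by (metis closure_subset subsetD)
  have eq: "h \<bullet> x = h \<bullet> q" if x: "x \<in> Q" for x
  proof -
    obtain e where e: "e > 1" "(1 - e) *\<^sub>R x + e *\<^sub>R q \<in> Q"
      using q x convex_rel_interior_iff[OF cQ ne, of q] by blast
    then have "h \<bullet> q \<le> h \<bullet> ((1 - e) *\<^sub>R x + e *\<^sub>R q)" using face_of_imp_subset[OF F(1)] by (intro h(2)) auto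
    then have "(e - 1) * (h \<bullet> x) \<le> (e - 1) * (h \<bullet> q)" by (simp add: inner_add_right algebra_simps)
    then have "h \<bullet> x \<le> h \<bullet> q" using e(1) by (simp add: mult_le_cancel_left_pos)
    moreover have "h \<bullet> q \<le> h \<bullet> x" using x face_of_imp_subset[OF F(1)] by (intro h(2)) auto
    ultimately show ?thesis by simp
  qed
  have hi: "0 \<le> h $ i" for i
    using h(2)[OF newton_up_axis[OF I qP, of 1 i]] by (simp add: inner_add_right inner_axis)
  have "h \<bullet> q \<noteq> 0"
  proof
    assume 0: "h \<bullet> q = 0"
    obtain i where i: "h $ i \<noteq> 0" using h(1) by (auto simp: vec_eq_iff)
    have "x $ i = 0" if x: "x \<in> Q" for x
    proof -
      have xP: "x \<in> ?P" using x face_of_imp_subset[OF F(1)] by blast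
      have "(\<Sum>j\<in>UNIV. h $ j * x $ j) = 0" using eq[OF x] 0 by (simp add: inner_vec_def)
      then have "h $ i * x $ i = 0"
        by (subst (asm) sum_nonneg_eq_0_iff) (auto intro: mult_nonneg_nonneg hi newton_nonneg[OF xP])
      with i show ?thesis by simp
    qed
    with nh[of i] show False by blast
  qed
  then have "\<forall>x\<in>Q. ((1 / (h \<bullet> q)) *\<^sub>R h) \<bullet> x = 1" by (auto simp: eq)
  then show ?thesis by blast
qed

lemma face_hull_Gam:
  assumes "Q \<in> relevant_faces I" shows "Q \<subseteq> convex hull (Gam I \<inter> Q)"
  using assms by (intro face_subset_hull) (simp add: relevant_faces_def newton_polyhedron_def)

text \<open>
  Since \<open>Q\<close> is the hull of its lattice points, the condition on \<open>L\<^sub>Q\<close> is a linear system with integer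
  coefficients, and a real solution gives a rational one.
\<close>

lemma L_face:
  assumes I: "monomial_ideal I" and Q: "Q \<in> relevant_faces I"
  shows "linear (L_face Q)" "\<And>x. x \<in> Q \<Longrightarrow> L_face Q x = 1"
proof -
  obtain h where h: "\<And>x. x \<in> Q \<Longrightarrow> h \<bullet> x = 1" using relevant_face_functional[OF I Q] by blast
  obtain \<phi> :: "real \<Rightarrow> rat" where \<phi>: "\<And>x y. \<phi> (x + y) = \<phi> x + \<phi> y" "\<And>n x. \<phi> (of_nat n * x) = of_nat n * \<phi> x" "\<phi> 1 = 1"
    using rational_functional by blast
  have \<phi>0: "\<phi> 0 = 0" using \<phi>(2)[of 0 0] by simp
  have \<phi>s: "\<phi> (sum g F) = (\<Sum>i\<in>F. \<phi> (g i))" if "finite F" for g and F :: "'a set"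
    using that by (induction F rule: finite_induct) (auto simp: \<phi>0 \<phi>(1))
  let ?k = "(\<chi> i. of_rat (\<phi> (h $ i))) :: real ^ 'a"
  have "?k \<bullet> x = 1" if "x \<in> Gam I \<inter> Q" for x
  proof -
    from that obtain u where u: "x = expvec u" by (auto simp: Gam_def)
    have "(\<Sum>i\<in>UNIV. of_nat (lookup u i) * h $ i) = 1"
      using h[of x] that by (simp add: u inner_vec_def mult.commute)
    then have "\<phi> (\<Sum>i\<in>UNIV. of_nat (lookup u i) * h $ i) = 1" by (simp only: \<phi>(3))
    then have "(\<Sum>i\<in>UNIV. of_nat (lookup u i) * \<phi> (h $ i)) = 1" by (simp only: \<phi>s[OF finite] \<phi>(2))
    then have "(of_rat (\<Sum>i\<in>UNIV. of_nat (lookup u i) * \<phi> (h $ i)) :: real) = 1" by simp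
    then show ?thesis by (simp add: u inner_vec_def of_rat_sum of_rat_mult mult.commute)
  qed
  then have "convex hull (Gam I \<inter> Q) \<subseteq> {x. ?k \<bullet> x = 1}"
    by (intro hull_minimal) (auto simp: convex_hyperplane)
  with face_hull_Gam[OF Q] have k1: "\<forall>x\<in>Q. ?k \<bullet> x = 1" by blast
  have "linear (\<lambda>x. ?k \<bullet> x) \<and> (\<forall>i. ?k \<bullet> axis i 1 \<in> \<rat>) \<and> (\<forall>x\<in>Q. ?k \<bullet> x = 1)"
    using k1 by (auto simp: inner_axis intro!: bounded_linear.linear bounded_linear_inner_right)
  then have "linear (L_face Q) \<and> (\<forall>i. L_face Q (axis i 1) \<in> \<rat>) \<and> (\<forall>x\<in>Q. L_face Q x = 1)"
    unfolding L_face_def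
    by (rule someI[where P = "\<lambda>L. linear L \<and> (\<forall>i. L (axis i 1) \<in> \<rat>) \<and> (\<forall>x\<in>Q. L x = 1)"])
  then show "linear (L_face Q)" "\<And>x. x \<in> Q \<Longrightarrow> L_face Q x = 1" by auto
qed

text \<open>
  Simultaneous Diophantine approximation: a multiple \<open>q \<theta>\<close> is so close to an integer vector that the
  integer values of the linear forms at that vector have absolute value less than \<open>1\<close>.  The
  approximation is also finer than \<open>\<theta> s0\<close>, which keeps the coefficient of \<open>s0\<close> positive.
\<close>

lemma positive_integer_relation:
  fixes \<theta> :: "'s \<Rightarrow> real" and m :: "'t \<Rightarrow> 's \<Rightarrow> int"
  assumes S: "finite S" and T: "finite T" and nn: "\<And>s. s \<in> S \<Longrightarrow> 0 \<le> \<theta> s"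
    and s0: "s0 \<in> S" "0 < \<theta> s0"
    and rel: "\<And>t. t \<in> T \<Longrightarrow> (\<Sum>s\<in>S. \<theta> s * of_int (m t s)) = 0"
  shows "\<exists>p :: 's \<Rightarrow> nat. 0 < p s0 \<and> (\<forall>t\<in>T. (\<Sum>s\<in>S. int (p s) * m t s) = 0)"
proof -
  define B where "B = (\<Sum>t\<in>T. \<Sum>s\<in>S. \<bar>of_int (m t s) :: real\<bar>)"
  have B0: "0 \<le> B" unfolding B_def by (intro sum_nonneg) auto
  obtain N :: nat where N: "max (B + 1) (1 / \<theta> s0 + 1) \<le> real N" using real_arch_simple by blast
  then have N1: "B < real N" "1 / \<theta> s0 < real N" by auto
  have N0: "N > 0" using N1(1) B0 by (metis le_less_trans of_nat_0_less_iff)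
  obtain f where f: "bij_betw f {..<card S} S" using ex_bij_betw_nat_finite[OF S] by (auto simp: atLeast0LessThan)
  obtain q p where q: "0 < q" and p: "\<And>i. i < card S \<Longrightarrow> \<bar>of_int q * \<theta> (f i) - of_int (p i)\<bar> < 1 / N"
    using Dirichlet_approx_simult[OF N0, of "card S" "\<lambda>i. \<theta> (f i)"] by metis
  define g where "g s = p (inv_into {..<card S} f s)" for s
  have g: "\<bar>of_int q * \<theta> s - of_int (g s)\<bar> < 1 / N" if "s \<in> S" for s
  proof -
    have "inv_into {..<card S} f s \<in> {..<card S}"
      using bij_betw_apply[OF bij_betw_inv_into[OF f] that] .
    moreover have "f (inv_into {..<card S} f s) = s" by (rule bij_betw_inv_into_right[OF f that])
    ultimately have "inv_into {..<card S} f s < card S" "f (inv_into {..<card S} f s) = s" by simp_all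
    then show ?thesis using p[of "inv_into {..<card S} f s"] by (simp add: g_def)
  qed
  have N1': "1 / real N \<le> 1" using N0 by simp
  have q1: "1 \<le> (of_int q :: real)" using q by simp
  have g0: "0 \<le> g s" if "s \<in> S" for s
  proof -
    have "0 \<le> of_int q * \<theta> s" using nn[OF that] q1 by simp
    then have "(-1 :: real) < of_int (g s)" using g[OF that] N1' by linarith
    then show ?thesis by linarith
  qed
  have gpos: "0 < g s0"
  proof -
    have "1 / real N < \<theta> s0" using N1(2) s0(2) N0 by (simp add: field_simps)
    also have "\<theta> s0 \<le> of_int q * \<theta> s0" using s0(2) q1 by simp
    finally have "(0::real) < of_int (g s0)" using g[OF s0(1)] by linarith
    then show ?thesis by simp
  qed
  have "(\<Sum>s\<in>S. g s * m t s) = 0" if t: "t \<in> T" for t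
  proof -
    have "of_int (\<Sum>s\<in>S. g s * m t s) = (\<Sum>s\<in>S. (of_int (g s) - of_int q * \<theta> s) * of_int (m t s) :: real)
        + of_int q * (\<Sum>s\<in>S. \<theta> s * of_int (m t s))"
      by (simp add: sum_distrib_left algebra_simps sum.distrib[symmetric] sum_subtractf)
    then have "\<bar>of_int (\<Sum>s\<in>S. g s * m t s) :: real\<bar> = \<bar>\<Sum>s\<in>S. (of_int (g s) - of_int q * \<theta> s) * of_int (m t s)\<bar>"
      using rel[OF t] by simp
    also have "\<dots> \<le> (\<Sum>s\<in>S. \<bar>(of_int (g s) - of_int q * \<theta> s) * of_int (m t s)\<bar>)" by (rule sum_abs)
    also have "\<dots> \<le> (\<Sum>s\<in>S. 1 / N * \<bar>of_int (m t s)\<bar>)"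
      unfolding abs_mult using g by (intro sum_mono mult_right_mono) (auto simp: abs_minus_commute less_imp_le)
    also have "\<dots> = 1 / N * (\<Sum>s\<in>S. \<bar>of_int (m t s)\<bar>)" by (simp add: sum_distrib_left)
    also have "(\<Sum>s\<in>S. \<bar>of_int (m t s)\<bar>) \<le> B"
      unfolding B_def by (rule member_le_sum[OF t _ T]) (auto intro: sum_nonneg)
    finally have "\<bar>of_int (\<Sum>s\<in>S. g s * m t s) :: real\<bar> \<le> 1 / N * B" using N0 by (simp add: divide_right_mono)
    also have "\<dots> < 1" using N1(1) N0 by (simp add: field_simps)
    finally have "\<bar>of_int (\<Sum>s\<in>S. g s * m t s) :: real\<bar> < 1" .
    then show ?thesis by linarith
  qed
  then show ?thesis
    using gpos g0 by (intro exI[of _ "\<lambda>s. nat (g s)"]) (auto cong: sum.cong)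
qed

lemma S_face_add: "x \<in> S_face I Q \<Longrightarrow> y \<in> S_face I Q \<Longrightarrow> x + y \<in> S_face I Q"
  unfolding S_face_def by (rule subsemigroup_gen.add)

lemma S_face_gen: "u \<in> Gam I \<Longrightarrow> v \<in> Gam I \<inter> Q \<Longrightarrow> u - v \<in> S_face I Q"
  unfolding S_face_def by (rule subsemigroup_gen.gen) blast

lemma S_face_0: "v \<in> Gam I \<inter> Q \<Longrightarrow> 0 \<in> S_face I Q"
  using S_face_gen[of v I v Q] by simp

lemma S_face_nat: "v \<in> Gam I \<inter> Q \<Longrightarrow> x \<in> S_face I Q \<Longrightarrow> real n *\<^sub>R x \<in> S_face I Q"
  by (induction n) (auto simp: scaleR_add_left S_face_0 S_face_add)

lemma S_face_sum: "v \<in> Gam I \<inter> Q \<Longrightarrow> (\<And>a. a \<in> A \<Longrightarrow> f a \<in> S_face I Q) \<Longrightarrow> sum f A \<in> S_face I Q"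
  by (induction A rule: infinite_finite_induct) (auto simp: S_face_0 S_face_add)

lemma S_face_up:
  assumes "monomial_ideal I" "v \<in> Gam I \<inter> Q" "\<And>i. y $ i \<in> \<nat>" shows "y \<in> S_face I Q"
proof -
  have "v + y \<in> Gam I" using assms by (intro Gam_up_vec) auto
  from S_face_gen[OF this assms(2)] show ?thesis by simp
qed

lemma S_face_lists:
  assumes "w \<in> S_face I Q"
  shows "\<exists>us vs. set us \<subseteq> Gam I \<and> set vs \<subseteq> Gam I \<inter> Q \<and> length us = length vs \<and> w = sum_list us - sum_list vs"
  using assms unfolding S_face_def
proof (induction rule: subsemigroup_gen.induct)
  case (gen g)
  then obtain u v where "g = u - v" "u \<in> Gam I" "v \<in> Gam I \<inter> Q" by blast
  then show ?case by (intro exI[of _ "[u]"] exI[of _ "[v]"]) auto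
next
  case (add a b)
  then obtain us vs us' vs' where
    "set us \<subseteq> Gam I" "set vs \<subseteq> Gam I \<inter> Q" "length us = length vs" "a = sum_list us - sum_list vs"
    "set us' \<subseteq> Gam I" "set vs' \<subseteq> Gam I \<inter> Q" "length us' = length vs'" "b = sum_list us' - sum_list vs'"
    by blast
  then show ?case by (intro exI[of _ "us @ us'"] exI[of _ "vs @ vs'"]) auto
qed

section \<open>Every element of \<open>R\<^sub>Q\<close> comes from a stuck point\<close>

abbreviation mono_ideal :: "nat \<Rightarrow> (nat \<Rightarrow> 'n::{finite,linorder} \<Rightarrow>\<^sub>0 nat) \<Rightarrow> 'n cpoly set" where
  "mono_ideal r a \<equiv> ideal_gen (xmonom ` a ` {..<r})"

lemma Gam_above_generator:
  assumes "x \<in> Gam (mono_ideal r a)"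
  shows "\<exists>j<r. \<forall>i. lookup (a j) i \<le> x $ i"
proof -
  from assms obtain u where u: "x = expvec u" "xmonom u \<in> mono_ideal r a" by (auto simp: Gam_def)
  from u(2) obtain j w where "j < r" "u = a j + w" unfolding xmonom_mem_ideal_gen by auto
  then show ?thesis by (intro exI[of _ j]) (simp add: u(1) lookup_add)
qed

lemma Gam_generator:
  assumes "j < r" shows "expvec (a j) \<in> Gam (mono_ideal r a)"
proof -
  have "xmonom (a j) \<in> mono_ideal r a"
    using assms by (intro module.span_base[OF module_mult]) auto
  then show ?thesis unfolding Gam_def by blast
qed

lemma monomial_ideal_gen: "monomial_ideal (ideal_gen (xmonom ` U))"
  by (auto simp: monomial_ideal_def)

lemma Gam_expvec: "expvec u \<in> Gam I \<longleftrightarrow> xmonom u \<in> I"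
  by (auto simp: Gam_def expvec_inj)

lemma relevant_face_Gam_nonempty:
  assumes "Q \<in> relevant_faces I" shows "Gam I \<inter> Q \<noteq> {}"
proof
  assume "Gam I \<inter> Q = {}"
  then have "Q = {}" using face_hull_Gam[OF assms] by simp
  with assms show False by (auto simp: relevant_faces_def)
qed

lemma sum_count_list_scaleR:
  fixes xs :: "'a::real_vector list"
  assumes "finite X" "set xs \<subseteq> X"
  shows "(\<Sum>x\<in>X. real (count_list xs x) *\<^sub>R x) = sum_list xs"
  using assms(2)
proof (induction xs)
  case (Cons y xs)
  have "(\<Sum>x\<in>X. real (count_list (y # xs) x) *\<^sub>R x) =
      (\<Sum>x\<in>X. (if y = x then x else 0) + real (count_list xs x) *\<^sub>R x)"
    by (rule sum.cong) (auto simp: scaleR_add_left)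
  also have "\<dots> = y + (\<Sum>x\<in>X. real (count_list xs x) *\<^sub>R x)"
    unfolding sum.distrib using Cons.prems assms(1) by (subst sum.delta') auto
  finally show ?case using Cons by simp
qed simp

lemma ell_of_real: "ell r a (\<lambda>j. complex_of_real (f j)) i = of_real (\<Sum>j<r. f j * real (lookup (a j) i))"
  by (simp add: ell_def)

lemma negint_minus_one_add: "(- 1 :: complex) + of_int k \<in> negint \<Longrightarrow> k \<le> 0"
proof -
  assume "(- 1 :: complex) + of_int k \<in> negint"
  then obtain n where "(- 1 :: complex) + of_int k = - of_nat (Suc n)" by (auto simp: negint_def)
  then have "(of_int (- 1 + k) :: complex) = of_int (- int (Suc n))" by simp
  then have "- 1 + k = - int (Suc n)" by (simp only: of_int_eq_iff)
  then show ?thesis by linarith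
qed

text \<open>
  Write \<open>u - e\<close> as a difference of two sums of equally many exponents, the subtracted ones on \<open>Q\<close>,
  and write \<open>u \<in> V\<^sub>Q\<close> as a linear combination \<open>\<Sum>\<^sub>x \<rho>\<^sub>x x\<close> of exponents on \<open>Q\<close>.  Take all exponents
  involved as additional generators and let \<open>z\<^sub>x\<close> be the coefficient of \<open>x\<close> in the first
  expression minus \<open>\<rho>\<^sub>x\<close>.  Then \<open>\<ell>(z) = -e\<close>, so that all coordinates of \<open>\<ell>(z)\<close> are the negative
  integer \<open>-1\<close>, and \<open>\<Sum>\<^sub>x z\<^sub>x = -L\<^sub>Q(u)\<close>.  A translation from \<open>z\<close> would express
  \<open>u - e - v\<^sub>0\<close> as an element of \<open>S\<^sub>Q\<close>, contrary to \<open>u \<notin> M'\<^sub>Q\<close>.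
\<close>

lemma R_face_attained:
  fixes U :: "('n::{finite,linorder} \<Rightarrow>\<^sub>0 nat) set"
  assumes I: "I = ideal_gen (xmonom ` U)" and fin: "finite U"
    and Q: "Q \<in> relevant_faces I" and \<rho>: "\<rho> \<in> R_face I Q"
  shows "\<exists>r a z. 0 < r \<and> I = mono_ideal r a \<and> stuck r a z \<and> (\<Sum>j<r. z j) = complex_of_real \<rho>"
proof -
  have mon: "monomial_ideal I" unfolding I by (rule monomial_ideal_gen)
  let ?L = "L_face Q" and ?e = "(\<chi> i. 1) :: (real, 'n) vec"
  note L = L_face[OF mon Q]
  obtain u where u: "\<rho> = - ?L u" "u \<in> M_face I Q" "u \<notin> M'_face I Q" "u \<in> span Q"
    using \<rho> unfolding R_face_def by blast
  define v0 where "v0 = (SOME v0. v0 \<in> Gam I \<inter> Q)"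
  have v0: "v0 \<in> Gam I \<inter> Q"
    unfolding v0_def some_in_eq by (rule relevant_face_Gam_nonempty[OF Q])
  obtain w where w: "w \<in> S_face I Q" "u = ?e + w" using u(2) by (auto simp: M_face_def)
  have notin: "w - v0 \<notin> S_face I Q"
  proof
    assume "w - v0 \<in> S_face I Q"
    then have "v0 + (?e + (w - v0)) \<in> M'_face I Q"
      unfolding M'_face_def M_face_def v0_def by blast
    with u(3) w(2) show False by (simp add: algebra_simps)
  qed
  obtain us vs where uv: "set us \<subseteq> Gam I" "set vs \<subseteq> Gam I \<inter> Q" "length us = length vs" "w = sum_list us - sum_list vs"
    using S_face_lists[OF w(1)] by blast
  have "Q \<subseteq> span (Gam I \<inter> Q)"
    using face_hull_Gam[OF Q] convex_hull_subset_span by blast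
  then have "u \<in> span (Gam I \<inter> Q)" using u(4) span_minimal[OF _ subspace_span] by blast
  then obtain T c where T: "finite T" "T \<subseteq> Gam I \<inter> Q" "u = (\<Sum>x\<in>T. c x *\<^sub>R x)"
    unfolding real_vector.span_explicit by blast
  define X where "X = expvec ` U \<union> set us \<union> set vs \<union> T"
  have finX: "finite X" using fin T(1) by (simp add: X_def)
  have UI: "xmonom g \<in> I" if "g \<in> U" for g
    unfolding I using that by (intro module.span_base[OF module_mult]) auto
  have XG: "X \<subseteq> Gam I" using uv T(2) UI by (auto simp: X_def Gam_expvec)
  obtain xl where xl: "set xl = X" "distinct xl" using finite_distinct_list[OF finX] by blast
  define r where "r = length xl"
  have "\<forall>x\<in>X. \<exists>g. x = expvec g" using XG by (auto simp: Gam_def)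
  then obtain ex where ex: "\<And>x. x \<in> X \<Longrightarrow> expvec (ex x) = x" by metis
  define a where "a j = ex (xl ! j)" for j
  have xlX: "xl ! j \<in> X" if "j < r" for j using that xl(1) by (auto simp: r_def)
  have ea: "expvec (a j) = xl ! j" if "j < r" for j using ex[OF xlX[OF that]] by (simp add: a_def)
  have la: "real (lookup (a j) i) = (xl ! j) $ i" if "j < r" for i j
    unfolding ea[OF that, symmetric] by simp
  have bij: "bij_betw (\<lambda>j. xl ! j) {..<r} X"
    using bij_betw_nth[OF xl(2) refl] xl(1) by (simp add: r_def)
  have sumX: "(\<Sum>j<r. F (xl ! j)) = (\<Sum>x\<in>X. F x)" for F :: "(real, 'n) vec \<Rightarrow> 'z::comm_monoid_add"
    by (rule sum.reindex_bij_betw[OF bij])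
  have Ia: "I = mono_ideal r a"
  proof
    have "U \<subseteq> a ` {..<r}"
    proof
      fix g assume "g \<in> U"
      then have "expvec g \<in> X" by (simp add: X_def)
      then obtain j where "j < r" "xl ! j = expvec g" using xl(1) by (metis in_set_conv_nth r_def)
      with ea[of j] have "a j = g" by (simp add: expvec_inj)
      with \<open>j < r\<close> show "g \<in> a ` {..<r}" by blast
    qed
    then show "I \<subseteq> mono_ideal r a"
      unfolding I by (intro module.span_mono[OF module_mult] image_mono)
    have "xmonom ` a ` {..<r} \<subseteq> I"
    proof (intro subsetI, elim imageE, simp)
      fix j assume "j < r"
      then have "expvec (a j) \<in> Gam I" using ea xlX XG by auto
      then show "xmonom (a j) \<in> I" by (simp add: Gam_expvec)
    qed
    then show "mono_ideal r a \<subseteq> I"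
      unfolding I by (intro module.span_minimal[OF module_mult] module.subspace_span[OF module_mult])
  qed
  have "v0 \<in> Gam (mono_ideal r a)" using v0 Ia by simp
  then have r0: "0 < r" using Gam_above_generator[of v0 a r] by auto
  define \<rho>' where "\<rho>' x = (if x \<in> T then c x else 0)" for x
  define zr where "zr x = real (count_list us x) - real (count_list vs x) - \<rho>' x" for x
  define z where "z j = complex_of_real (zr (xl ! j))" for j
  have TX: "T \<subseteq> X" and usX: "set us \<subseteq> X" and vsX: "set vs \<subseteq> X" by (auto simp: X_def)
  have \<rho>sum: "(\<Sum>x\<in>X. \<rho>' x *\<^sub>R x) = u"
    unfolding T(3) by (rule sum.mono_neutral_cong_right) (use finX TX in \<open>auto simp: \<rho>'_def\<close>)
  have \<rho>L: "(\<Sum>x\<in>X. \<rho>' x) = ?L u"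
  proof -
    have "?L u = (\<Sum>x\<in>T. c x * ?L x)"
      unfolding T(3) using L(1) by (simp add: linear_sum linear_scale)
    also have "\<dots> = (\<Sum>x\<in>T. c x)" using L(2) T(2) by (intro sum.cong) auto
    also have "\<dots> = (\<Sum>x\<in>X. \<rho>' x)"
      by (rule sum.mono_neutral_cong_left) (use finX TX in \<open>auto simp: \<rho>'_def\<close>)
    finally show ?thesis by simp
  qed
  have zrsum: "(\<Sum>x\<in>X. zr x *\<^sub>R x) = - ?e"
    using sum_count_list_scaleR[OF finX usX] sum_count_list_scaleR[OF finX vsX] \<rho>sum w(2) uv(4)
    by (simp add: zr_def scaleR_diff_left sum_subtractf)
  have ellz: "ell r a z i = - 1" for i
  proof -
    have "ell r a z i = of_real (\<Sum>j<r. zr (xl ! j) * (xl ! j) $ i)"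
      unfolding z_def ell_of_real by (simp add: la)
    also have "(\<Sum>j<r. zr (xl ! j) * (xl ! j) $ i) = (\<Sum>x\<in>X. zr x *\<^sub>R x) $ i"
      unfolding sumX[of "\<lambda>x. zr x * x $ i"] by (simp add: sum_component)
    finally show ?thesis by (simp add: zrsum)
  qed
  have zsum: "(\<Sum>j<r. z j) = complex_of_real \<rho>"
  proof -
    have "(\<Sum>j<r. z j) = of_real (\<Sum>j<r. zr (xl ! j))" by (simp add: z_def)
    also have "(\<Sum>j<r. zr (xl ! j)) = (\<Sum>x\<in>X. zr x)" by (rule sumX)
    also have "\<dots> = real (\<Sum>x\<in>X. count_list us x) - real (\<Sum>x\<in>X. count_list vs x) - ?L u"
      by (simp add: zr_def sum_subtractf \<rho>L)
    also have "\<dots> = \<rho>" using uv(3) by (simp add: sum_count_set[OF usX finX] sum_count_set[OF vsX finX] u(1))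
    finally show ?thesis .
  qed
  have "stuck r a z"
    unfolding stuck_def
  proof
    assume "\<exists>c :: nat \<Rightarrow> int. (\<Sum>j<r. c j) = 1 \<and>
      (\<forall>j<r. z j \<in> \<nat> \<longrightarrow> z j + of_int (c j) \<in> \<nat>) \<and>
      (\<forall>i. ell r a z i \<in> negint \<longrightarrow> ell r a z i + of_int (ell r a c i) \<in> negint)"
    then obtain d :: "nat \<Rightarrow> int" where d: "(\<Sum>j<r. d j) = 1"
      and d1: "\<And>j. j < r \<Longrightarrow> z j \<in> \<nat> \<Longrightarrow> z j + of_int (d j) \<in> \<nat>"
      and d2: "\<And>i. ell r a z i \<in> negint \<Longrightarrow> ell r a z i + of_int (ell r a d i) \<in> negint" by blast
    have m1: "(- 1 :: complex) \<in> negint" unfolding negint_def by (intro CollectI exI[of _ 0]) simp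
    have dneg: "ell r a d i \<le> 0" for i
      using d2[of i] m1 negint_minus_one_add unfolding ellz by blast
    \<comment> \<open>The multiplicities of \<open>\<Sum> us + \<Sum>\<^sub>j d\<^sub>j x\<^sub>j\<close>, which are nonnegative off \<open>Q\<close>; \<open>y = -\<ell>(d)\<close> is a
      vector of natural numbers because \<open>\<ell>(z) + \<ell>(d)\<close> stays negative.\<close>
    define n where "n j = int (count_list us (xl ! j)) + d j" for j
    define y where "y = - (\<Sum>j<r. of_int (d j) *\<^sub>R (xl ! j))"
    have yi: "y $ i = of_int (- ell r a d i)" for i
    proof -
      have "y $ i = - (\<Sum>j<r. of_int (d j) * (xl ! j) $ i)" by (simp add: y_def sum_component)
      also have "(\<Sum>j<r. of_int (d j) * (xl ! j) $ i) = (\<Sum>j<r. of_int (d j) * real (lookup (a j) i))"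
        by (rule sum.cong) (simp_all add: la)
      finally show ?thesis by (simp add: ell_def)
    qed
    have "y $ i \<in> \<nat>" for i
      unfolding yi using dneg[of i] by (metis neg_0_le_iff_le of_int_of_nat_eq of_nat_in_Nats zero_le_imp_eq_int)
    then have y: "y \<in> S_face I Q" by (intro S_face_up[OF mon v0])
    have nS: "of_int (n j) *\<^sub>R (xl ! j - v0) \<in> S_face I Q" if j: "j < r" for j
    proof (cases "0 \<le> n j")
      case True
      then obtain k where "n j = int k" by (metis nonneg_int_cases)
      moreover have "xl ! j - v0 \<in> S_face I Q" using xlX[OF j] XG v0 by (intro S_face_gen) auto
      ultimately show ?thesis using S_face_nat[OF v0] by simp
    next
      case False
      then obtain k where k: "n j = - int k" by (metis int_cases2 of_nat_0_le_iff)
      have "xl ! j \<in> Q"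
      proof (rule ccontr)
        assume nQ: "xl ! j \<notin> Q"
        then have "count_list vs (xl ! j) = 0" "\<rho>' (xl ! j) = 0"
          using uv(2) T(2) by (auto simp: \<rho>'_def count_list_0_iff)
        then have zj: "z j = of_nat (count_list us (xl ! j))" by (simp add: z_def zr_def)
        then have "z j + of_int (d j) \<in> \<nat>" using d1[OF j] by simp
        then obtain l where "of_nat (count_list us (xl ! j)) + of_int (d j) = complex_of_nat l"
          unfolding zj by (auto elim: Nats_cases)
        then have "(of_int (n j) :: complex) = of_int (int l)" by (simp add: n_def)
        then have "n j = int l" by (simp only: of_int_eq_iff)
        with False show False by simp
      qed
      then have "v0 - xl ! j \<in> S_face I Q" using xlX[OF j] XG v0 by (intro S_face_gen) auto
      from S_face_nat[OF v0 this, of k] show ?thesis by (simp add: k algebra_simps)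
    qed
    have vS: "real (length vs) *\<^sub>R v0 - sum_list vs \<in> S_face I Q"
      using uv(2)
    proof (induction vs)
      case (Cons v vs)
      then have "(v0 - v) + (real (length vs) *\<^sub>R v0 - sum_list vs) \<in> S_face I Q"
        using v0 by (intro S_face_add[OF S_face_gen]) auto
      then show ?case by (simp add: algebra_simps)
    qed (simp add: S_face_0[OF v0])
    have A1: "(\<Sum>j<r. of_int (n j) *\<^sub>R (xl ! j - v0)) + (real (length vs) *\<^sub>R v0 - sum_list vs) + y \<in> S_face I Q"
      using nS vS y by (intro S_face_add S_face_sum[OF v0]) auto
    have A2: "(\<Sum>j<r. of_int (n j) *\<^sub>R (xl ! j - v0)) = sum_list us - y - (real (length us) + 1) *\<^sub>R v0"
    proof -
      have s1: "(\<Sum>j<r. real (count_list us (xl ! j)) *\<^sub>R (xl ! j)) = sum_list us"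
        unfolding sumX[of "\<lambda>x. real (count_list us x) *\<^sub>R x"] by (rule sum_count_list_scaleR[OF finX usX])
      have "(\<Sum>j<r. int (count_list us (xl ! j))) = int (length us)"
        unfolding sumX[of "\<lambda>x. int (count_list us x)"] by (simp add: sum_count_set[OF usX finX] flip: of_nat_sum)
      then have "(\<Sum>j<r. n j) = int (length us) + 1" by (simp add: n_def sum.distrib d)
      then have "real_of_int (\<Sum>j<r. n j) = real (length us) + 1" by simp
      then have s2: "(\<Sum>j<r. real_of_int (n j)) = real (length us) + 1" by simp
      have "(\<Sum>j<r. of_int (n j) *\<^sub>R (xl ! j - v0)) =
          (\<Sum>j<r. real (count_list us (xl ! j)) *\<^sub>R (xl ! j)) + (\<Sum>j<r. of_int (d j) *\<^sub>R (xl ! j)) - (\<Sum>j<r. real_of_int (n j)) *\<^sub>R v0"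
        by (simp add: scaleR_diff_right sum_subtractf scaleR_sum_left n_def scaleR_add_left sum.distrib)
      then show ?thesis unfolding s1 s2 by (simp add: y_def)
    qed
    have "w - v0 = (\<Sum>j<r. of_int (n j) *\<^sub>R (xl ! j - v0)) + (real (length vs) *\<^sub>R v0 - sum_list vs) + y"
      unfolding A2 using uv(3,4) by (simp add: algebra_simps)
    with A1 have "w - v0 \<in> S_face I Q" by (simp only:)
    with notin show False ..
  qed
  with r0 Ia zsum show ?thesis by (intro exI conjI)
qed

section \<open>Every stuck point gives an element of some \<open>R\<^sub>Q\<close>\<close>

text \<open>
  A point in the relative interior of the face generated by the \<open>a\<^sub>j\<close> with \<open>j \<in> A\<close> and the
  directions \<open>e\<^sub>i\<close> with \<open>i \<notin> E\<close>.
\<close>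

definition face_center :: "(nat \<Rightarrow> 'n::finite \<Rightarrow>\<^sub>0 nat) \<Rightarrow> nat set \<Rightarrow> 'n set \<Rightarrow> real ^ 'n" where
  "face_center a A E = (1 / real (card A)) *\<^sub>R (\<Sum>j\<in>A. expvec (a j)) + (\<Sum>i\<in>- E. axis i 1)"

definition minimal_face :: "(real ^ 'n) set \<Rightarrow> (nat \<Rightarrow> 'n::finite \<Rightarrow>\<^sub>0 nat) \<Rightarrow> nat set \<Rightarrow> 'n set \<Rightarrow> (real ^ 'n) set" where
  "minimal_face P a A E = {y \<in> P. \<exists>\<epsilon>>0. face_center a A E + \<epsilon> *\<^sub>R (face_center a A E - y) \<in> P}"

lemma face_center_nth:
  "face_center a A E $ i = (1 / real (card A)) * (\<Sum>j\<in>A. real (lookup (a j) i)) + (if i \<in> E then 0 else 1)"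
  by (simp add: face_center_def sum_component axis_def)

lemma newton_combination:
  fixes a :: "nat \<Rightarrow> 'n::{finite,linorder} \<Rightarrow>\<^sub>0 nat"
  assumes A: "A \<subseteq> {..<r}" and c: "\<And>j. j \<in> A \<Longrightarrow> 0 \<le> c j" "(\<Sum>j\<in>A. c j) = 1" and d: "\<And>i. 0 \<le> d $ i"
  shows "(\<Sum>j\<in>A. c j *\<^sub>R expvec (a j)) + d \<in> newton_polyhedron (mono_ideal r a)"
proof (rule newton_up[OF monomial_ideal_gen _ d])
  have "finite A" using finite_subset[OF A] by simp
  then show "(\<Sum>j\<in>A. c j *\<^sub>R expvec (a j)) \<in> newton_polyhedron (mono_ideal r a)"
    using A c Gam_generator Gam_subset_newton by (intro convex_sum newton_convex) blast+
qed

lemma face_center_mem: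
  fixes a :: "nat \<Rightarrow> 'n::{finite,linorder} \<Rightarrow>\<^sub>0 nat"
  assumes A: "A \<subseteq> {..<r}" "A \<noteq> {}"
  shows "face_center a A E \<in> newton_polyhedron (mono_ideal r a)"
proof -
  have "finite A" using finite_subset[OF A(1)] by simp
  then have "card A > 0" using A(2) by auto
  then have "(\<Sum>j\<in>A. (1 / real (card A)) *\<^sub>R expvec (a j)) + (\<Sum>i\<in>- E. axis i 1)
      \<in> newton_polyhedron (mono_ideal r a)"
    by (intro newton_combination[OF A(1)]) (auto simp: sum_component axis_def intro: sum_nonneg)
  then show ?thesis by (simp add: face_center_def scaleR_sum_right)
qed

text \<open>
  Prolonging the segment from the given point beyond the center by a factor \<open>1/|A|\<close> keeps the
  weights of all \<open>a\<^sub>k\<close> and the coordinates outside \<open>E\<close> nonnegative.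
\<close>

lemma minimal_face_mem:
  fixes a :: "nat \<Rightarrow> 'n::{finite,linorder} \<Rightarrow>\<^sub>0 nat"
  assumes A: "A \<subseteq> {..<r}" "j \<in> A" and F: "F = {} \<or> (\<exists>i. F = {i} \<and> i \<notin> E)"
  shows "expvec (a j) + (\<Sum>i\<in>F. axis i 1) \<in> minimal_face (newton_polyhedron (mono_ideal r a)) a A E"
proof -
  let ?P = "newton_polyhedron (mono_ideal r a)"
  let ?x = "expvec (a j) + (\<Sum>i\<in>F. axis i 1)"
  have finA: "finite A" using finite_subset[OF A(1)] by simp
  then have N: "card A > 0" using A(2) by (auto simp: card_gt_0_iff)
  have fF: "finite F" using F by auto
  have FE: "F \<subseteq> - E" using F by auto
  define \<epsilon> where "\<epsilon> = 1 / real (card A)"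
  have e: "\<epsilon> > 0" "\<epsilon> \<le> 1" using N by (auto simp: \<epsilon>_def)
  define c where "c k = (1 + \<epsilon>) * \<epsilon> - (if j = k then \<epsilon> else 0)" for k
  define d where "d = (1 + \<epsilon>) *\<^sub>R (\<Sum>i\<in>- E. axis i 1) - \<epsilon> *\<^sub>R (\<Sum>i\<in>F. axis i 1 :: (real, 'n) vec)"
  have "0 \<le> (\<Sum>i\<in>F. axis i 1 :: (real, 'n) vec) $ k" for k
    by (auto simp: sum_component axis_def intro: sum_nonneg)
  moreover have "expvec (a j) \<in> ?P" using Gam_generator[of j r a] A Gam_subset_newton by blast
  ultimately have "?x \<in> ?P" by (intro newton_up[OF monomial_ideal_gen])
  moreover have "(\<Sum>k\<in>A. c k *\<^sub>R expvec (a k)) + d \<in> ?P"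
  proof (rule newton_combination[OF A(1)])
    show "0 \<le> c k" for k using e by (auto simp: c_def algebra_simps)
    have "(\<Sum>k\<in>A. c k) = real (card A) * ((1 + \<epsilon>) * \<epsilon>) - \<epsilon>"
      using finA A(2) by (simp add: c_def sum_subtractf)
    also have "\<dots> = 1" using N by (simp add: \<epsilon>_def field_simps)
    finally show "(\<Sum>k\<in>A. c k) = 1" .
    fix i
    have "d $ i = (if i \<in> E then 0 else 1 + \<epsilon>) - (if i \<in> F then \<epsilon> else 0)"
      using fF by (simp add: d_def sum_component axis_def)
    then show "0 \<le> d $ i" using FE e by auto
  qed
  moreover have "(\<Sum>k\<in>A. c k *\<^sub>R expvec (a k)) + d = face_center a A E + \<epsilon> *\<^sub>R (face_center a A E - ?x)"
  proof -
    have "(\<Sum>k\<in>A. c k *\<^sub>R expvec (a k)) = (\<Sum>k\<in>A. ((1 + \<epsilon>) * \<epsilon>) *\<^sub>R expvec (a k) - (if j = k then \<epsilon> *\<^sub>R expvec (a k) else 0))"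
      by (rule sum.cong) (auto simp: c_def scaleR_diff_left)
    also have "\<dots> = (1 + \<epsilon>) *\<^sub>R (\<epsilon> *\<^sub>R (\<Sum>k\<in>A. expvec (a k))) - \<epsilon> *\<^sub>R expvec (a j)"
      using finA A(2) by (simp add: sum_subtractf scaleR_sum_right)
    finally show ?thesis
      by (simp add: d_def face_center_def \<epsilon>_def[symmetric] algebra_simps)
  qed
  ultimately show ?thesis unfolding minimal_face_def using e(1) by auto
qed

text \<open>
  A lattice point \<open>v\<close> of the minimal face can be subtracted at the expense of the \<open>a\<^sub>j\<close> with
  \<open>j \<in> A\<close> only, as far as the coordinates in \<open>E\<close> are concerned.  Prolonging the segment from
  \<open>v\<close> beyond the center writes a combination of the center and \<open>-v\<close>, with positive real
  coefficients, as a combination of exponents; \<open>positive_integer_relation\<close> makes the coefficients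
  integers with that of \<open>v\<close> positive.  Exponents that are not generators are finally replaced by
  generators dividing them, which only decreases \<open>\<ell>(c)\<close>.
\<close>

lemma minimal_face_relation:
  fixes a :: "nat \<Rightarrow> 'n::{finite,linorder} \<Rightarrow>\<^sub>0 nat"
  assumes A: "A \<subseteq> {..<r}" "A \<noteq> {}"
    and v: "v \<in> Gam (mono_ideal r a)"
      "v \<in> minimal_face (newton_polyhedron (mono_ideal r a)) a A E"
  shows "\<exists>c :: nat \<Rightarrow> int. (\<Sum>j<r. c j) = - 1 \<and> (\<forall>j<r. j \<notin> A \<longrightarrow> 0 \<le> c j) \<and> (\<forall>i\<in>E. real_of_int (ell r a c i) \<le> - v $ i)"
proof -
  let ?I = "mono_ideal r a"
  let ?p = "face_center a A E"
  have finA: "finite A" using finite_subset[OF A(1)] by simp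
  then have N: "card A > 0" using A(2) by auto
  from v(2) obtain \<epsilon> where e: "\<epsilon> > 0" "?p + \<epsilon> *\<^sub>R (?p - v) \<in> newton_polyhedron ?I" unfolding minimal_face_def by blast
  then obtain W t where W: "finite W" "W \<subseteq> Gam ?I" "\<And>x. x \<in> W \<Longrightarrow> 0 \<le> t x" "sum t W = 1"
      "(\<Sum>x\<in>W. t x *\<^sub>R x) = ?p + \<epsilon> *\<^sub>R (?p - v)"
    unfolding newton_polyhedron_def convex_hull_explicit by blast
  have "\<forall>x\<in>Gam ?I. \<exists>u. x = expvec u" by (auto simp: Gam_def)
  then obtain ex where ex: "\<And>x. x \<in> Gam ?I \<Longrightarrow> x = expvec (ex x)" by metis
  have exi: "real (lookup (ex x) i) = x $ i" if "x \<in> Gam ?I" for x i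
    using arg_cong[OF ex[OF that], of "\<lambda>x. x $ i"] by simp
  have "\<forall>x\<in>Gam ?I. \<exists>j. j < r \<and> (\<forall>i. real (lookup (a j) i) \<le> x $ i)"
    using Gam_above_generator by blast
  then obtain g where g: "\<And>x. x \<in> Gam ?I \<Longrightarrow> g x < r" "\<And>x i. x \<in> Gam ?I \<Longrightarrow> real (lookup (a (g x)) i) \<le> x $ i"
    by metis
  \<comment> \<open>The real relation says \<open>\<Sum>\<^sub>x t\<^sub>x x + \<epsilon> v = (1 + \<epsilon>) p\<close> in the coordinates of \<open>E\<close>, and equality
    of the total weights.  Its terms are indexed by \<open>None\<close> for the sum of the \<open>a\<^sub>j\<close> with
    \<open>j \<in> A\<close>, by \<open>Some None\<close> for \<open>v\<close>, and by \<open>Some (Some x)\<close> for \<open>x \<in> W\<close>, even if \<open>v \<in> W\<close>.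
    Its equations are indexed by \<open>None\<close> for the weights and by \<open>Some i\<close> for \<open>i \<in> E\<close>.\<close>
  define S where "S = insert None (insert (Some None) ((\<lambda>x. Some (Some x)) ` W))"
  define \<theta> where "\<theta> s = (case s of None \<Rightarrow> (1 + \<epsilon>) / real (card A) | Some None \<Rightarrow> \<epsilon> | Some (Some x) \<Rightarrow> t x)" for s
  define co where "co i x = (case i of None \<Rightarrow> 1 | Some i \<Rightarrow> int (lookup (ex x) i))" for i x
  define m where "m i s = (case s of
      None \<Rightarrow> - (\<Sum>j\<in>A. (case i of None \<Rightarrow> 1 | Some i \<Rightarrow> int (lookup (a j) i)))
    | Some None \<Rightarrow> co i v | Some (Some x) \<Rightarrow> co i x)" for i s
  have sumS: "(\<Sum>s\<in>S. F s) = F None + F (Some None) + (\<Sum>x\<in>W. F (Some (Some x)))" for F :: "((real, 'n) vec) option option \<Rightarrow> 'z::comm_monoid_add"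
  proof -
    have "(\<Sum>s\<in>(\<lambda>x. Some (Some x)) ` W. F s) = (\<Sum>x\<in>W. F (Some (Some x)))"
      by (subst sum.reindex) (auto simp: inj_on_def)
    moreover have "finite ((\<lambda>x. Some (Some x)) ` W)" using W(1) by simp
    ultimately show ?thesis unfolding S_def by (subst sum.insert, (auto)[2], subst sum.insert) (auto simp: ac_simps)
  qed
  have rel: "(\<Sum>s\<in>S. \<theta> s * of_int (m i s)) = 0" if i: "i \<in> insert None (Some ` E)" for i
  proof (cases i)
    case None
    have "(\<Sum>s\<in>S. \<theta> s * of_int (m i s)) = - ((1 + \<epsilon>) / real (card A) * real (card A)) + \<epsilon> + 1"
      by (simp add: sumS \<theta>_def m_def co_def None W(4))
    then show ?thesis using N by simp
  next
    case (Some i')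
    with i have iE: "i' \<in> E" by auto
    have "(\<Sum>x\<in>W. t x * x $ i') = (?p + \<epsilon> *\<^sub>R (?p - v)) $ i'"
      unfolding W(5)[symmetric] by (simp add: sum_component)
    also have "\<dots> = (1 + \<epsilon>) / real (card A) * (\<Sum>j\<in>A. real (lookup (a j) i')) - \<epsilon> * v $ i'"
      using iE by (simp add: face_center_nth) (simp add: algebra_simps add_divide_distrib)
    finally have "(\<Sum>x\<in>W. t x * x $ i') = (1 + \<epsilon>) / real (card A) * (\<Sum>j\<in>A. real (lookup (a j) i')) - \<epsilon> * v $ i'" .
    moreover have "(\<Sum>x\<in>W. t x * real (lookup (ex x) i')) = (\<Sum>x\<in>W. t x * x $ i')"
      using W(2) exi by (intro sum.cong) auto
    ultimately show ?thesis
      by (simp add: sumS \<theta>_def m_def co_def Some exi[OF v(1)])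
  qed
  have "\<exists>q. 0 < q (Some None) \<and> (\<forall>i\<in>insert None (Some ` E). (\<Sum>s\<in>S. int (q s) * m i s) = 0)"
  proof (rule positive_integer_relation[where \<theta> = \<theta>])
    show "finite S" using W(1) by (simp add: S_def)
    show "0 \<le> \<theta> s" if "s \<in> S" for s using that e(1) W(3) by (auto simp: S_def \<theta>_def)
    show "Some None \<in> S" "0 < \<theta> (Some None)" using e(1) by (auto simp: S_def \<theta>_def)
  qed (use rel in auto)
  then obtain q :: "((real, 'n) vec) option option \<Rightarrow> nat" where q: "0 < q (Some None)"
    and qr: "\<And>i. i \<in> insert None (Some ` E) \<Longrightarrow> (\<Sum>s\<in>S. int (q s) * m i s) = 0" by blast
  define M where "M = int (q None)"
  define n where "n x = int (q (Some (Some x)))" for x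
  \<comment> \<open>One copy of \<open>v\<close> goes to the other side of the relation; the other \<open>l\<close> copies stay and are
    replaced by a generator.\<close>
  define l where "l = int (q (Some None)) - 1"
  have l0: "0 \<le> l" using q by (simp add: l_def)
  have r0: "(\<Sum>x\<in>W. n x) = M * int (card A) - l - 1"
    using qr[of None] by (simp add: sumS m_def co_def M_def n_def l_def)
  have ri: "(\<Sum>x\<in>W. n x * int (lookup (ex x) i)) = M * (\<Sum>j\<in>A. int (lookup (a j) i)) - (l + 1) * int (lookup (ex v) i)"
    if "i \<in> E" for i
    using qr[of "Some i"] that by (simp add: sumS m_def co_def M_def n_def l_def)
  define c where "c j = l * (if j = g v then 1 else 0) + (\<Sum>x\<in>W. n x * (if j = g x then 1 else 0)) - M * (if j \<in> A then 1 else 0)" for j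
  have sumc: "(\<Sum>j<r. c j * f j) = l * f (g v) + (\<Sum>x\<in>W. n x * f (g x)) - M * (\<Sum>j\<in>A. f j)" for f :: "nat \<Rightarrow> int"
  proof -
    have d: "(\<Sum>j<r. (if j = k then 1 else 0) * f j) = f k" if "k < r" for k
      using that by (subst sum.remove[of _ k]) auto
    have "(\<Sum>j<r. (\<Sum>x\<in>W. n x * (if j = g x then 1 else 0)) * f j) = (\<Sum>x\<in>W. n x * (\<Sum>j<r. (if j = g x then 1 else 0) * f j))"
      unfolding sum_distrib_left sum_distrib_right by (subst sum.swap) (simp add: mult.assoc)
    also have "\<dots> = (\<Sum>x\<in>W. n x * f (g x))" 
    proof (intro sum.cong refl)
      fix x assume "x \<in> W"
      then have "g x < r" using W(2) g(1) by blast
      then show "n x * (\<Sum>j<r. (if j = g x then 1 else 0) * f j) = n x * f (g x)" by (simp only: d)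
    qed
    finally have s1: "(\<Sum>j<r. (\<Sum>x\<in>W. n x * (if j = g x then 1 else 0)) * f j) = (\<Sum>x\<in>W. n x * f (g x))" .
    have s2: "(\<Sum>j<r. (if j \<in> A then 1 else 0) * f j) = (\<Sum>j\<in>A. f j)"
      using A(1) by (intro sum.mono_neutral_cong_right) auto
    have "(\<Sum>j<r. c j * f j) = l * (\<Sum>j<r. (if j = g v then 1 else 0) * f j)
       + (\<Sum>j<r. (\<Sum>x\<in>W. n x * (if j = g x then 1 else 0)) * f j) - M * (\<Sum>j<r. (if j \<in> A then 1 else 0) * f j)"
      unfolding c_def by (simp only: sum_distrib_left left_diff_distrib distrib_right sum.distrib sum_subtractf mult.assoc)
    then show ?thesis unfolding s1 s2 d[OF g(1)[OF v(1)]] .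
  qed
  have "(\<Sum>j<r. c j) = - 1" using sumc[of "\<lambda>_. 1"] r0 by simp
  moreover have "0 \<le> c j" if "j \<notin> A" for j
    unfolding c_def using l0 that by (auto simp: n_def intro!: add_nonneg_nonneg sum_nonneg)
  moreover have "real_of_int (ell r a c i) \<le> - v $ i" if i: "i \<in> E" for i
  proof -
    have gl: "lookup (a (g x)) i \<le> lookup (ex x) i" if "x \<in> Gam ?I" for x
      using g(2)[OF that, of i] exi[OF that, of i] by linarith
    have "ell r a c i = l * int (lookup (a (g v)) i) + (\<Sum>x\<in>W. n x * int (lookup (a (g x)) i)) - M * (\<Sum>j\<in>A. int (lookup (a j) i))"
      unfolding ell_def using sumc[of "\<lambda>j. int (lookup (a j) i)"] by simp
    also have "\<dots> \<le> l * int (lookup (ex v) i) + (\<Sum>x\<in>W. n x * int (lookup (ex x) i)) - M * (\<Sum>j\<in>A. int (lookup (a j) i))"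
      using l0 gl[OF v(1)] gl W(2) by (intro diff_right_mono add_mono mult_left_mono sum_mono) (auto simp: n_def)
    also have "\<dots> = - int (lookup (ex v) i)" using ri[OF i] by (simp add: algebra_simps)
    finally show ?thesis using exi[OF v(1), of i] by linarith
  qed
  ultimately show ?thesis by (intro exI[of _ c] conjI allI ballI impI)
qed

text \<open>
  For a generator \<open>u - v\<close> of \<open>S\<^sub>Q\<close>, add to the translation for \<open>v\<close> a generator that divides \<open>x\<^sup>u\<close>.
\<close>

lemma S_face_relation:
  fixes a :: "nat \<Rightarrow> 'n::{finite,linorder} \<Rightarrow>\<^sub>0 nat"
  assumes A: "A \<subseteq> {..<r}" "A \<noteq> {}"
    and w: "w \<in> S_face (mono_ideal r a)
      (minimal_face (newton_polyhedron (mono_ideal r a)) a A E)"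
  shows "\<exists>c :: nat \<Rightarrow> int. (\<Sum>j<r. c j) = 0 \<and> (\<forall>j<r. j \<notin> A \<longrightarrow> 0 \<le> c j) \<and> (\<forall>i\<in>E. real_of_int (ell r a c i) \<le> w $ i)"
  using w unfolding S_face_def
proof (induction rule: subsemigroup_gen.induct)
  case (gen w)
  then obtain u v where w: "w = u - v" and u: "u \<in> Gam (mono_ideal r a)"
    and v: "v \<in> Gam (mono_ideal r a)"
      "v \<in> minimal_face (newton_polyhedron (mono_ideal r a)) a A E"
    by blast
  obtain k where k: "k < r" "\<And>i. real (lookup (a k) i) \<le> u $ i"
    using Gam_above_generator[OF u] by blast
  obtain c :: "nat \<Rightarrow> int" where c: "(\<Sum>j<r. c j) = - 1" "\<And>j. j < r \<Longrightarrow> j \<notin> A \<Longrightarrow> 0 \<le> c j"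
    "\<And>i. i \<in> E \<Longrightarrow> real_of_int (ell r a c i) \<le> - v $ i"
    using minimal_face_relation[OF A v] by blast
  let ?c = "\<lambda>j. (if j = k then 1 else 0) + c j"
  have "(\<Sum>j<r. ?c j) = 0" using k(1) c(1) by (simp add: sum.distrib)
  moreover have "0 \<le> ?c j" if "j < r" "j \<notin> A" for j using c(2)[OF that] by auto
  moreover have "real_of_int (ell r a ?c i) \<le> w $ i" if "i \<in> E" for i
    using c(3)[OF that] k(2)[of i] by (simp add: ell_add ell_delta[OF k(1)] w)
  ultimately show ?case by (intro exI[of _ ?c] conjI allI ballI impI)
next
  case (add x y)
  then obtain c d :: "nat \<Rightarrow> int" where c: "(\<Sum>j<r. c j) = 0" "\<And>j. j < r \<Longrightarrow> j \<notin> A \<Longrightarrow> 0 \<le> c j"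
      "\<And>i. i \<in> E \<Longrightarrow> real_of_int (ell r a c i) \<le> x $ i"
    and d: "(\<Sum>j<r. d j) = 0" "\<And>j. j < r \<Longrightarrow> j \<notin> A \<Longrightarrow> 0 \<le> d j"
      "\<And>i. i \<in> E \<Longrightarrow> real_of_int (ell r a d i) \<le> y $ i"
    by blast
  let ?c = "\<lambda>j. c j + d j"
  have "(\<Sum>j<r. ?c j) = 0" using c(1) d(1) by (simp add: sum.distrib)
  moreover have "0 \<le> ?c j" if "j < r" "j \<notin> A" for j using c(2)[OF that] d(2)[OF that] by simp
  moreover have "real_of_int (ell r a ?c i) \<le> (x + y) $ i" if "i \<in> E" for i
    using c(3)[OF that] d(3)[OF that] by (simp add: ell_add)
  ultimately show ?case by (intro exI[of _ ?c] conjI allI ballI impI)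
qed

text \<open>
  Let \<open>k\<^sub>j\<close> be the natural numbers among the \<open>z\<^sub>j\<close>, \<open>K\<close> their sum and \<open>\<sigma> = \<Sum>\<^sub>j k\<^sub>j a\<^sub>j\<close>, and let \<open>y\<close> be
  the vector that is \<open>-\<ell>\<^sub>i(z) - 1 \<in> \<nat>\<close> in the coordinates of \<open>E\<close> and zero elsewhere.  Then
  \<open>u = e + \<sigma> + y - K v\<^sub>0\<close> lies in \<open>M\<^sub>Q\<close>.  By the choice of \<open>y\<close>, the coordinates in \<open>E\<close> of \<open>u + K v\<^sub>0\<close>
  and of \<open>-\<Sum>\<^sub>j\<^sub>\<in>\<^sub>A z\<^sub>j a\<^sub>j\<close> agree, and \<open>Q\<close> contains all directions \<open>e\<^sub>i\<close> with \<open>i \<notin> E\<close>; hence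
  \<open>u \<in> V\<^sub>Q\<close> and \<open>L\<^sub>Q(u) = -\<Sum>\<^sub>j z\<^sub>j\<close>.  The imaginary parts of the \<open>z\<^sub>j\<close> are treated in the same way
  and cancel.
\<close>

lemma stuck_in_R_face:
  fixes a :: "nat \<Rightarrow> 'n::{finite,linorder} \<Rightarrow>\<^sub>0 nat"
  assumes r: "0 < r" and I: "I = mono_ideal r a" and st: "stuck r a z"
  shows "\<exists>Q\<in>relevant_faces I. \<exists>\<rho>\<in>R_face I Q. (\<Sum>j<r. z j) = complex_of_real \<rho>"
proof -
  have mon: "monomial_ideal I" unfolding I by (rule monomial_ideal_gen)
  let ?e = "(\<chi> i. 1) :: (real, 'n) vec"
  define A where "A = {j. j < r \<and> z j \<notin> \<nat>}"
  define E where "E = {i. ell r a z i \<in> negint}"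
  have "\<forall>j. \<exists>n. j < r \<longrightarrow> z j \<in> \<nat> \<longrightarrow> z j = of_nat n" by (metis Nats_cases)
  then obtain k' where k': "\<And>j. j < r \<Longrightarrow> z j \<in> \<nat> \<Longrightarrow> z j = of_nat (k' j)" by metis
  define k where "k j = (if j \<in> A then 0 else k' j)" for j
  have kz: "z j = of_nat (k j)" if "j < r" "j \<notin> A" for j using k'[of j] that by (auto simp: k_def A_def)
  have Ar: "A \<subseteq> {..<r}" by (auto simp: A_def)
  have finA: "finite A" using finite_subset[OF Ar] by simp
  have stuckD: False if c1: "(\<Sum>j<r. c j) = 1" and c2: "\<And>j. j < r \<Longrightarrow> j \<notin> A \<Longrightarrow> 0 \<le> int (k j) + c j"
    and c3: "\<And>i. i \<in> E \<Longrightarrow> ell r a z i + of_int (ell r a c i) \<in> negint" for c :: "nat \<Rightarrow> int"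
  proof -
    have "z j + of_int (c j) \<in> \<nat>" if j: "j < r" "z j \<in> \<nat>" for j
    proof -
      have jA: "j \<notin> A" using j by (simp add: A_def)
      from c2[OF j(1) jA] have "\<exists>l. int (k j) + c j = int l" by (metis nonneg_int_cases)
      then obtain l where l: "int (k j) + c j = int l" ..
      have "z j + of_int (c j) = of_int (int (k j) + c j)" using kz[OF j(1) jA] by simp
      then show ?thesis unfolding l by simp
    qed
    with c1 c3 st show False unfolding stuck_def E_def by blast
  qed
  have An: "A \<noteq> {}"
  proof
    assume A0: "A = {}"
    have "ell r a z i \<in> \<nat>" for i by (rule ell_Nats) (use A0 in \<open>auto simp: A_def\<close>)
    then have "E = {}" using negint_not_Nats by (auto simp: E_def)
    then show False using stuckD[of "\<lambda>j. if j = 0 then 1 else 0"] r by auto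
  qed
  define Q where "Q = minimal_face (newton_polyhedron I) a A E"
  have Qface: "Q face_of newton_polyhedron I"
    unfolding Q_def minimal_face_def using face_center_mem[OF Ar An, of a E] I
    by (intro face_generated_by_point newton_convex) simp
  have aQ: "expvec (a j) \<in> Q" if "j \<in> A" for j
    using minimal_face_mem[OF Ar that, of "{}" E a] by (simp add: Q_def I)
  have aiQ: "expvec (a j) + axis i 1 \<in> Q" if "j \<in> A" "i \<notin> E" for i j
    using minimal_face_mem[OF Ar that(1), of "{i}" E a] that(2) by (simp add: Q_def I)
  have aG: "expvec (a j) \<in> Gam I" if "j < r" for j unfolding I by (rule Gam_generator[OF that])
  define v0 where "v0 = (SOME v0. v0 \<in> Gam I \<inter> Q)"
  have v0: "v0 \<in> Gam I \<inter> Q"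
    unfolding v0_def some_in_eq using An aQ aG Ar by blast
  define K where "K = (\<Sum>j<r. k j)"
  define \<sigma> where "\<sigma> = (\<Sum>j<r. real (k j) *\<^sub>R expvec (a j))"
  define y :: "(real, 'n) vec" where "y = (\<chi> i. if i \<in> E then - Re (ell r a z i) - 1 else 0)"
  have ellE: "\<exists>n. ell r a z i = - of_nat (Suc n) \<and> y $ i = real n" if "i \<in> E" for i
    using that by (auto simp: E_def negint_def y_def)
  have yN: "y $ i \<in> \<nat>" for i
    using ellE[of i] by (cases "i \<in> E") (auto simp: y_def)
  define w where "w = \<sigma> + y - real K *\<^sub>R v0"
  have wS: "w \<in> S_face I Q"
  proof -
    have "w = (\<Sum>j<r. real (k j) *\<^sub>R (expvec (a j) - v0)) + y"
      by (simp add: w_def \<sigma>_def K_def scaleR_diff_right sum_subtractf scaleR_sum_left)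
    moreover have "real (k j) *\<^sub>R (expvec (a j) - v0) \<in> S_face I Q" if "j < r" for j
      using aG[OF that] v0 by (intro S_face_nat S_face_gen) auto
    ultimately show ?thesis using S_face_up[OF mon v0 yN] by (auto intro!: S_face_add S_face_sum[OF v0])
  qed
  have notM: "w - v0 \<notin> S_face I Q"
  proof
    assume "w - v0 \<in> S_face I Q"
    then obtain c :: "nat \<Rightarrow> int" where c: "(\<Sum>j<r. c j) = 0" "\<And>j. j < r \<Longrightarrow> j \<notin> A \<Longrightarrow> 0 \<le> c j"
      "\<And>i. i \<in> E \<Longrightarrow> real_of_int (ell r a c i) \<le> (w - v0) $ i"
      using S_face_relation[OF Ar An, of "w - v0" a E] unfolding Q_def I by blast
    have "v0 \<in> Gam (mono_ideal r a)" using v0 I by simp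
    then obtain g where g: "g < r" "\<And>i. real (lookup (a g) i) \<le> v0 $ i"
      using Gam_above_generator by blast
    \<comment> \<open>Undo the definition of \<open>w - v\<^sub>0\<close>: remove the \<open>k\<^sub>j\<close> copies of \<open>a\<^sub>j\<close> and put back \<open>K + 1\<close> copies
      of \<open>v\<^sub>0\<close>, replaced by a generator below it.\<close>
    let ?d = "\<lambda>j. c j + ((if j = g then int K + 1 else 0) + - int (k j))"
    show False
    proof (rule stuckD[of ?d])
      show "(\<Sum>j<r. ?d j) = 1"
        using c(1) g(1) by (simp add: sum.distrib sum_subtractf K_def)
      show "0 \<le> int (k j) + ?d j" if "j < r" "j \<notin> A" for j using c(2)[OF that] by simp
      fix i assume i: "i \<in> E"
      obtain n where n: "ell r a z i = - of_nat (Suc n)" "y $ i = real n" using ellE[OF i] by blast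
      have s: "real_of_int (ell r a (\<lambda>j. - int (k j)) i) = - \<sigma> $ i"
        by (simp add: ell_def \<sigma>_def sum_component sum_negf)
      have e1: "ell r a ?d i = ell r a c i + (ell r a (\<lambda>j. if j = g then int K + 1 else 0) i + ell r a (\<lambda>j. - int (k j)) i)"
        by (simp only: ell_add)
      have "real_of_int (ell r a ?d i) = real_of_int (ell r a c i) + (real K + 1) * real (lookup (a g) i) - \<sigma> $ i"
        unfolding e1 of_int_add s ell_delta[OF g(1)] by simp
      also have "\<dots> \<le> (w - v0) $ i + (real K + 1) * v0 $ i - \<sigma> $ i"
      proof -
        have "(real K + 1) * real (lookup (a g) i) \<le> (real K + 1) * v0 $ i"
          by (intro mult_left_mono g(2)) simp
        with c(3)[OF i] show ?thesis by linarith
      qed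
      also have "\<dots> = real n" by (simp add: w_def n(2)[symmetric] algebra_simps)
      finally have "ell r a ?d i \<le> int n" by linarith
      then have l: "ell r a ?d i = int n - int (nat (int n - ell r a ?d i))" (is "_ = int n - int ?l") by simp
      have "ell r a z i + of_int (ell r a ?d i) = - of_nat (Suc ?l)"
        unfolding n(1) by (subst l) simp
      then show "ell r a z i + of_int (ell r a ?d i) \<in> negint" unfolding negint_def by blast
    qed
  qed
  have ReE: "\<sigma> $ i = Re (ell r a z i) - (\<Sum>j\<in>A. Re (z j) *\<^sub>R expvec (a j)) $ i" for i
  proof -
    have "Re (ell r a z i) = (\<Sum>j<r. Re (z j) * real (lookup (a j) i))" by (simp add: ell_def)
    also have "\<dots> = (\<Sum>j<r. (if j \<in> A then Re (z j) * real (lookup (a j) i) else 0) + real (k j) * real (lookup (a j) i))"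
      by (rule sum.cong) (auto simp: kz k_def)
    also have "\<dots> = (\<Sum>j\<in>A. Re (z j) * real (lookup (a j) i)) + \<sigma> $ i"
      using Ar by (simp add: sum.distrib \<sigma>_def sum_component sum.If_cases Int_absorb1)
    finally show ?thesis by (simp add: sum_component)
  qed
  define u where "u = ?e + w"
  define x1 where "x1 = (\<Sum>j\<in>A. Re (z j) *\<^sub>R expvec (a j))"
  define x2 where "x2 = (\<Sum>j\<in>A. Im (z j) *\<^sub>R expvec (a j))"
  have uE: "(u + x1 + real K *\<^sub>R v0) $ i = 0" if "i \<in> E" for i
    using that by (simp add: u_def w_def ReE y_def x1_def)
  have x2E: "x2 $ i = 0" if "i \<in> E" for i
  proof -
    have "Im (ell r a z i) = (\<Sum>j<r. Im (z j) * real (lookup (a j) i))" by (simp add: ell_def)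
    also have "\<dots> = (\<Sum>j\<in>A. Im (z j) * real (lookup (a j) i))"
      by (rule sum.mono_neutral_right) (use Ar in \<open>auto simp: kz\<close>)
    finally show ?thesis using ellE[OF that] by (auto simp: x2_def sum_component)
  qed
  have expand: "x = (\<Sum>i\<in>- E. x $ i *\<^sub>R axis i 1)" if "\<And>i. i \<in> E \<Longrightarrow> x $ i = 0" for x :: "(real, 'n) vec"
  proof -
    have "x = (\<Sum>i\<in>UNIV. x $ i *\<^sub>R axis i 1)" using basis_expansion[of x] by (simp add: scalar_mult_eq_scaleR)
    also have "\<dots> = (\<Sum>i\<in>- E. x $ i *\<^sub>R axis i 1)" by (rule sum.mono_neutral_right) (use that in auto)
    finally show ?thesis .
  qed
  obtain j0 where j0: "j0 \<in> A" using An by blast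
  have axQ: "axis i 1 \<in> span Q" if "i \<notin> E" for i
    using span_diff[OF span_base[OF aiQ[OF j0 that]] span_base[OF aQ[OF j0]]] by simp
  have uspan: "u \<in> span Q"
  proof -
    have "u + x1 + real K *\<^sub>R v0 \<in> span Q"
      by (subst expand[OF uE], assumption) (intro span_sum span_scale axQ, simp)
    moreover have "x1 + real K *\<^sub>R v0 \<in> span Q"
      unfolding x1_def using v0 aQ by (intro span_add span_sum span_scale span_base) auto
    ultimately show ?thesis using span_diff[of "u + x1 + real K *\<^sub>R v0" Q "x1 + real K *\<^sub>R v0"] by (simp add: algebra_simps)
  qed
  have rel: "Q \<in> relevant_faces I"
    unfolding relevant_faces_def
  proof (intro CollectI conjI notI)
    show "Q face_of newton_polyhedron I" by (rule Qface)
    assume QP: "Q = newton_polyhedron I"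
    \<comment> \<open>If \<open>Q\<close> were the whole polyhedron, \<open>2 v\<^sub>0\<close> would lie on it and \<open>-v\<^sub>0\<close> would belong to \<open>S\<^sub>Q\<close>.\<close>
    have vG: "v0 + v0 \<in> Gam I" using v0 by (intro Gam_up_vec[OF mon]) (auto simp: Gam_def)
    then have "v0 - (v0 + v0) \<in> S_face I Q" using v0 Gam_subset_newton[of I] QP by (intro S_face_gen) auto
    from S_face_add[OF wS this] notM show False by simp
  next
    assume "\<exists>i. Q \<subseteq> {x. x $ i = 0}"
    then obtain i where i: "\<And>x. x \<in> Q \<Longrightarrow> x $ i = 0" by blast
    have z0: "real (lookup (a j) i) = 0" if "j \<in> A" for j using i[OF aQ[OF that]] by simp
    have iE: "i \<in> E"
    proof (rule ccontr)
      assume "i \<notin> E"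
      from i[OF aiQ[OF j0 this]] z0[OF j0] show False by (simp add: axis_def)
    qed
    have "z j * of_nat (lookup (a j) i) = (if j \<in> A then 0 else z j) * of_nat (lookup (a j) i)" for j
      using z0[of j] by simp
    then have "ell r a z i = ell r a (\<lambda>j. if j \<in> A then 0 else z j) i"
      unfolding ell_def by (intro sum.cong refl)
    also have "\<dots> \<in> \<nat>" by (rule ell_Nats) (simp add: kz)
    finally have "ell r a z i \<in> \<nat>" .
    with iE negint_not_Nats show False by (auto simp: E_def)
  qed
  note L = L_face[OF mon rel]
  let ?L = "L_face Q"
  have Lax: "?L (axis i 1) = 0" if "i \<notin> E" for i
  proof -
    have "?L (expvec (a j0) + axis i 1) = ?L (expvec (a j0)) + ?L (axis i 1)" by (rule linear_add[OF L(1)])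
    then show ?thesis using L(2)[OF aiQ[OF j0 that]] L(2)[OF aQ[OF j0]] by simp
  qed
  have L0: "?L x = 0" if "\<And>i. i \<in> E \<Longrightarrow> x $ i = 0" for x
  proof -
    have "?L x = ?L (\<Sum>i\<in>- E. x $ i *\<^sub>R axis i 1)" using expand[OF that] by (rule arg_cong)
    also have "\<dots> = (\<Sum>i\<in>- E. x $ i *\<^sub>R ?L (axis i 1))" by (simp add: linear_sum[OF L(1)] linear_scale[OF L(1)])
    also have "\<dots> = 0" by (rule sum.neutral) (simp add: Lax)
    finally show ?thesis .
  qed
  have LA: "?L (\<Sum>j\<in>A. f j *\<^sub>R expvec (a j)) = (\<Sum>j\<in>A. f j)" for f
    by (simp add: linear_sum[OF L(1)] linear_scale[OF L(1)] L(2)[OF aQ])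
  have "?L (u + x1 + real K *\<^sub>R v0) = 0" by (rule L0[OF uE])
  then have Lu: "?L u = - (\<Sum>j\<in>A. Re (z j)) - real K"
    using v0 by (simp add: linear_add[OF L(1)] linear_scale[OF L(1)] L(2) x1_def LA)
  have Im0: "(\<Sum>j\<in>A. Im (z j)) = 0"
    using L0[OF x2E] by (simp add: x2_def LA)
  have "(\<Sum>j<r. z j) = (\<Sum>j<r. (if j \<in> A then z j else 0) + of_nat (k j))"
    by (rule sum.cong) (auto simp: kz k_def)
  also have "\<dots> = (\<Sum>j\<in>A. z j) + of_nat K"
    using Ar by (simp add: sum.distrib K_def sum.If_cases Int_absorb1)
  also have "\<dots> = complex_of_real (- ?L u)"
    using Im0 by (simp add: complex_eq_iff Lu)
  finally have "(\<Sum>j<r. z j) = complex_of_real (- ?L u)" .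
  moreover have "- ?L u \<in> R_face I Q"
  proof -
    have "u \<in> M_face I Q" using wS by (auto simp: M_face_def u_def)
    moreover have "u \<notin> M'_face I Q"
    proof
      assume "u \<in> M'_face I Q"
      then obtain w' where "w' \<in> S_face I Q" "u = v0 + (?e + w')"
        unfolding M'_face_def M_face_def v0_def by blast
      then show False using notM by (simp add: u_def algebra_simps)
    qed
    ultimately show ?thesis using uspan unfolding R_face_def by blast
  qed
  ultimately show ?thesis using rel by blast
qed

section \<open>The roots of the Bernstein-Sato polynomial\<close>

lemma ideal_gen_family:
  assumes "p \<in> ideal_gen (f ` {..<r :: nat})"
  shows "\<exists>k. p = (\<Sum>i<r. k i * f i)"
proof -
  let ?S = "{p. \<exists>k. p = (\<Sum>i<r. k i * f i)}"
  have "module.subspace (*) ?S"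
    unfolding module.subspace_def[OF module_mult]
  proof (intro conjI ballI allI)
    show "0 \<in> ?S" by (intro CollectI exI[of _ "\<lambda>_. 0"]) simp
    fix p q assume "p \<in> ?S" "q \<in> ?S"
    then obtain k l where "p = (\<Sum>i<r. k i * f i)" "q = (\<Sum>i<r. l i * f i)" by blast
    then show "p + q \<in> ?S" by (intro CollectI exI[of _ "\<lambda>i. k i + l i"]) (simp add: distrib_right sum.distrib)
  next
    fix c p assume "p \<in> ?S"
    then obtain k where "p = (\<Sum>i<r. k i * f i)" by blast
    then show "c * p \<in> ?S" by (intro CollectI exI[of _ "\<lambda>i. c * k i"]) (simp add: sum_distrib_left mult.assoc)
  qed
  moreover have "f j \<in> ?S" if "j < r" for j
    using that by (intro CollectI exI[of _ "\<lambda>i. if i = j then 1 else 0"]) (subst sum.remove[of _ j], auto)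
  then have "f ` {..<r} \<subseteq> ?S" by blast
  ultimately show ?thesis using module.span_minimal[OF module_mult, of "f ` {..<r}" ?S] assms by blast
qed

text \<open>
  This is where the independence of the Bernstein-Sato polynomial from the generators enters.
\<close>

lemma model_relation_same_ideal:
  assumes f0: "\<And>j. j \<ge> r \<Longrightarrow> f j = 0" and g0: "\<And>j. j \<ge> l \<Longrightarrow> g j = 0"
    and eq: "ideal_gen (f ` {..<r}) = ideal_gen (g ` {..<l})" and r: "0 < r"
    and rel: "model_relation l g b"
  shows "model_relation r f b"
proof -
  have "\<exists>h. f j = (\<Sum>b<l. h b * g b)" if "j < r" for j
    using that eq by (intro ideal_gen_family) (auto intro!: module.span_base[OF module_mult] simp flip: eq)
  then obtain h where h: "\<And>j. j < r \<Longrightarrow> f j = (\<Sum>b<l. h j b * g b)" by metis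
  let ?h = "\<lambda>j b. if j < r then h j b else 0"
  have gf: "\<exists>k. g j = (\<Sum>i<r. k i * f i)" for j
  proof (cases "j < l")
    case True
    then show ?thesis by (intro ideal_gen_family) (auto intro!: module.span_base[OF module_mult] simp: eq)
  next
    case False
    then show ?thesis using g0[of j] by (intro exI[of _ "\<lambda>_. 0"]) simp
  qed
  have fg: "f j = (\<Sum>b<l. ?h j b * g b)" for j
    using h[of j] f0[of j] by (cases "j < r") auto
  show ?thesis by (rule model_relation_transfer[where f = f and h = ?h and l = l and g = g, OF fg _ gf r rel]) simp
qed

lemma model_relation_diff:
  assumes "model_relation r f b" "model_relation r f c" shows "model_relation r f (b - c)"
  using Vfilt_diff[OF assms[unfolded model_relation_def]]
  by (simp add: model_relation_def single_diff left_diff_distrib)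

lemma model_relation_add:
  assumes "model_relation r f b" "model_relation r f c" shows "model_relation r f (b + c)"
  using Vfilt.add[OF assms[unfolded model_relation_def]]
  by (simp add: model_relation_def single_add distrib_right)

lemma model_relation_smult:
  assumes "model_relation r f b" shows "model_relation r f (smult c b)"
  using Vfilt.mono[OF assms[unfolded model_relation_def], of 0 c]
  by (simp add: model_relation_def mult_single flip: mult.assoc)

text \<open>
  Multiplication by \<open>s = \<Sum>\<^sub>j s\<^sub>j\<close> is the operator \<open>\<Sum>\<^sub>j tau\<^sub>j t\<^sub>j\<close>.  So the polynomials that satisfy
  the relation form an ideal, and the minimal one divides all others.
\<close>

lemma model_relation_X:
  assumes f0: "\<And>j. j \<ge> r \<Longrightarrow> f j = 0" and r: "0 < r" and b: "model_relation r f b"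
  shows "model_relation r f (pCons 0 b)"
proof -
  let ?H = "\<lambda>M. single 0 (poly b (of_nat (size M))) * gen_prod f M"
  have V: "Vfilt r f 1 (tau j (tshift {#j#} ?H))" if "j < r" for j
    using b that by (intro Vfilt.tau Vfilt.shift) (simp_all add: model_relation_def)
  have "Vfilt r f 1 (\<lambda>M. \<Sum>j<r. tau j (tshift {#j#} ?H) M)"
    using V by (intro Vfilt_sum[OF V[OF r]]) auto
  also have "(\<lambda>M. \<Sum>j<r. tau j (tshift {#j#} ?H) M) = (\<lambda>M. single 0 (poly (pCons 0 b) (of_nat (size M))) * gen_prod f M)"
  proof
    fix M
    have t: "tau j (tshift {#j#} ?H) M = of_nat (count M j) * ?H M" for j
      by (cases "j \<in># M") (simp_all only: tau_def tshift_single insert_DiffM not_in_iff of_nat_0 mult_zero_left)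
    show "(\<Sum>j<r. tau j (tshift {#j#} ?H) M) = single 0 (poly (pCons 0 b) (of_nat (size M))) * gen_prod f M"
    proof (cases "set_mset M \<subseteq> {..<r}")
      case True
      have "(\<Sum>j<r. tau j (tshift {#j#} ?H) M) = of_nat (size M) * ?H M"
        unfolding t size_conv_sum[OF True] by (simp only: sum_distrib_right)
      then show ?thesis by (simp add: of_nat_mult_single)
    next
      case False
      then obtain j where j: "j \<in># M" "j \<notin> {..<r}" by blast
      then have "gen_prod f (add_mset j (M - {#j#})) = 0" using f0[of j] by (simp only: gen_prod_add_mset) simp
      then have "gen_prod f M = 0" using j(1) by simp
      then show ?thesis unfolding t by simp
    qed
  qed
  finally show ?thesis by (simp add: model_relation_def)
qed

lemma model_relation_mult:
  assumes f0: "\<And>j. j \<ge> r \<Longrightarrow> f j = 0" and r: "0 < r" and b: "model_relation r f b"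
  shows "model_relation r f (p * b)"
proof (induction p)
  case 0
  show ?case using model_relation_smult[OF b, of 0] by simp
next
  case (pCons c p)
  have "model_relation r f (smult c b + pCons 0 (p * b))"
    by (intro model_relation_add model_relation_smult b model_relation_X[OF f0 r pCons.IH])
  then show ?case by simp
qed

lemma gen_seq_image: "gen_seq fs ` {..<length fs} = set fs"
  by (force simp: gen_seq_def set_conv_nth image_iff)

lemma bernstein_sato_relation_monomial_gens:
  fixes I :: "'n::{finite,linorder} cpoly set"
  assumes nz: "0 \<notin> set fs" and ne: "fs \<noteq> []" and fs: "ideal_gen (set fs) = I"
    and r: "0 < r" and a: "I = mono_ideal r a"
  shows "bernstein_sato_relation fs b \<longleftrightarrow> model_relation r (monomial_gens r a) b"
proof -
  have "monomial_gens r a ` {..<r} = xmonom ` a ` {..<r}" unfolding image_image by (rule image_cong) (auto simp: monomial_gens_def)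
  then have eq: "ideal_gen (monomial_gens r a ` {..<r}) = ideal_gen (gen_seq fs ` {..<length fs})"
    using fs a by (simp add: gen_seq_image)
  show ?thesis
    unfolding bernstein_sato_relation_iff[OF nz ne]
  proof
    assume "model_relation (length fs) (gen_seq fs) b"
    then show "model_relation r (monomial_gens r a) b"
      by (rule model_relation_same_ideal[rotated -1]) (use eq r in \<open>auto simp: monomial_gens_def gen_seq_def\<close>)
  next
    assume "model_relation r (monomial_gens r a) b"
    then show "model_relation (length fs) (gen_seq fs) b"
      by (rule model_relation_same_ideal[rotated -1]) (use eq ne in \<open>auto simp: monomial_gens_def gen_seq_def\<close>)
  qed
qed

text \<open>
  A monomial ideal with finitely many generators needs only the finitely many monomials that
  occur when these are expressed.
\<close>

lemma finite_monomial_generators: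
  assumes "finite F" "ideal_gen F = ideal_gen (xmonom ` U)"
  shows "\<exists>U'. finite U' \<and> ideal_gen F = ideal_gen (xmonom ` U')"
proof -
  have "\<exists>T. finite T \<and> T \<subseteq> U \<and> p \<in> ideal_gen (xmonom ` T)" if "p \<in> F" for p
  proof -
    have "p \<in> ideal_gen (xmonom ` U)" using that assms(2) module.span_base[OF module_mult] by blast
    then obtain t k where t: "finite t" "t \<subseteq> xmonom ` U" "p = (\<Sum>x\<in>t. k x * x)"
      unfolding module.span_explicit[OF module_mult] by blast
    obtain T where T: "T \<subseteq> U" "finite T" "t = xmonom ` T" using finite_subset_image[OF t(1,2)] by blast
    have "p \<in> ideal_gen (xmonom ` T)"
      unfolding t(3) T(3) by (intro module.span_sum[OF module_mult] module.span_scale[OF module_mult] module.span_base[OF module_mult])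
    with T show ?thesis by blast
  qed
  then obtain T where T: "\<And>p. p \<in> F \<Longrightarrow> finite (T p) \<and> T p \<subseteq> U \<and> p \<in> ideal_gen (xmonom ` T p)" by metis
  let ?U = "\<Union>p\<in>F. T p"
  have "F \<subseteq> ideal_gen (xmonom ` ?U)"
  proof
    fix p assume p: "p \<in> F"
    have "ideal_gen (xmonom ` T p) \<subseteq> ideal_gen (xmonom ` ?U)" using p by (intro module.span_mono[OF module_mult]) blast
    with T[OF p] show "p \<in> ideal_gen (xmonom ` ?U)" by blast
  qed
  then have "ideal_gen F \<subseteq> ideal_gen (xmonom ` ?U)"
    by (intro module.span_minimal[OF module_mult] module.subspace_span[OF module_mult])
  moreover have "ideal_gen (xmonom ` ?U) \<subseteq> ideal_gen F"
    unfolding assms(2) using T by (intro module.span_mono[OF module_mult]) blast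
  moreover have "finite ?U" using assms(1) T by blast
  ultimately show ?thesis by blast
qed

text \<open>
  The minimal polynomial \<open>b\<close> divides the product of linear factors given by
  \<open>model_relation_exists\<close>, so each of its roots is the sum of a stuck point and thereby an element
  of some \<open>R\<^sub>Q\<close>.  Conversely an element of \<open>R\<^sub>Q\<close> is the sum of a stuck point for suitable monomial
  generators, and \<open>b\<close> satisfies the relation for these generators too.
\<close>

theorem theorem1p1:
  fixes I :: "'n::{finite,linorder} cpoly set" and fs :: "'n cpoly list"
  assumes "monomial_ideal I"
    and "I \<noteq> {0}"
    and "0 \<notin> set fs"
    and "ideal_gen (set fs) = I"
  shows "{z. poly (bernstein_sato_poly fs) z = 0} =
    complex_of_real ` (\<Union>Q\<in>relevant_faces I. R_face I Q)"
proof -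
  have ne: "fs \<noteq> []"
  proof
    assume "fs = []"
    then have "I = ideal_gen {}" using assms(4) by simp
    then show False using assms(2) unfolding module.span_empty[OF module_mult] by blast
  qed
  obtain U0 where "I = ideal_gen (xmonom ` U0)" using assms(1) unfolding monomial_ideal_def by blast
  then obtain U where U: "finite U" "I = ideal_gen (xmonom ` U)"
    using finite_monomial_generators[of "set fs" U0] assms(4) by auto
  obtain ul where ul: "set ul = U" using finite_list[OF U(1)] by blast
  define r where "r = length ul"
  define a where "a j = ul ! j" for j
  have "a ` {..<r} = U" using ul by (auto simp: a_def r_def set_conv_nth)
  then have a: "I = mono_ideal r a" using U(2) by simp
  have "U \<noteq> {}"
  proof
    assume "U = {}"
    then have "I = ideal_gen {}" using U(2) by simp
    then show False using assms(2) unfolding module.span_empty[OF module_mult] by blast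
  qed
  then have r: "0 < r" using ul by (auto simp: r_def)
  note rel_iff = bernstein_sato_relation_monomial_gens[OF assms(3) ne assms(4)]
  obtain cs where cs: "\<forall>c\<in>set cs. \<exists>z. stuck r a z \<and> c = (\<Sum>j<r. z j)"
    and rel0: "model_relation r (monomial_gens r a) (\<Prod>c\<leftarrow>cs. [:- c, 1:])"
    using model_relation_exists[OF r, of a] stuck_in_R_face[OF r a] by (metis Reals_of_real)
  let ?b0 = "\<Prod>c\<leftarrow>cs. [:- c, 1:]"
  let ?P = "\<lambda>b. lead_coeff b = 1 \<and> bernstein_sato_relation fs b"
  define b where "b = bernstein_sato_poly fs"
  have "lead_coeff (\<Prod>c\<leftarrow>ds. [:- c, 1:]) = 1" for ds :: "complex list"
  proof (induction ds)
    case (Cons d ds)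
    then show ?case by (simp only: list.map prod_list.Cons lead_coeff_mult) simp
  qed simp
  then have "?P ?b0" using rel0 rel_iff[OF r a] by simp
  from arg_min_nat_lemma[of ?P, OF this, of Polynomial.degree]
  have b: "lead_coeff b = 1" "bernstein_sato_relation fs b"
    and min: "\<And>c. lead_coeff c = 1 \<Longrightarrow> bernstein_sato_relation fs c \<Longrightarrow> Polynomial.degree b \<le> Polynomial.degree c"
    unfolding b_def bernstein_sato_poly_def by blast+
  have "b \<noteq> 0" using b(1) by auto
  have sb: "model_relation r (monomial_gens r a) b" using b(2) rel_iff[OF r a] by simp
  have "?b0 mod b = 0"
  proof (rule ccontr)
    let ?m = "?b0 mod b"
    assume m: "?m \<noteq> 0"
    have "model_relation r (monomial_gens r a) (?b0 - ?b0 div b * b)"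
      by (intro model_relation_diff rel0 model_relation_mult[OF _ r sb]) (simp add: monomial_gens_def)
    then have "model_relation r (monomial_gens r a) ?m" by (simp add: minus_div_mult_eq_mod)
    then have "model_relation r (monomial_gens r a) (smult (1 / lead_coeff ?m) ?m)" by (rule model_relation_smult)
    then have "Polynomial.degree b \<le> Polynomial.degree (smult (1 / lead_coeff ?m) ?m)"
      using m rel_iff[OF r a] by (intro min) (simp_all add: lead_coeff_smult)
    also have "\<dots> \<le> Polynomial.degree ?m" by (rule degree_smult_le)
    finally show False using degree_mod_less[OF \<open>b \<noteq> 0\<close>, of ?b0] m by simp
  qed
  then have dvd: "b dvd ?b0" by (simp add: dvd_eq_mod_eq_0)
  have roots0: "poly ?b0 z = 0 \<longleftrightarrow> z \<in> set cs" for z by (induction cs) auto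
  show ?thesis
    unfolding b_def[symmetric]
  proof (intro equalityI subsetI)
    fix z assume "z \<in> {z. poly b z = 0}"
    then have "poly ?b0 z = 0" using dvd by (auto elim!: dvdE)
    then obtain s where s: "stuck r a s" "z = (\<Sum>j<r. s j)" using cs roots0 by blast
    from stuck_in_R_face[OF r a s(1)] s(2) show "z \<in> complex_of_real ` (\<Union>Q\<in>relevant_faces I. R_face I Q)" by blast
  next
    fix z assume "z \<in> complex_of_real ` (\<Union>Q\<in>relevant_faces I. R_face I Q)"
    then obtain Q \<rho> where Q: "Q \<in> relevant_faces I" "\<rho> \<in> R_face I Q" "z = complex_of_real \<rho>" by blast
    obtain r' a' s where s: "0 < r'" "I = mono_ideal r' a'" "stuck r' a' s" "(\<Sum>j<r'. s j) = complex_of_real \<rho>"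
      using R_face_attained[OF U(2,1) Q(1,2)] by blast
    have "model_relation r' (monomial_gens r' a') b" using b(2) rel_iff[OF s(1,2)] by simp
    from model_relation_root[OF this s(3)] show "z \<in> {z. poly b z = 0}" by (simp add: s(4) Q(3))
  qed
qed

end
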